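(* Let $M$ be a loopless matroid of rank $r+1$ on the ground set $\{0,\ldots,n\}$ with Tutte polynomial $T_M(x,y)$. Then for $0\le i\le n-r$ the coefficient of $y^i$ in $T_M(1,y)$ is $$[y^i]T_M(1,y)=\frac{1}{r!}\deg_{A^\bullet(M)}(\gamma_{i+1}\gamma_{i+2}\cdots\gamma_{i+r}).$$
   Context: For a loopless matroid $M$ of rank $r+1$ on $\{0,\ldots,n\}$, $$A^\bullet(M)=\mathbb{Z}[x_F: F\text{ a flat},\ \emptyset\ne F\ne\{0,\ldots,n\}]/(I_M+J_M),$$ where $I_M$ is generated by the products $x_Fx_G$ with $F,G$ incomparable, and $J_M$ is generated by the elements $\sum_{F\ni i}x_F-\sum_{F\ni j}x_F$ for $0\le i<j\le n$. The degree map $\deg_{A^\bullet(M)}:A^r(M)\to\mathbb{Z}$ is the isomorphism sending $x_{F_1}\cdots x_{F_r}$ to $1$ for every maximal chain $\emptyset\subsetneq F_1\subsetneq\cdots\subsetneq F_r\subsetneq\{0,\ldots,n\}$ of flats. For $1\le k\le n$, $\gamma_k\in A^1(M)$ is the class attached to the hypersimplex $P_{k,n+1}=[0,1]^{n+1}\cap\{\sum x_i=k\}$ via its support function, namely $$\gamma_k=\sum_{F}\left(\min(k,|F|)-|F\cap V|\right)x_F,$$ the sum over flats $F\neq\emptyset,\{0,\ldots,n\}$, where $V\subset\{0,\ldots,n\}$ is any fixed subset of size $k$ (the class is independent of the choice of $V$). *)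

theory Defs
  imports
    "HOL-Algebra.QuotRing"
    "HOL-Algebra.Elementary_Groups"
    "HOL-Library.Poly_Mapping"
    "HOL-Computational_Algebra.Polynomial"
begin

section \<open>Matroids\<close>

record 'a matroid =
  ground :: "'a set"
  indep :: "'a set \<Rightarrow> bool"

definition is_matroid :: "'a matroid \<Rightarrow> bool" where
  "is_matroid M \<longleftrightarrow>
     finite (ground M) \<and>
     (\<forall>A. indep M A \<longrightarrow> A \<subseteq> ground M) \<and>
     indep M {} \<and>
     (\<forall>A B. indep M B \<and> A \<subseteq> B \<longrightarrow> indep M A) \<and>
     (\<forall>A B. indep M A \<and> indep M B \<and> card A < card B \<longrightarrow>
        (\<exists>e\<in>B - A. indep M (insert e A)))"

definition loopless :: "'a matroid \<Rightarrow> bool" where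
  "loopless M \<longleftrightarrow> (\<forall>e\<in>ground M. indep M {e})"

definition rank_of :: "'a matroid \<Rightarrow> 'a set \<Rightarrow> nat" where
  "rank_of M A = Max (card ` {B. B \<subseteq> A \<and> indep M B})"

abbreviation matroid_rank :: "'a matroid \<Rightarrow> nat" where
  "matroid_rank M \<equiv> rank_of M (ground M)"

definition is_flat :: "'a matroid \<Rightarrow> 'a set \<Rightarrow> bool" where
  "is_flat M F \<longleftrightarrow>
     F \<subseteq> ground M \<and> (\<forall>e\<in>ground M - F. rank_of M F < rank_of M (insert e F))"

definition proper_flats :: "'a matroid \<Rightarrow> 'a set set" where
  "proper_flats M = {F. is_flat M F \<and> F \<noteq> {} \<and> F \<noteq> ground M}"

text \<open>
  The Tutte polynomial as an element of \<open>\<int>[y][x]\<close>: the indeterminate of the outer polynomial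
  is \<open>x\<close>, the indeterminate of the coefficients is \<open>y\<close>.
\<close>

definition tutte :: "'a matroid \<Rightarrow> int poly poly" where
  "tutte M = (\<Sum>A\<in>Pow (ground M).
     [:-1, 1:] ^ (matroid_rank M - rank_of M A) * [:[:-1, 1:]:] ^ (card A - rank_of M A))"


section \<open>The Chow ring\<close>

text \<open>
  Polynomials over \<open>\<int>\<close> with indeterminates indexed by \<open>'v\<close>: finitely supported maps from
  exponent vectors to integers.
\<close>

type_synonym 'v int_mpoly = "('v \<Rightarrow>\<^sub>0 nat) \<Rightarrow>\<^sub>0 int"

definition mvar :: "'v \<Rightarrow> 'v int_mpoly" where
  "mvar v = Poly_Mapping.single (Poly_Mapping.single v 1) 1"

definition homogeneous :: "nat \<Rightarrow> 'v int_mpoly \<Rightarrow> bool" where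
  "homogeneous d p \<longleftrightarrow> (\<forall>m\<in>Poly_Mapping.keys p. (\<Sum>v\<in>Poly_Mapping.keys m. Poly_Mapping.lookup m v) = d)"

definition flat_poly_ring :: "'a matroid \<Rightarrow> 'a set int_mpoly ring" where
  "flat_poly_ring M =
     \<lparr>carrier = {p. \<forall>m\<in>Poly_Mapping.keys p. Poly_Mapping.keys m \<subseteq> proper_flats M},
      monoid.mult = (*), one = 1, ring.zero = 0, add = (+)\<rparr>"

definition incomparable_ideal :: "'a matroid \<Rightarrow> 'a set int_mpoly set" where
  "incomparable_ideal M = Idl\<^bsub>flat_poly_ring M\<^esub>
     {mvar F * mvar G | F G. F \<in> proper_flats M \<and> G \<in> proper_flats M \<and> \<not> F \<subseteq> G \<and> \<not> G \<subseteq> F}"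

definition linear_ideal :: "'a matroid \<Rightarrow> 'a set int_mpoly set" where
  "linear_ideal M = Idl\<^bsub>flat_poly_ring M\<^esub>
     {(\<Sum>F\<in>{F \<in> proper_flats M. i \<in> F}. mvar F) - (\<Sum>F\<in>{F \<in> proper_flats M. j \<in> F}. mvar F) | i j.
        i \<in> ground M \<and> j \<in> ground M}"

definition chow_ideal :: "'a matroid \<Rightarrow> 'a set int_mpoly set" where
  "chow_ideal M = incomparable_ideal M <+>\<^bsub>flat_poly_ring M\<^esub> linear_ideal M"

definition chow_ring :: "'a matroid \<Rightarrow> 'a set int_mpoly set ring" where
  "chow_ring M = flat_poly_ring M Quot chow_ideal M"

definition chow_class :: "'a matroid \<Rightarrow> 'a set int_mpoly \<Rightarrow> 'a set int_mpoly set" where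
  "chow_class M p = chow_ideal M +>\<^bsub>flat_poly_ring M\<^esub> p"

definition chow_group :: "'a matroid \<Rightarrow> nat \<Rightarrow> 'a set int_mpoly set monoid" where
  "chow_group M d = (add_monoid (chow_ring M))
     \<lparr>carrier := chow_class M ` {p \<in> carrier (flat_poly_ring M). homogeneous d p}\<rparr>"


section \<open>The degree map and the hypersimplex classes\<close>

text \<open>
  In a matroid of rank \<open>r + 1\<close>, every strict chain of \<open>r\<close> proper nonempty flats is maximal.
\<close>

definition maximal_chain :: "'a matroid \<Rightarrow> 'a set list \<Rightarrow> bool" where
  "maximal_chain M Fs \<longleftrightarrow>
     length Fs + 1 = matroid_rank M \<and> set Fs \<subseteq> proper_flats M \<and> sorted_wrt (\<subset>) Fs"

text \<open>
  The degree map is a function on the top graded piece only; extensionality fixes its (irrelevant)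
  values elsewhere, so that the description is unique.
\<close>

definition degree_map :: "'a matroid \<Rightarrow> 'a set int_mpoly set \<Rightarrow> int" where
  "degree_map M = (THE d.
     d \<in> iso (chow_group M (matroid_rank M - 1)) integer_group \<and>
     d \<in> extensional (carrier (chow_group M (matroid_rank M - 1))) \<and>
     (\<forall>Fs. maximal_chain M Fs \<longrightarrow> d (chow_class M (\<Prod>F\<leftarrow>Fs. mvar F)) = 1))"

text \<open>
  The class attached to the hypersimplex \<open>P\<^bsub>k,n+1\<^esub>\<close> for a matroid on \<open>{0..n}\<close> and
  \<open>1 \<le> k \<le> n\<close>. It depends on the choice of a subset \<open>V\<close> of size \<open>k\<close> of the ground set only up
  to an element of the linear ideal; here \<open>V = {0, \<dots>, k - 1}\<close>.
\<close>

definition hypersimplex_class :: "nat matroid \<Rightarrow> nat \<Rightarrow> nat set int_mpoly set" where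
  "hypersimplex_class M k = chow_class M
     (\<Sum>F\<in>proper_flats M. of_int (int (min k (card F)) - int (card (F \<inter> {..<k}))) * mvar F)"

end

theory Submission
  imports Defs
begin

text \<open>
  The degree of a product of divisor classes is computed by tropical intersection: cutting a flag of
  flats by a function on flats weighs each flat that refines the flag by the difference between the
  function and an additive interpolant of it. The partition property of the covers of a flat
  (the balancing condition) makes this independent of the interpolant and symmetric in the functions,
  which yields the degree map.

  The class \<open>\<gamma>\<^bsub>k\<^esub>\<close> is represented by \<open>F \<mapsto> min k |F|\<close>, whose negative second difference in \<open>k\<close> is
  the sum of the \<open>x\<^bsub>F\<^esub>\<close> with \<open>|F| = k\<close>. Hence \<open>c \<mapsto> deg (\<gamma>\<^bsub>c\<^esub> \<gamma>\<^bsub>i+1\<^esub> \<dots> \<gamma>\<^bsub>i+r-1\<^esub>)\<close> solves a discrete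
  Poisson equation with zero boundary values at \<open>c = 0\<close> and \<open>c = n + 1\<close>. Its source vanishes for
  \<open>i < c < i + r\<close>; for larger \<open>c\<close> it only sees hyperplanes of size \<open>c\<close>, and for smaller \<open>c\<close> only
  flats of rank one. Solving the equation expresses the degree through restrictions to
  hyperplanes and contractions of rank-one flats, and \<open>T\<^bsub>M\<^esub>(1, y)\<close>, written as a sum over spanning
  sets, satisfies the same recurrence.
\<close>

section \<open>Flags of flats and iterated intersection numbers\<close>

text \<open>The degree map is a definite description, so the top graded piece has to be identified
  with the integers before anything can be computed. Two halves meet there: every word of degree
  \<open>r\<close> reduces modulo the relations to an integer multiple of one class, and the
  intersection numbers give a functional that kills the ideal and is 1 on complete flags, so this
  class has infinite order. The induction in the main computation passes to minors, but it stays
  inside one lattice of flats. The minor belonging to an interval from \<open>A\<close> to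
  \<open>B\<close> is encoded by a flag that has members of all ranks outside the gap between
  \<open>A\<close> and \<open>B\<close>; for this reason intersection numbers start from an
  arbitrary flag. The factorial is collected one factor at a time: the recurrence for the
  coefficients of T(1, y) carries on its left side a factor equal to the number of classes in the
  product. Commutativity is essential, because each induction step takes the class of largest index
  out of the product, puts it first and lets its index vary.\<close>

locale flat_system =
  fixes E :: "'a set" and L :: "'a set set" and rk :: "'a set \<Rightarrow> nat" and r :: nat
  assumes finite_ground: "finite E"
    and flat_subset: "F \<in> L \<Longrightarrow> F \<subseteq> E"
    and empty_flat: "{} \<in> L"
    and ground_flat: "E \<in> L"
    and rk_empty: "rk {} = 0"
    and rk_ground: "rk E = Suc r"
    and rk_strict: "\<lbrakk>F \<in> L; G \<in> L; F \<subset> G\<rbrakk> \<Longrightarrow> rk F < rk G"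
    and cover_exists: "\<lbrakk>F \<in> L; e \<in> E - F\<rbrakk> \<Longrightarrow>
      \<exists>H\<in>L. insert e F \<subseteq> H \<and> rk H = Suc (rk F) \<and> (\<forall>G\<in>L. insert e F \<subseteq> G \<longrightarrow> H \<subseteq> G)"
begin

text \<open>Both \<open>{}\<close> and \<open>E\<close> are members, so a complete flag has
  \<open>r + 2\<close> members and every interpolant has a prescribed total on
  \<open>E\<close>.\<close>

definition flag :: "'a set set \<Rightarrow> bool" where
  "flag \<sigma> \<longleftrightarrow> \<sigma> \<subseteq> L \<and> {} \<in> \<sigma> \<and> E \<in> \<sigma> \<and> (\<forall>F\<in>\<sigma>. \<forall>G\<in>\<sigma>. F \<subseteq> G \<or> G \<subseteq> F)"

definition link :: "'a set set \<Rightarrow> 'a set set" where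
  "link \<sigma> = {F \<in> L - \<sigma>. \<forall>G\<in>\<sigma>. F \<subseteq> G \<or> G \<subseteq> F}"

text \<open>In terms of the Bergman fan, \<open>\<phi>\<close> is a piecewise linear function, a
  flag is a cone, and an interpolant is a linear function agreeing with \<open>\<phi>\<close> on
  that cone. Additive functions vanish at \<open>{}\<close>, hence the normalisation.\<close>

definition interpolates :: "('a \<Rightarrow> rat) \<Rightarrow> ('a set \<Rightarrow> rat) \<Rightarrow> 'a set set \<Rightarrow> bool" where
  "interpolates a \<phi> \<sigma> \<longleftrightarrow> (\<forall>F\<in>\<sigma>. sum a F = \<phi> F - \<phi> {})"

text \<open>Only meaningful when \<open>\<sigma>\<close> is a flag and \<open>card \<sigma> + length q = r + 2\<close>, so that the recursion ends in
  a complete flag.\<close>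

fun inter_num :: "'a set set \<Rightarrow> ('a set \<Rightarrow> rat) list \<Rightarrow> rat" where
  "inter_num \<sigma> [] = 1"
| "inter_num \<sigma> (\<phi> # q) = (\<Sum>F\<in>link \<sigma>.
     (\<phi> F - \<phi> {} - sum (SOME a. interpolates a \<phi> \<sigma>) F) * inter_num (insert F \<sigma>) q)"

declare inter_num.simps(2) [simp del]

lemma finite_flat: "F \<in> L \<Longrightarrow> finite F"
  using flat_subset finite_ground by (meson finite_subset)

lemma finite_flats: "finite L"
  using flat_subset finite_ground by (meson PowI finite_Pow_iff finite_subset subsetI)

lemma finite_link [simp]: "finite (link \<sigma>)"
  using finite_flats by (auto simp: link_def)

lemma flag_finite: "flag \<sigma> \<Longrightarrow> finite \<sigma>"
  using finite_flats finite_subset by (auto simp: flag_def)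

lemma flag_insert: "flag \<sigma> \<Longrightarrow> F \<in> link \<sigma> \<Longrightarrow> flag (insert F \<sigma>)"
  by (auto simp: flag_def link_def)

lemma flag_insert_card: "flag \<sigma> \<Longrightarrow> F \<in> link \<sigma> \<Longrightarrow> card (insert F \<sigma>) = Suc (card \<sigma>)"
  using flag_finite by (auto simp: link_def)

lemma link_insert: "F \<in> link \<sigma> \<Longrightarrow>
  link (insert F \<sigma>) = {G \<in> link \<sigma>. G \<noteq> F \<and> (F \<subseteq> G \<or> G \<subseteq> F)}"
  by (auto simp: link_def)

lemma link_sub: "F \<in> link \<sigma> \<Longrightarrow> F \<in> L"
  by (auto simp: link_def)

text \<open>The largest member of a chain has an element \<open>e\<close> outside all smaller
  members, so changing the value at \<open>e\<close> alone repairs the sum on that member. No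
  division occurs, and the values lie in any abelian group: integral interpolants are used for the
  reduction to one generator, rational ones for intersection numbers.\<close>

lemma chain_interpolation:
  fixes \<phi> :: "'a set \<Rightarrow> 'b :: ab_group_add"
  assumes "flag \<sigma>"
  shows "\<exists>a. \<forall>F\<in>\<sigma>. sum a F = \<phi> F - \<phi> {}"
proof -
  \<comment> \<open>Stated for arbitrary finite chains of flats, since deleting the largest member
    of a flag removes \<open>E\<close>.\<close>
  have "\<exists>a. \<forall>F\<in>\<tau>. sum a F = \<phi> F - \<phi> {}"
    if "finite \<tau>" "\<tau> \<subseteq> L" "\<forall>F\<in>\<tau>. \<forall>G\<in>\<tau>. F \<subseteq> G \<or> G \<subseteq> F" for \<tau>
    using that
  proof (induction "card \<tau>" arbitrary: \<tau>)
    case 0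
    then show ?case by auto
  next
    case (Suc k)
    have "\<tau> \<noteq> {}" using Suc.hyps(2) by auto
    then obtain M where M: "M \<in> \<tau>" "\<And>F. F \<in> \<tau> \<Longrightarrow> M \<subseteq> F \<Longrightarrow> M = F"
      using finite_has_maximal[OF Suc.prems(1)] by auto
    then have M_max: "F \<subseteq> M" if "F \<in> \<tau>" for F
      using Suc.prems(3) that by blast
    define U where "U = \<Union>(\<tau> - {M})"
    have "card (\<tau> - {M}) = k" using Suc M by (metis card_Diff_singleton diff_Suc_1)
    then obtain a where a: "\<forall>F\<in>\<tau> - {M}. sum a F = \<phi> F - \<phi> {}"
      using Suc.hyps(1)[of "\<tau> - {M}"] Suc.prems by (metis Diff_iff Diff_subset finite_Diff subset_trans)
    have finM: "finite M" using M Suc.prems(2) finite_flat by auto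
    show ?case
    proof (cases "M = {}")
      case True
      then have "\<forall>F\<in>\<tau>. F = {}" using M_max by blast
      then show ?thesis by (intro exI[of _ "\<lambda>_. 0"]) force
    next
      case False
      have "\<exists>e\<in>M. e \<notin> U"
      proof (cases "\<tau> - {M} = {}")
        case True then show ?thesis using False U_def by auto
      next
        case ne: False
        obtain N where N: "N \<in> \<tau> - {M}" "\<And>F. F \<in> \<tau> - {M} \<Longrightarrow> N \<subseteq> F \<Longrightarrow> N = F"
          using finite_has_maximal[of "\<tau> - {M}"] ne Suc.prems(1) by auto
        then have "F \<subseteq> N" if "F \<in> \<tau> - {M}" for F
          using Suc.prems(3) that by (metis Diff_iff subset_refl)
        then have "U \<subseteq> N" unfolding U_def by blast
        moreover have "N \<subset> M" using N M_max by blast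
        ultimately show ?thesis by blast
      qed
      then obtain e where e: "e \<in> M" "e \<notin> U" by auto
      define b where "b = a(e := \<phi> M - \<phi> {} - sum a (M - {e}))"
      have "sum b M = \<phi> M - \<phi> {}"
      proof -
        have "sum b M = b e + sum b (M - {e})" using e finM by (meson sum.remove)
        also have "sum b (M - {e}) = sum a (M - {e})" by (rule sum.cong) (auto simp: b_def)
        finally show ?thesis by (simp add: b_def)
      qed
      moreover have "sum b F = \<phi> F - \<phi> {}" if "F \<in> \<tau> - {M}" for F
      proof -
        have "e \<notin> F" using e that U_def by auto
        then have "sum b F = sum a F" by (intro sum.cong) (auto simp: b_def)
        then show ?thesis using a that by auto
      qed
      ultimately show ?thesis by blast
    qed
  qed
  from this[OF flag_finite[OF assms]] assms show ?thesis
    by (auto simp: flag_def)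
qed

lemma interpolates_exists: "flag \<sigma> \<Longrightarrow> \<exists>a. interpolates a \<phi> \<sigma>"
  unfolding interpolates_def by (rule chain_interpolation)

lemma link_cover_unique:
  assumes "F \<in> L" "G \<in> L" "H \<in> L" "insert e F \<subseteq> G" "insert e F \<subseteq> H"
    "rk G = Suc (rk F)" "rk H = Suc (rk F)" "e \<notin> F"
  shows "G = H"
proof -
  obtain K where K: "K \<in> L" "insert e F \<subseteq> K" "rk K = Suc (rk F)"
     "\<forall>G\<in>L. insert e F \<subseteq> G \<longrightarrow> K \<subseteq> G"
    using cover_exists[of F e] assms flat_subset by blast
  have "K = G" using K assms rk_strict[of K G] by (metis less_irrefl psubsetI)
  moreover have "K = H" using K assms rk_strict[of K H] by (metis less_irrefl psubsetI)
  ultimately show ?thesis by simp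
qed

lemma flag_rk_inj: "flag \<sigma> \<Longrightarrow> inj_on rk \<sigma>"
  by (rule inj_onI) (metis flag_def less_irrefl psubsetI rk_strict subsetD)

lemma flag_rk_mono: "flag \<sigma> \<Longrightarrow> F \<in> \<sigma> \<Longrightarrow> G \<in> \<sigma> \<Longrightarrow> rk F \<le> rk G \<longleftrightarrow> F \<subseteq> G"
  by (metis flag_def leD le_less psubsetI rk_strict subsetD subset_refl flag_rk_inj inj_onD order_refl)

lemma rk_le: "F \<in> L \<Longrightarrow> rk F \<le> Suc r"
  using rk_strict[of F E] flat_subset ground_flat rk_ground by (metis le_less psubsetI)

lemma flag_rk_image: "flag \<sigma> \<Longrightarrow> rk ` \<sigma> \<subseteq> {..Suc r}"
  using rk_le by (auto simp: flag_def)

text \<open>Each \<open>e\<close> in \<open>B - A\<close> lies in exactly one cover of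
  \<open>A\<close>, and this cover stays inside \<open>B\<close> because it is the least flat
  containing \<open>insert e A\<close>. The values are general because the same partition later
  groups sums of polynomials.\<close>

lemma sum_flats_cover:
  assumes "A \<in> L" "B \<in> L" "A \<subseteq> B"
  shows "(\<Sum>F\<in>{F\<in>L. A \<subseteq> F \<and> F \<subseteq> B \<and> rk F = Suc (rk A)}. sum a (F - A)) = sum (a::'a \<Rightarrow> 'b::comm_monoid_add) (B - A)"
proof -
  let ?S = "{F\<in>L. A \<subseteq> F \<and> F \<subseteq> B \<and> rk F = Suc (rk A)}"
  have "sum a (\<Union>F\<in>?S. F - A) = (\<Sum>F\<in>?S. sum a (F - A))"
  proof (rule sum.UNION_disjoint)
    show "finite ?S" using finite_flats by auto
    show "\<forall>F\<in>?S. finite (F - A)" using finite_flat by auto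
    show "\<forall>F\<in>?S. \<forall>G\<in>?S. F \<noteq> G \<longrightarrow> (F - A) \<inter> (G - A) = {}"
    proof (intro ballI impI)
      fix F G assume "F \<in> ?S" "G \<in> ?S" "F \<noteq> G"
      moreover have "F = G" if "e \<in> (F - A) \<inter> (G - A)" for e
        using link_cover_unique[OF assms(1), of F G e] that \<open>F \<in> ?S\<close> \<open>G \<in> ?S\<close> by simp
      ultimately show "(F - A) \<inter> (G - A) = {}" by auto
    qed
  qed
  moreover have "(\<Union>F\<in>?S. F - A) = B - A"
  proof
    show "B - A \<subseteq> (\<Union>F\<in>?S. F - A)"
    proof
      fix e assume e: "e \<in> B - A"
      then obtain H where "H \<in> L" "insert e A \<subseteq> H" "rk H = Suc (rk A)"
         "\<forall>G\<in>L. insert e A \<subseteq> G \<longrightarrow> H \<subseteq> G"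
        using cover_exists[of A e] assms flat_subset by blast
      then show "e \<in> (\<Union>F\<in>?S. F - A)" using e assms by blast
    qed
  qed auto
  ultimately show ?thesis by simp
qed

text \<open>Exactly one rank is missing from the flag. The flats that complete it are the covers of
  \<open>A\<close> inside \<open>B\<close>, for the two members next to the missing rank, and their
  sums add up to \<open>sum a B - sum a A\<close>.\<close>

lemma balanced_codim1:
  assumes "flag \<sigma>" "card \<sigma> = r + 1" "\<forall>F\<in>\<sigma>. sum a F = (0::rat)"
  shows "(\<Sum>F\<in>link \<sigma>. sum a F) = 0"
proof -
  have fl: "\<sigma> \<subseteq> L" "{} \<in> \<sigma>" "E \<in> \<sigma>" using assms by (auto simp: flag_def)
  have "card (rk ` \<sigma>) = r + 1" using assms card_image flag_rk_inj by fastforce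
  then have "card ({..Suc r} - rk ` \<sigma>) = 1"
    using flag_rk_image[OF assms(1)] by (simp add: card_Diff_subset flag_finite[OF assms(1)])
  then obtain t where t: "{..Suc r} - rk ` \<sigma> = {t}" using card_1_singletonE by blast
  have "t \<noteq> 0" using t fl rk_empty by (metis Diff_iff image_eqI insertI1)
  have "t \<noteq> Suc r" using t fl rk_ground by (metis Diff_iff image_eqI insertI1)
  have "t \<le> r" using t \<open>t \<noteq> Suc r\<close> by (metis Diff_iff atMost_iff insertI1 le_SucE)
  have "t - 1 \<in> rk ` \<sigma>" "Suc t \<in> rk ` \<sigma>"
  proof -
    have "k \<in> rk ` \<sigma>" if "k \<le> Suc r" "k \<noteq> t" for k
      using that t by blast
    then show "t - 1 \<in> rk ` \<sigma>" "Suc t \<in> rk ` \<sigma>"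
      using \<open>t \<noteq> 0\<close> \<open>t \<le> r\<close> by auto
  qed
  then obtain A B where A: "A \<in> \<sigma>" "rk A = t - 1" and B: "B \<in> \<sigma>" "rk B = Suc t" by auto
  have tA: "t = Suc (rk A)" using A \<open>t \<noteq> 0\<close> by simp
  have AB: "A \<subseteq> B" using flag_rk_mono[OF assms(1) A(1) B(1)] A B by linarith
  have "link \<sigma> = {F\<in>L. A \<subseteq> F \<and> F \<subseteq> B \<and> rk F = Suc (rk A)}"
  proof (intro equalityI subsetI)
    fix F assume F: "F \<in> link \<sigma>"
    have fl2: "flag (insert F \<sigma>)" using F assms flag_insert by auto
    have "F \<notin> \<sigma>" "F \<in> L" using F by (auto simp: link_def)
    then have "rk F \<notin> rk ` \<sigma>" using flag_rk_inj[OF fl2] by (auto simp: inj_on_def)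
    then have "rk F = t" using t rk_le[OF \<open>F \<in> L\<close>] by (metis Diff_iff atMost_iff singletonD)
    moreover have "A \<subseteq> F" "F \<subseteq> B"
      using flag_rk_mono[OF fl2, of A F] flag_rk_mono[OF fl2, of F B] A(1) B calculation tA by simp_all
    ultimately show "F \<in> {F\<in>L. A \<subseteq> F \<and> F \<subseteq> B \<and> rk F = Suc (rk A)}"
      using tA \<open>F \<in> L\<close> by simp
  next
    fix F assume F: "F \<in> {F\<in>L. A \<subseteq> F \<and> F \<subseteq> B \<and> rk F = Suc (rk A)}"
    have "rk F \<notin> rk ` \<sigma>" using F tA t by auto
    then have "F \<notin> \<sigma>" by auto
    moreover have "F \<subseteq> G \<or> G \<subseteq> F" if "G \<in> \<sigma>" for G
    proof (cases "rk G \<le> rk A")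
      case True
      then show ?thesis using flag_rk_mono[OF assms(1) that A(1)] F by auto
    next
      case False
      then have "rk G \<noteq> t" using t that by auto
      then have "rk B \<le> rk G" using False tA B by simp
      then show ?thesis using flag_rk_mono[OF assms(1) B(1) that] F by auto
    qed
    ultimately show "F \<in> link \<sigma>" using F by (auto simp: link_def)
  qed
  moreover have "sum a F = sum a (F - A)" if "F \<in> L" "A \<subseteq> F" for F
    using sum.subset_diff[OF that(2), of a] finite_flat[OF that(1)] assms(3) A by auto
  ultimately have "(\<Sum>F\<in>link \<sigma>. sum a F) =
      (\<Sum>F\<in>{F\<in>L. A \<subseteq> F \<and> F \<subseteq> B \<and> rk F = Suc (rk A)}. sum a (F - A))"
    by (auto intro!: sum.cong)
  also have "\<dots> = sum a (B - A)" using sum_flats_cover[of A B a] A(1) B(1) AB fl by auto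
  also have "\<dots> = sum a B - sum a A"
    using AB B fl finite_flat by (metis (no_types) sum_diff subsetD)
  finally show ?thesis using assms A B by simp
qed

lemma interpolates_some: "flag \<sigma> \<Longrightarrow> interpolates (SOME a. interpolates a \<phi> \<sigma>) \<phi> \<sigma>"
  using interpolates_exists[of \<sigma> \<phi>] by (rule someI_ex)

section \<open>Balancing along flags of every length\<close>

definition ordered_link_pairs :: "'a set set \<Rightarrow> ('a set \<times> 'a set) set" where
  "ordered_link_pairs \<sigma> = (SIGMA F:link \<sigma>. link (insert F \<sigma>))"

lemma swap_ordered_link_pairs: "prod.swap ` ordered_link_pairs \<sigma> = ordered_link_pairs \<sigma>"
proof -
  have "prod.swap p \<in> ordered_link_pairs \<sigma>" if "p \<in> ordered_link_pairs \<sigma>" for p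
    using that by (auto simp: ordered_link_pairs_def link_insert)
  then have "prod.swap ` ordered_link_pairs \<sigma> \<subseteq> ordered_link_pairs \<sigma>" by blast
  moreover from this have "prod.swap ` prod.swap ` ordered_link_pairs \<sigma> \<subseteq> prod.swap ` ordered_link_pairs \<sigma>"
    by (rule image_mono)
  ultimately show ?thesis by (simp add: image_image)
qed

lemma sum_link_swap:
  "(\<Sum>F\<in>link \<sigma>. \<Sum>G\<in>link (insert F \<sigma>). h F G) = (\<Sum>F\<in>link \<sigma>. \<Sum>G\<in>link (insert F \<sigma>). h G F :: rat)"
proof -
  have "(\<Sum>F\<in>link \<sigma>. \<Sum>G\<in>link (insert F \<sigma>). h F G) = (\<Sum>(F,G)\<in>ordered_link_pairs \<sigma>. h F G)"
    unfolding ordered_link_pairs_def by (rule sum.Sigma) auto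
  also have "\<dots> = (\<Sum>p\<in>prod.swap ` ordered_link_pairs \<sigma>. case p of (F,G) \<Rightarrow> h F G)"
    by (simp add: swap_ordered_link_pairs)
  also have "\<dots> = (\<Sum>(F,G)\<in>ordered_link_pairs \<sigma>. h G F)"
    by (subst sum.reindex) (auto simp: case_prod_unfold)
  also have "\<dots> = (\<Sum>F\<in>link \<sigma>. \<Sum>G\<in>link (insert F \<sigma>). h G F)"
    unfolding ordered_link_pairs_def by (rule sum.Sigma[symmetric]) auto
  finally show ?thesis .
qed

text \<open>Two interpolants differ by an additive function that vanishes on the flag. Balancing is
  a hypothesis because the induction proving \<open>balanced\<close> already uses this consequence
  for the shorter list.\<close>

lemma balanced_aux:
  assumes bal: "\<And>\<tau> a. \<lbrakk>flag \<tau>; card \<tau> + length q = r + 1; \<forall>F\<in>\<tau>. sum a F = 0\<rbrakk> \<Longrightarrow>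
      (\<Sum>F\<in>link \<tau>. sum a F * inter_num (insert F \<tau>) q) = 0"
    and "flag \<sigma>" "card \<sigma> + length q = r + 1" "interpolates a \<phi> \<sigma>"
  shows "inter_num \<sigma> (\<phi> # q) = (\<Sum>F\<in>link \<sigma>. (\<phi> F - \<phi> {} - sum a F) * inter_num (insert F \<sigma>) q)"
proof -
  define b where "b = (SOME a. interpolates a \<phi> \<sigma>)"
  have b: "interpolates b \<phi> \<sigma>" unfolding b_def using interpolates_some assms by blast
  have "inter_num \<sigma> (\<phi> # q) - (\<Sum>F\<in>link \<sigma>. (\<phi> F - \<phi> {} - sum a F) * inter_num (insert F \<sigma>) q)
    = (\<Sum>F\<in>link \<sigma>. sum (\<lambda>e. a e - b e) F * inter_num (insert F \<sigma>) q)"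
    unfolding inter_num.simps(2) b_def[symmetric] sum_subtractf[symmetric]
    by (intro sum.cong refl) (simp add: sum_subtractf algebra_simps)
  also have "\<dots> = 0"
    by (rule bal) (use assms b in \<open>auto simp: sum_subtractf interpolates_def\<close>)
  finally show ?thesis by simp
qed

text \<open>Over \<open>\<rat>\<close> an interpolant on \<open>\<sigma>\<close> can be corrected by a multiple of \<open>a\<close> to one on
  \<open>insert F \<sigma>\<close> (unless \<open>sum a F = 0\<close>), which makes the double sum antisymmetric.\<close>

lemma balanced:
  assumes "flag \<sigma>" "card \<sigma> + length q = r + 1" "\<forall>F\<in>\<sigma>. sum a F = 0"
  shows "(\<Sum>F\<in>link \<sigma>. sum a F * inter_num (insert F \<sigma>) q) = 0"
  using assms
proof (induction q arbitrary: \<sigma> a)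
  case Nil
  then show ?case using balanced_codim1 by simp
next
  case (Cons \<phi> q)
  obtain c where c: "interpolates c \<phi> \<sigma>" using interpolates_exists Cons.prems by blast
  define \<psi> where "\<psi> = (\<lambda>F. \<phi> F - \<phi> {} - sum c F)"
  have step: "sum a F * inter_num (insert F \<sigma>) (\<phi> # q) =
     (\<Sum>G\<in>link (insert F \<sigma>). (sum a F * \<psi> G - \<psi> F * sum a G) * inter_num (insert G (insert F \<sigma>)) q)"
    if F: "F \<in> link \<sigma>" for F
  proof -
    have fl: "flag (insert F \<sigma>)" "card (insert F \<sigma>) + length q = r + 1"
      using flag_insert flag_insert_card F Cons.prems by auto
    show ?thesis
    proof (cases "sum a F = 0")
      \<comment> \<open>No multiple of \<open>a\<close> corrects \<open>c\<close> at
        \<open>F\<close>. But \<open>a\<close> now vanishes on all of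
        \<open>insert F \<sigma>\<close>, so the induction hypothesis kills the terms with
        \<open>sum a G\<close> and the formula of \<open>step\<close> persists.\<close>
      case True
      have "(\<Sum>G\<in>link (insert F \<sigma>). sum a G * inter_num (insert G (insert F \<sigma>)) q) = 0"
        using Cons.IH[OF fl] True Cons.prems by auto
      then have "(\<Sum>G\<in>link (insert F \<sigma>). \<psi> F * (sum a G * inter_num (insert G (insert F \<sigma>)) q)) = 0"
        by (simp add: sum_distrib_left[symmetric])
      then show ?thesis by (simp add: True sum_negf mult.assoc)
    next
      case False
      define b where "b = (\<lambda>e. c e + \<psi> F / sum a F * a e)"
      have sb: "sum b G = sum c G + \<psi> F / sum a F * sum a G" for G
        by (simp add: b_def sum.distrib sum_distrib_left)
      have "interpolates b \<phi> (insert F \<sigma>)"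
        using c False Cons.prems by (auto simp: interpolates_def sb \<psi>_def)
      then have "inter_num (insert F \<sigma>) (\<phi> # q) =
         (\<Sum>G\<in>link (insert F \<sigma>). (\<phi> G - \<phi> {} - sum b G) * inter_num (insert G (insert F \<sigma>)) q)"
        using balanced_aux[OF Cons.IH fl] by blast
      then show ?thesis using False
        by (auto simp: sum_distrib_left sb \<psi>_def field_simps intro!: sum.cong)
    qed
  qed
  have "(\<Sum>F\<in>link \<sigma>. sum a F * inter_num (insert F \<sigma>) (\<phi> # q)) =
    (\<Sum>F\<in>link \<sigma>. \<Sum>G\<in>link (insert F \<sigma>). sum a F * \<psi> G * inter_num (insert G (insert F \<sigma>)) q)
    - (\<Sum>F\<in>link \<sigma>. \<Sum>G\<in>link (insert F \<sigma>). \<psi> F * sum a G * inter_num (insert G (insert F \<sigma>)) q)"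
    by (simp add: step sum_subtractf left_diff_distrib)
  also have "\<dots> = 0"
    by (subst sum_link_swap) (simp add: insert_commute mult_ac)
  finally show ?case .
qed

lemma inter_num_Cons:
  assumes "flag \<sigma>" "card \<sigma> + length q = r + 1" "interpolates a \<phi> \<sigma>"
  shows "inter_num \<sigma> (\<phi> # q) = (\<Sum>F\<in>link \<sigma>. (\<phi> F - \<phi> {} - sum a F) * inter_num (insert F \<sigma>) q)"
  using balanced_aux[OF balanced] assms by blast

lemma inter_num_Cons_zero:
  assumes "flag \<sigma>" "card \<sigma> + length q = r + 1" "\<forall>F\<in>\<sigma>. \<phi> F = 0"
  shows "inter_num \<sigma> (\<phi> # q) = (\<Sum>F\<in>link \<sigma>. \<phi> F * inter_num (insert F \<sigma>) q)"
  using inter_num_Cons[of \<sigma> q "\<lambda>_. 0" \<phi>] assms by (simp add: interpolates_def flag_def)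

text \<open>A linear function defines the zero divisor class: adding \<open>a\<close> to an
  interpolant of \<open>\<phi>\<close> gives one of \<open>\<psi>\<close>, and the weights
  agree.\<close>

lemma inter_num_add_affine:
  assumes "flag \<sigma>" "card \<sigma> + length q = r + 1" "\<And>F. F \<in> L \<Longrightarrow> \<psi> F = \<phi> F + sum a F + c"
  shows "inter_num \<sigma> (\<psi> # q) = inter_num \<sigma> (\<phi> # q)"
proof -
  obtain b where b: "interpolates b \<phi> \<sigma>" using interpolates_exists assms by blast
  have sL: "F \<in> L" if "F \<in> \<sigma>" for F using assms that by (auto simp: flag_def)
  have "interpolates (\<lambda>e. a e + b e) \<psi> \<sigma>"
    using b sL assms(3) empty_flat by (auto simp: interpolates_def sum.distrib)
  from inter_num_Cons[OF assms(1,2) this] inter_num_Cons[OF assms(1,2) b] show ?thesis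
    using link_sub assms(3) empty_flat by (auto simp: sum.distrib intro!: sum.cong)
qed

lemma inter_num_cong_affine:
  assumes "flag \<sigma>" "card \<sigma> + length q = r + 2"
    "list_all2 (\<lambda>\<psi> \<phi>. \<exists>a c. \<forall>F\<in>L. \<psi> F = \<phi> F + sum a F + c) p q"
  shows "inter_num \<sigma> p = inter_num \<sigma> q"
  using assms(3,1,2)
proof (induction p q arbitrary: \<sigma> rule: list_all2_induct)
  case Nil
  then show ?case by simp
next
  case (Cons \<psi> p \<phi> q)
  have "length p = length q" using Cons.hyps list_all2_lengthD by blast
  then have len: "card \<sigma> + length p = r + 1" using Cons.prems by simp
  then have len': "card \<sigma> + length q = r + 1" using \<open>length p = length q\<close> by simp
  obtain b where b: "interpolates b \<phi> \<sigma>" using interpolates_exists Cons.prems by blast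
  have "inter_num \<sigma> (\<psi> # p) = inter_num \<sigma> (\<phi> # p)"
    using Cons.hyps(1) inter_num_add_affine[OF Cons.prems(1) len] by blast
  also have "\<dots> = inter_num \<sigma> (\<phi> # q)"
    unfolding inter_num_Cons[OF Cons.prems(1) len b] inter_num_Cons[OF Cons.prems(1) len' b]
    using Cons.IH flag_insert flag_insert_card Cons.prems by (intro sum.cong) auto
  finally show ?case .
qed

section \<open>Multilinearity and symmetry of intersection numbers\<close>

lemma inter_num_linear:
  assumes "flag \<sigma>" "card \<sigma> + length q = r + 1"
  shows "inter_num \<sigma> ((\<lambda>F. x * \<phi> F + y * \<psi> F) # q) =
    x * inter_num \<sigma> (\<phi> # q) + y * inter_num \<sigma> (\<psi> # q)"
proof -
  obtain a where a: "interpolates a \<phi> \<sigma>" using interpolates_exists assms by blast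
  obtain b where b: "interpolates b \<psi> \<sigma>" using interpolates_exists assms by blast
  have s: "(\<Sum>e\<in>F. x * a e + y * b e) = x * sum a F + y * sum b F" for F
    by (simp add: sum.distrib sum_distrib_left)
  have "interpolates (\<lambda>e. x * a e + y * b e) (\<lambda>F. x * \<phi> F + y * \<psi> F) \<sigma>"
    using a b by (auto simp: interpolates_def s right_diff_distrib)
  from inter_num_Cons[OF assms this] show ?thesis
    unfolding inter_num_Cons[OF assms a] inter_num_Cons[OF assms b]
    by (simp add: sum_distrib_left[of _ _ "link \<sigma>"] sum.distrib[of _ _ "link \<sigma>", symmetric] s)
      (simp add: algebra_simps)
qed

lemma inter_num_zero:
  assumes "flag \<sigma>" "card \<sigma> + length q = r + 1"
  shows "inter_num \<sigma> ((\<lambda>_. 0) # q) = 0"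
  using inter_num_linear[OF assms, of 0 "\<lambda>_. 0" 0 "\<lambda>_. 0"] by simp

lemma inter_num_sum:
  assumes "flag \<sigma>" "card \<sigma> + length q = r + 1" "finite S"
  shows "inter_num \<sigma> ((\<lambda>F. \<Sum>s\<in>S. x s * \<phi> s F) # q) = (\<Sum>s\<in>S. x s * inter_num \<sigma> (\<phi> s # q))"
  using assms(3)
proof (induction S rule: finite_induct)
  case empty
  then show ?case using inter_num_zero assms by simp
next
  case (insert s S)
  then show ?case
    using inter_num_linear[OF assms(1,2), of "x s" "\<phi> s" 1 "\<lambda>F. \<Sum>s\<in>S. x s * \<phi> s F"] by simp
qed

text \<open>Once both functions are normalised to vanish on \<open>\<sigma>\<close>, only the value
  at the first inserted flat has to be corrected. The number splits into a sum over ordered pairs of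
  flats, symmetric by exchanging the order of insertion, and a self-intersection term in a single
  flat \<open>F\<close>, in which the two functions enter only through the product of their values
  at \<open>F\<close>.\<close>

lemma inter_num_swap:
  assumes fl: "flag \<sigma>" and len: "card \<sigma> + length q = r"
  shows "inter_num \<sigma> (\<phi> # \<psi> # q) = inter_num \<sigma> (\<psi> # \<phi> # q)"
proof -
  define res where "res = (\<lambda>\<phi> F. \<phi> F - \<phi> {} - sum (SOME a. interpolates a \<phi> \<sigma>) F)"
  have res0: "\<forall>F\<in>\<sigma>. res \<phi> F = 0" for \<phi>
    using interpolates_some[OF fl, of \<phi>] by (auto simp: interpolates_def res_def)
  have aff: "\<exists>a c. \<forall>F\<in>L. \<phi> F = res \<phi> F + sum a F + c" for \<phi>
    by (intro exI[of _ "SOME a. interpolates a \<phi> \<sigma>"] exI[of _ "\<phi> {}"]) (simp add: res_def)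
  \<comment> \<open>Additive functions that are 1 at \<open>F\<close> and 0 on
    \<open>\<sigma>\<close>; scaled by \<open>res \<psi> F\<close> they interpolate
    \<open>res \<psi>\<close> on \<open>insert F \<sigma>\<close>.\<close>
  define \<delta> where "\<delta> = (\<lambda>F. SOME a. interpolates a (\<lambda>G. if G = F then 1 else 0) (insert F \<sigma>))"
  define \<Delta> where "\<Delta> = (\<lambda>F. sum (\<delta> F))"
  have empty: "{} \<in> \<sigma>" using fl by (auto simp: flag_def)
  have dl: "\<Delta> F F = 1" "\<forall>G\<in>\<sigma>. \<Delta> F G = 0" if "F \<in> link \<sigma>" for F
  proof -
    have "F \<noteq> {}" "F \<notin> \<sigma>" using that empty by (auto simp: link_def)
    then show "\<Delta> F F = 1" "\<forall>G\<in>\<sigma>. \<Delta> F G = 0"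
      using interpolates_some[OF flag_insert[OF fl that], of "\<lambda>G. if G = F then 1 else 0"]
      by (auto simp: interpolates_def \<delta>_def \<Delta>_def)
  qed
  have eq: "inter_num \<sigma> (\<phi> # \<psi> # q) =
     (\<Sum>F\<in>link \<sigma>. \<Sum>G\<in>link (insert F \<sigma>). res \<phi> F * res \<psi> G * inter_num (insert G (insert F \<sigma>)) q)
     - (\<Sum>F\<in>link \<sigma>. res \<phi> F * res \<psi> F *
          (\<Sum>G\<in>link (insert F \<sigma>). \<Delta> F G * inter_num (insert G (insert F \<sigma>)) q))" for \<phi> \<psi>
  proof -
    have "inter_num \<sigma> (\<phi> # \<psi> # q) = inter_num \<sigma> (res \<phi> # res \<psi> # q)"
    proof (rule inter_num_cong_affine[OF fl])
      have "list_all2 (\<lambda>\<psi> \<phi>. \<exists>a c. \<forall>F\<in>L. \<psi> F = \<phi> F + sum a F + c) q q"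
        by (rule list_all2_refl) (auto intro!: exI[of _ "\<lambda>_. 0"])
      then show "list_all2 (\<lambda>\<psi> \<phi>. \<exists>a c. \<forall>F\<in>L. \<psi> F = \<phi> F + sum a F + c) (\<phi> # \<psi> # q) (res \<phi> # res \<psi> # q)"
        using aff by simp
    qed (use len in simp)
    also have "\<dots> = (\<Sum>F\<in>link \<sigma>. res \<phi> F * inter_num (insert F \<sigma>) (res \<psi> # q))"
      using inter_num_Cons_zero[OF fl] res0 len by simp
    also have "\<dots> = (\<Sum>F\<in>link \<sigma>. res \<phi> F * (\<Sum>G\<in>link (insert F \<sigma>).
        (res \<psi> G - res \<psi> F * \<Delta> F G) * inter_num (insert G (insert F \<sigma>)) q))"
    proof (intro sum.cong refl)
      fix F assume F: "F \<in> link \<sigma>"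
      have "interpolates (\<lambda>e. res \<psi> F * \<delta> F e) (res \<psi>) (insert F \<sigma>)"
        using dl[OF F] res0[of \<psi>] empty by (auto simp: interpolates_def \<Delta>_def sum_distrib_left[symmetric])
      moreover have "card (insert F \<sigma>) + length q = r + 1" using flag_insert_card[OF fl F] len by simp
      ultimately show "res \<phi> F * inter_num (insert F \<sigma>) (res \<psi> # q) = res \<phi> F * (\<Sum>G\<in>link (insert F \<sigma>).
        (res \<psi> G - res \<psi> F * \<Delta> F G) * inter_num (insert G (insert F \<sigma>)) q)"
        using inter_num_Cons[OF flag_insert[OF fl F]] res0[of \<psi>] empty
        by (simp add: sum_distrib_left[symmetric] \<Delta>_def)
    qed
    finally show ?thesis
      by (simp add: sum_subtractf left_diff_distrib right_diff_distrib sum_distrib_left mult.assoc)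
  qed
  show ?thesis unfolding eq
    by (subst sum_link_swap) (simp add: insert_commute mult_ac)
qed

lemma inter_num_tail_cong:
  assumes "flag \<sigma>" "\<And>F. F \<in> link \<sigma> \<Longrightarrow> flag (insert F \<sigma>) \<Longrightarrow> card (insert F \<sigma>) = Suc (card \<sigma>) \<Longrightarrow>
    inter_num (insert F \<sigma>) p = inter_num (insert F \<sigma>) q"
  shows "inter_num \<sigma> (\<phi> # p) = inter_num \<sigma> (\<phi> # q)"
  unfolding inter_num.simps(2) using assms flag_insert flag_insert_card by (intro sum.cong) auto

lemma inter_num_move:
  assumes "flag \<sigma>" "card \<sigma> + length us + length vs = r + 1"
  shows "inter_num \<sigma> (us @ \<phi> # vs) = inter_num \<sigma> (\<phi> # us @ vs)"
  using assms
proof (induction us arbitrary: \<sigma>)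
  case Nil
  then show ?case by simp
next
  case (Cons \<psi> us)
  have "inter_num \<sigma> (\<psi> # us @ \<phi> # vs) = inter_num \<sigma> (\<psi> # \<phi> # us @ vs)"
    by (rule inter_num_tail_cong) (use Cons in auto)
  also have "\<dots> = inter_num \<sigma> (\<phi> # \<psi> # us @ vs)"
    using inter_num_swap Cons.prems by simp
  finally show ?case by simp
qed

lemma inter_num_mset:
  assumes "flag \<sigma>" "card \<sigma> + length p = r + 2" "mset p = mset q"
  shows "inter_num \<sigma> p = inter_num \<sigma> q"
  using assms
proof (induction p arbitrary: \<sigma> q)
  case Nil
  then show ?case by simp
next
  case (Cons \<phi> p)
  have "\<phi> \<in> set q" using Cons.prems by (metis list.set_intros(1) mset_eq_setD)
  then obtain us vs where q: "q = us @ \<phi> # vs" by (meson split_list)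
  then have m: "mset p = mset (us @ vs)" using Cons.prems by simp
  then have "length p = length us + length vs" by (metis length_append mset_eq_length)
  then have "inter_num \<sigma> q = inter_num \<sigma> (\<phi> # us @ vs)"
    using inter_num_move Cons.prems q by simp
  also have "\<dots> = inter_num \<sigma> (\<phi> # p)"
    by (rule inter_num_tail_cong[symmetric]) (use Cons m in auto)
  finally show ?case by simp
qed

end

section \<open>Rank, closure and flats of a matroid\<close>

locale matroid =
  fixes M :: "'a matroid"
  assumes is_matroid: "is_matroid M"
begin

abbreviation "E \<equiv> ground M"
abbreviation "rk \<equiv> rank_of M"
abbreviation "flats \<equiv> {F. is_flat M F}"

definition closure :: "'a set \<Rightarrow> 'a set" where
  "closure A = {e \<in> E. rk (insert e A) = rk A}"

lemma finite_E: "finite E"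
  using is_matroid by (simp add: is_matroid_def)

lemma indep_ground: "indep M A \<Longrightarrow> A \<subseteq> E"
  using is_matroid by (simp add: is_matroid_def)

lemma indep_finite: "indep M A \<Longrightarrow> finite A"
  using indep_ground finite_E finite_subset by blast

lemma indep_empty: "indep M {}"
  using is_matroid by (simp add: is_matroid_def)

lemma indep_subset: "indep M B \<Longrightarrow> A \<subseteq> B \<Longrightarrow> indep M A"
  using is_matroid unfolding is_matroid_def by blast

lemma augmentation: "indep M A \<Longrightarrow> indep M B \<Longrightarrow> card A < card B \<Longrightarrow> \<exists>e\<in>B - A. indep M (insert e A)"
  using is_matroid unfolding is_matroid_def by blast

lemma finite_indep_subsets: "finite {B. B \<subseteq> A \<and> indep M B}"
  by (rule finite_subset[of _ "Pow E"]) (use indep_ground finite_E in auto)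

lemma rank_witness: "\<exists>B\<subseteq>A. indep M B \<and> card B = rk A"
proof -
  have "rk A \<in> card ` {B. B \<subseteq> A \<and> indep M B}"
    unfolding rank_of_def using indep_empty by (intro Max_in finite_imageI finite_indep_subsets) auto
  then show ?thesis by auto
qed

lemma rank_ge: "B \<subseteq> A \<Longrightarrow> indep M B \<Longrightarrow> card B \<le> rk A"
  unfolding rank_of_def by (intro Max_ge finite_imageI finite_indep_subsets) auto

lemma rank_mono: "A \<subseteq> B \<Longrightarrow> rk A \<le> rk B"
  by (metis rank_ge rank_witness subset_trans)

lemma rank_insert_ge: "rk A \<le> rk (insert e A)"
  by (rule rank_mono) auto

lemma rank_le_card: "finite A \<Longrightarrow> rk A \<le> card A"
  by (metis card_mono rank_witness)

lemma rank_empty: "rk {} = 0"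
  using rank_le_card[of "{}"] by simp

lemma indep_extend:
  assumes "indep M B" "B \<subseteq> A"
  shows "\<exists>C. B \<subseteq> C \<and> C \<subseteq> A \<and> indep M C \<and> card C = rk A"
  using assms
proof (induction "rk A - card B" arbitrary: B)
  case 0
  then show ?case using rank_ge[of B A] by auto
next
  case (Suc k)
  obtain D where D: "D \<subseteq> A" "indep M D" "card D = rk A" using rank_witness by blast
  then have "card B < card D" using Suc.hyps by simp
  then obtain e where e: "e \<in> D - B" "indep M (insert e B)" using augmentation Suc.prems D by blast
  then have "k = rk A - card (insert e B)" using Suc indep_finite by auto
  from Suc.hyps(1)[OF this e(2)] e D Suc.prems show ?case by blast
qed

lemma rank_insert_le: "rk (insert e A) \<le> Suc (rk A)"
proof -
  obtain C where C: "C \<subseteq> insert e A" "indep M C" "card C = rk (insert e A)" using rank_witness by blast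
  have "card (C - {e}) \<le> rk A" using C indep_subset[of C "C - {e}"] by (intro rank_ge) auto
  then show ?thesis using C(3) card_Diff1_le[of C e] by (cases "e \<in> C") (auto simp: card_Diff_singleton)
qed

text \<open>Submodularity in the form used for closures. Extend a basis of \<open>A\<close> to one
  of \<open>B\<close> and then to one of \<open>insert e B\<close>; if the rank of \<open>B\<close>
  grew, the last basis contains \<open>e\<close>, and its part inside \<open>insert e A\<close> is
  too large.\<close>

lemma rank_insert_mono:
  assumes "rk (insert e A) = rk A" "A \<subseteq> B"
  shows "rk (insert e B) = rk B"
proof (rule ccontr)
  assume neq: "rk (insert e B) \<noteq> rk B"
  then have e: "e \<notin> B" by (metis insert_absorb)
  have less: "rk B < rk (insert e B)" using neq rank_insert_ge[of B e] by linarith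
  obtain I where I: "I \<subseteq> A" "indep M I" "card I = rk A" using rank_witness by blast
  obtain J where J: "I \<subseteq> J" "J \<subseteq> B" "indep M J" "card J = rk B"
    using indep_extend[OF I(2), of B] I assms by auto
  obtain K where K: "J \<subseteq> K" "K \<subseteq> insert e B" "indep M K" "card K = rk (insert e B)"
    using indep_extend[OF J(3), of "insert e B"] J by auto
  have "e \<in> K" using K less rank_ge[of K B] by auto
  then have "indep M (insert e I)" using indep_subset[OF K(3)] I J K by auto
  moreover have "e \<notin> I" using I assms e by auto
  ultimately show False using rank_ge[of "insert e I" "insert e A"] I assms indep_finite by auto
qed

lemma rank_union_eq:
  assumes "finite S" "\<And>e. e \<in> S \<Longrightarrow> rk (insert e A) = rk A"
  shows "rk (A \<union> S) = rk A"
  using assms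
proof (induction S rule: finite_induct)
  case (insert e S)
  then show ?case using rank_insert_mono[of e A "A \<union> S"] by auto
qed auto

lemma rank_union_le: "finite S \<Longrightarrow> rk (A \<union> S) \<le> rk A + card S"
proof (induction S rule: finite_induct)
  case (insert e S)
  then show ?case using rank_insert_le[of e "A \<union> S"] by auto
qed auto

section \<open>Closure and flats\<close>

lemma subset_closure: "A \<subseteq> E \<Longrightarrow> A \<subseteq> closure A"
  by (auto simp: closure_def insert_absorb)

lemma closure_ground: "closure A \<subseteq> E"
  by (auto simp: closure_def)

lemma rank_closure: "A \<subseteq> E \<Longrightarrow> rk (closure A) = rk A"
proof -
  assume A: "A \<subseteq> E"
  have "rk (A \<union> closure A) = rk A"
    using finite_subset[OF closure_ground finite_E] by (intro rank_union_eq) (simp_all add: closure_def)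
  then show ?thesis using subset_closure[OF A] by (simp add: Un_absorb1)
qed

lemma flat_closure: "A \<subseteq> E \<Longrightarrow> is_flat M (closure A)"
  unfolding is_flat_def
proof (intro conjI ballI)
  fix e assume A: "A \<subseteq> E" and e: "e \<in> E - closure A"
  have "rk A < rk (insert e A)" using e rank_insert_ge[of A e] by (auto simp: closure_def le_less)
  also have "\<dots> \<le> rk (insert e (closure A))" using subset_closure[OF A] by (intro rank_mono) auto
  finally show "rk (closure A) < rk (insert e (closure A))" by (simp add: rank_closure[OF A])
qed (rule closure_ground)

lemma closure_least: "is_flat M G \<Longrightarrow> A \<subseteq> G \<Longrightarrow> closure A \<subseteq> G"
proof
  fix e assume G: "is_flat M G" "A \<subseteq> G" "e \<in> closure A"
  then have "rk (insert e G) = rk G" using rank_insert_mono by (auto simp: closure_def)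
  then show "e \<in> G" using G by (force simp: is_flat_def closure_def)
qed

lemma flat_ground: "is_flat M E"
  by (simp add: is_flat_def)

lemma flat_sub: "is_flat M F \<Longrightarrow> F \<subseteq> E"
  by (simp add: is_flat_def)

lemma rank_flat_strict: "is_flat M F \<Longrightarrow> F \<subset> G \<Longrightarrow> G \<subseteq> E \<Longrightarrow> rk F < rk G"
proof -
  assume F: "is_flat M F" "F \<subset> G" "G \<subseteq> E"
  then obtain e where e: "e \<in> G - F" by blast
  then have "rk F < rk (insert e F)" using F by (auto simp: is_flat_def)
  also have "\<dots> \<le> rk G" using e F by (intro rank_mono) auto
  finally show ?thesis .
qed

lemma closure_unique: "is_flat M H \<Longrightarrow> A \<subseteq> H \<Longrightarrow> rk H = rk A \<Longrightarrow> closure A = H"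
proof (rule ccontr)
  assume H: "is_flat M H" "A \<subseteq> H" "rk H = rk A" "closure A \<noteq> H"
  then have "A \<subseteq> E" "closure A \<subset> H" using closure_least[of H A] flat_sub by auto
  then have "rk (closure A) < rk H"
    using rank_flat_strict[OF flat_closure _ flat_sub[OF H(1)]] by blast
  then show False using rank_closure[OF \<open>A \<subseteq> E\<close>] H by simp
qed

lemma rank_insert_flat: "is_flat M F \<Longrightarrow> e \<in> E - F \<Longrightarrow> rk (insert e F) = Suc (rk F)"
  using rank_insert_le[of e F] unfolding is_flat_def by (metis Suc_leI antisym)

end

locale loopless_matroid = matroid +
  fixes r :: nat
  assumes loopless: "loopless M"
    and rank_ground: "rk E = Suc r"

sublocale loopless_matroid \<subseteq> flat_system "ground M" "{F. is_flat M F}" "rank_of M" r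
proof
  \<comment> \<open>Looplessness enters here: every single element raises the rank of the empty
    set.\<close>
  show "{} \<in> {F. is_flat M F}"
  proof -
    have "rk {} < rk {e}" if "e \<in> E" for e
      using loopless that rank_ge[of "{e}" "{e}"] by (auto simp: loopless_def rank_empty)
    then show ?thesis by (auto simp: is_flat_def)
  qed
  show "\<exists>H\<in>{F. is_flat M F}. insert e F \<subseteq> H \<and> rk H = Suc (rk F) \<and>
      (\<forall>G\<in>{F. is_flat M F}. insert e F \<subseteq> G \<longrightarrow> H \<subseteq> G)"
    if "F \<in> {F. is_flat M F}" "e \<in> E - F" for F e
  proof (intro bexI[of _ "closure (insert e F)"] conjI)
    have sub: "insert e F \<subseteq> E" using that flat_sub by auto
    show "rk (closure (insert e F)) = Suc (rk F)"
      using rank_closure[OF sub] rank_insert_flat that by simp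
    show "insert e F \<subseteq> closure (insert e F)" using subset_closure sub by blast
    show "\<forall>G\<in>{F. is_flat M F}. insert e F \<subseteq> G \<longrightarrow> closure (insert e F) \<subseteq> G"
      using closure_least by blast
    show "closure (insert e F) \<in> {F. is_flat M F}" using flat_closure[OF sub] by simp
  qed
qed (use finite_E flat_ground flat_sub rank_empty rank_ground rank_flat_strict in auto)

section \<open>Spanning subsets of an interval of flats\<close>

lemma sum_power_card_Pow:
  "finite X \<Longrightarrow> (\<Sum>C\<in>Pow X. z ^ card C) = (1 + z :: 'b :: comm_semiring_1) ^ card X"
proof (induction X rule: finite_induct)
  case (insert e X)
  have "(\<Sum>C\<in>insert e ` Pow X. z ^ card C) = (\<Sum>C\<in>Pow X. z * z ^ card C)"
  proof (subst sum.reindex)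
    show "inj_on (insert e) (Pow X)" using insert.hyps by (auto intro!: inj_onI)
    show "sum ((\<lambda>C. z ^ card C) \<circ> insert e) (Pow X) = (\<Sum>C\<in>Pow X. z * z ^ card C)"
      using insert.hyps by (intro sum.cong refl) (auto simp: finite_subset subset_iff card_insert_if dest: finite_subset)
  qed
  moreover have "Pow X \<inter> insert e ` Pow X = {}" using insert.hyps by auto
  ultimately show ?case
    using insert by (simp add: Pow_insert sum.union_disjoint sum_distrib_left[symmetric] algebra_simps)
qed simp

context loopless_matroid
begin

text \<open>The spanning sets of the minor that restricts to \<open>B\<close> and contracts
  \<open>A\<close>.\<close>

definition spanning :: "'a set \<Rightarrow> 'a set \<Rightarrow> 'a set set" where
  "spanning A B = {S. S \<subseteq> B - A \<and> rk (A \<union> S) = rk B}"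

text \<open>\<open>T(1, y)\<close> of the minor given by the interval from \<open>A\<close> to \<open>B\<close>.\<close>

definition spanning_poly :: "'a set \<Rightarrow> 'a set \<Rightarrow> int poly" where
  "spanning_poly A B = (\<Sum>S\<in>spanning A B. [:-1, 1:] ^ (card S - (rk B - rk A)))"

text \<open>Counts spanning sets with a marked element. It ties together the sum over rank-one
  flats, the sum over hyperplanes and the derivative of \<open>spanning_poly\<close>, from which the
  recurrence is eliminated.\<close>

definition weighted_spanning_poly :: "'a set \<Rightarrow> 'a set \<Rightarrow> int poly" where
  "weighted_spanning_poly A B =
     (\<Sum>S\<in>spanning A B. of_nat (card S) * [:-1, 1:] ^ (card S - (rk B - rk A)))"

lemma finite_spanning: "is_flat M B \<Longrightarrow> finite (spanning A B)"
  by (rule finite_subset[of _ "Pow E"]) (use flat_sub finite_E in \<open>auto simp: spanning_def\<close>)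

lemma finite_spanning_member: "is_flat M B \<Longrightarrow> S \<in> spanning A B \<Longrightarrow> finite S"
  using flat_sub finite_E by (auto simp: spanning_def intro: finite_subset[of _ E])

lemma card_spanning_ge: "is_flat M B \<Longrightarrow> S \<in> spanning A B \<Longrightarrow> rk B - rk A \<le> card S"
  using rank_union_le[of S A] finite_spanning_member[of B S A] by (auto simp: spanning_def)

text \<open>Over \<open>A\<close>, the element \<open>e\<close> already spans \<open>F\<close>. The
  other elements of \<open>F - A\<close> are then loops that may be present or absent, each
  contributing the factor 1 + (y - 1) = y, and the part outside \<open>F\<close> is a spanning set
  of the interval from \<open>F\<close> to \<open>B\<close>.\<close>

lemma spanning_through_atom:
  assumes A: "is_flat M A" and B: "is_flat M B" and F: "is_flat M F"
    and sub: "A \<subseteq> F" "F \<subseteq> B" and rk: "rk F = Suc (rk A)" and e: "e \<in> F - A"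
  shows "(\<Sum>S\<in>{S \<in> spanning A B. e \<in> S}. [:-1, 1:] ^ (card S - (rk B - rk A))) =
     [:0, 1:] ^ (card (F - A) - 1) * spanning_poly F B"
proof -
  define X where "X = F - A - {e}"
  have finF: "finite F" using F flat_sub finite_E finite_subset by blast
  have X: "finite X" "card X = card (F - A) - 1" "X \<subseteq> F - A" "e \<notin> X"
    using finF e by (auto simp: X_def card_Diff_singleton)
  have rkF: "rk (T \<union> F) = rk (T \<union> A)" if "T \<subseteq> E" "e \<in> T" for T
  proof -
    have "rk (insert e A) = Suc (rk A)"
      using rank_insert_flat[OF A, of e] e flat_sub[OF F] by blast
    then have cl: "closure (insert e A) = F"
      using e F sub rk by (intro closure_unique) auto
    have "rk (insert f (T \<union> A)) = rk (T \<union> A)" if "f \<in> F" for f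
    proof (rule rank_insert_mono)
      have "f \<in> closure (insert e A)" using that cl by simp
      then show "rk (insert f (insert e A)) = rk (insert e A)" unfolding closure_def by blast
      show "insert e A \<subseteq> T \<union> A" using \<open>e \<in> T\<close> by blast
    qed
    then have "rk (T \<union> A \<union> F) = rk (T \<union> A)" using finF by (intro rank_union_eq) auto
    moreover have "T \<union> A \<union> F = T \<union> F" using sub by auto
    ultimately show ?thesis by simp
  qed
  have leAB: "rk F \<le> rk B" using sub rank_mono by auto
  have "(\<Sum>S\<in>{S \<in> spanning A B. e \<in> S}. [:-1, 1:] ^ (card S - (rk B - rk A))) =
    (\<Sum>(C, S)\<in>Pow X \<times> spanning F B. [:-1, 1:] ^ card C * [:-1, 1:: int:] ^ (card S - (rk B - rk F)))"
  proof (rule sum.reindex_bij_witness[where i = "\<lambda>(C, S). insert e (C \<union> S)" and j = "\<lambda>S. (S \<inter> X, S - F)"])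
    fix S assume S: "S \<in> {S \<in> spanning A B. e \<in> S}"
    have SE: "S \<subseteq> E" using S flat_sub[OF B] by (auto simp: spanning_def)
    show "(case (S \<inter> X, S - F) of (C, S) \<Rightarrow> insert e (C \<union> S)) = S"
      using S e by (auto simp: X_def spanning_def)
    have "F \<union> (S - F) = S \<union> F" by auto
    then have "rk (F \<union> (S - F)) = rk B" using rkF[OF SE] S by (simp add: spanning_def Un_commute)
    then show mem: "(S \<inter> X, S - F) \<in> Pow X \<times> spanning F B"
      using S by (auto simp: spanning_def)
    have finS: "finite S" using SE finite_E finite_subset by blast
    have "S = insert e ((S \<inter> X) \<union> (S - F))" using S e by (auto simp: X_def spanning_def)
    moreover have "card (insert e ((S \<inter> X) \<union> (S - F))) = Suc (card (S \<inter> X) + card (S - F))"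
      using finS X e by (subst card_insert_disjoint) (auto intro!: card_Un_disjoint)
    ultimately have "card S = Suc (card (S \<inter> X) + card (S - F))" by simp
    moreover have "rk B - rk F \<le> card (S - F)" using card_spanning_ge[OF B] mem by auto
    ultimately have "card S - (rk B - rk A) = card (S \<inter> X) + (card (S - F) - (rk B - rk F))"
      using rk leAB by simp
    then show "(case (S \<inter> X, S - F) of (C, S) \<Rightarrow> [:-1, 1:] ^ card C * [:-1, 1:: int:] ^ (card S - (rk B - rk F)))
      = [:-1, 1:] ^ (card S - (rk B - rk A))"
      by (simp add: power_add)
  next
    fix p assume p: "p \<in> Pow X \<times> spanning F B"
    obtain C S where pp: "p = (C, S)" "C \<subseteq> X" "S \<subseteq> B - F" "rk (F \<union> S) = rk B"
      using p by (auto simp: spanning_def)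
    show "(\<lambda>S. (S \<inter> X, S - F)) (case p of (C, S) \<Rightarrow> insert e (C \<union> S)) = p"
      using pp X e by auto
    have SE: "insert e (C \<union> S) \<subseteq> E" using pp(2,3) X(3) e sub flat_sub[OF B] by blast
    have "insert e (C \<union> S) \<union> F = F \<union> S" using pp X e by auto
    then have "rk (A \<union> insert e (C \<union> S)) = rk B" using rkF[OF SE] pp by (simp add: Un_commute)
    then show "(case p of (C, S) \<Rightarrow> insert e (C \<union> S)) \<in> {S \<in> spanning A B. e \<in> S}"
      using pp X e sub by (auto simp: spanning_def)
  qed
  also have "\<dots> = (\<Sum>C\<in>Pow X. [:-1, 1:] ^ card C) * spanning_poly F B"
    by (simp add: sum_product sum.cartesian_product spanning_poly_def)
  also have "(\<Sum>C\<in>Pow X. [:-1, 1:: int:] ^ card C) = [:0, 1:] ^ (card (F - A) - 1)"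
    using sum_power_card_Pow[OF X(1), of "[:-1, 1::int:]"] by (simp add: X(2) one_pCons)
  finally show ?thesis .
qed

text \<open>Mark an element of the spanning set and group the marked elements by the cover of
  \<open>A\<close> in which they lie.\<close>

lemma weighted_spanning_poly_atoms:
  assumes A: "is_flat M A" and B: "is_flat M B" and AB: "A \<subseteq> B"
  shows "weighted_spanning_poly A B = (\<Sum>F\<in>{F. is_flat M F \<and> A \<subseteq> F \<and> F \<subseteq> B \<and> rk F = Suc (rk A)}.
     of_nat (card (F - A)) * ([:0, 1:] ^ (card (F - A) - 1) * spanning_poly F B))"
proof -
  let ?w = "\<lambda>S. [:-1, 1:: int:] ^ (card S - (rk B - rk A))"
  have finB: "finite (B - A)" using B flat_sub finite_E finite_subset by blast
  have "weighted_spanning_poly A B = (\<Sum>S\<in>spanning A B. \<Sum>e\<in>{e \<in> B - A. e \<in> S}. ?w S)"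
    unfolding weighted_spanning_poly_def
  proof (intro sum.cong refl)
    fix S assume "S \<in> spanning A B"
    then have "{e \<in> B - A. e \<in> S} = S" by (auto simp: spanning_def)
    then show "of_nat (card S) * ?w S = (\<Sum>e\<in>{e \<in> B - A. e \<in> S}. ?w S)" by simp
  qed
  also have "\<dots> = (\<Sum>e\<in>B - A. \<Sum>S\<in>{S \<in> spanning A B. e \<in> S}. ?w S)"
    by (rule sum.swap_restrict) (use finB finite_spanning B in auto)
  also have "\<dots> = (\<Sum>F\<in>{F. is_flat M F \<and> A \<subseteq> F \<and> F \<subseteq> B \<and> rk F = Suc (rk A)}.
     \<Sum>e\<in>F - A. \<Sum>S\<in>{S \<in> spanning A B. e \<in> S}. ?w S)"
    using sum_flats_cover[of A B "\<lambda>e. \<Sum>S\<in>{S \<in> spanning A B. e \<in> S}. ?w S"] A B AB by simp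
  also have "\<dots> = (\<Sum>F\<in>{F. is_flat M F \<and> A \<subseteq> F \<and> F \<subseteq> B \<and> rk F = Suc (rk A)}.
     of_nat (card (F - A)) * ([:0, 1:] ^ (card (F - A) - 1) * spanning_poly F B))"
  proof (intro sum.cong refl)
    fix F assume F: "F \<in> {F. is_flat M F \<and> A \<subseteq> F \<and> F \<subseteq> B \<and> rk F = Suc (rk A)}"
    have "(\<Sum>e\<in>F - A. \<Sum>S\<in>{S \<in> spanning A B. e \<in> S}. ?w S) =
        (\<Sum>e\<in>F - A. [:0, 1:] ^ (card (F - A) - 1) * spanning_poly F B)"
      using F A B by (intro sum.cong refl spanning_through_atom) auto
    then show "(\<Sum>e\<in>F - A. \<Sum>S\<in>{S \<in> spanning A B. e \<in> S}. ?w S) =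
      of_nat (card (F - A)) * ([:0, 1:] ^ (card (F - A) - 1) * spanning_poly F B)" by simp
  qed
  finally show ?thesis .
qed

text \<open>Remove the marked element \<open>e\<close>. Either the rest still spans and the weight
  splits off a factor y - 1, or the rest together with \<open>A\<close> closes up to a hyperplane
  \<open>H\<close> of the interval, and \<open>e\<close> can be any element of \<open>B - H\<close>.
  Solving for the hyperplane sum collects 1 + (y - 1) = y copies of the weighted polynomial.\<close>

lemma sum_hyperplanes:
  assumes A: "is_flat M A" and B: "is_flat M B" and AB: "A \<subset> B"
  shows "(\<Sum>H\<in>{H. is_flat M H \<and> A \<subseteq> H \<and> H \<subseteq> B \<and> Suc (rk H) = rk B}.
      of_nat (card (B - H)) * spanning_poly A H) =
    [:0, 1:] * weighted_spanning_poly A B - of_nat (card (B - A)) * ([:-1, 1:] * spanning_poly A B)"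
proof -
  let ?w = "\<lambda>S. [:-1, 1:: int:] ^ (card S - (rk B - rk A))"
  define hyps where "hyps = {H. is_flat M H \<and> A \<subseteq> H \<and> H \<subseteq> B \<and> Suc (rk H) = rk B}"
  define P where "P = {(S, e). S \<subseteq> B - A \<and> e \<in> B - A - S \<and> insert e S \<in> spanning A B}"
  have BE: "B \<subseteq> E" using flat_sub B by blast
  have finB: "finite B" using BE finite_E finite_subset by blast
  have finhyps: "finite hyps" unfolding hyps_def
    by (rule finite_subset[of _ "Pow E"]) (use flat_sub finite_E in auto)
  have finP: "finite P"
    by (rule finite_subset[of _ "Pow B \<times> B"]) (use finB in \<open>auto simp: P_def\<close>)
  have "weighted_spanning_poly A B = (\<Sum>S\<in>spanning A B. \<Sum>e\<in>S. ?w S)"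
    by (simp add: weighted_spanning_poly_def)
  also have "\<dots> = (\<Sum>(S, e)\<in>Sigma (spanning A B) (\<lambda>S. S). ?w S)"
    by (rule sum.Sigma) (use finite_spanning finite_spanning_member B in auto)
  also have "\<dots> = (\<Sum>(S, e)\<in>P. [:-1, 1:] ^ (Suc (card S) - (rk B - rk A)))"
  proof (rule sum.reindex_bij_witness[where i = "\<lambda>(S, e). (insert e S, e)" and j = "\<lambda>(S, e). (S - {e}, e)"])
    fix p assume p: "p \<in> (SIGMA S:spanning A B. S)"
    then obtain S e where pp: "p = (S, e)" "S \<in> spanning A B" "e \<in> S" by auto
    have "insert e (A \<union> (S - {e})) = A \<union> S" using pp by blast
    then show "(case p of (S, e) \<Rightarrow> (S - {e}, e)) \<in> P"
      using pp by (auto simp: P_def spanning_def)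
    have "Suc (card (S - {e})) = card S"
      using pp finite_spanning_member[OF B pp(2)] by (metis card.remove)
    then show "(case case p of (S, e) \<Rightarrow> (S - {e}, e) of (S, e) \<Rightarrow> [:-1, 1:] ^ (Suc (card S) - (rk B - rk A)))
       = (case p of (S, e) \<Rightarrow> ?w S)" using pp by simp
  qed (auto simp: P_def)
  also have "\<dots> = (\<Sum>(S, e)\<in>{p\<in>P. fst p \<in> spanning A B}. [:-1, 1:] ^ (Suc (card S) - (rk B - rk A))) +
    (\<Sum>(S, e)\<in>{p\<in>P. fst p \<notin> spanning A B}. [:-1, 1:] ^ (Suc (card S) - (rk B - rk A)))"
    by (subst sum.union_disjoint[symmetric]) (auto simp: finP intro!: sum.cong)
  also have "(\<Sum>(S, e)\<in>{p\<in>P. fst p \<in> spanning A B}. [:-1, 1:: int:] ^ (Suc (card S) - (rk B - rk A)))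
     = (\<Sum>(S, e)\<in>(SIGMA S:spanning A B. B - A - S). [:-1, 1:] * ?w S)"
  proof (rule sum.cong)
    show "{p\<in>P. fst p \<in> spanning A B} = (SIGMA S:spanning A B. B - A - S)"
    proof -
      have "insert e S \<in> spanning A B" if "S \<in> spanning A B" "e \<in> B - A - S" for S e
      proof -
        have "rk B \<le> rk (A \<union> insert e S)" using that rank_mono[of "A \<union> S" "A \<union> insert e S"]
          by (auto simp: spanning_def)
        moreover have "rk (A \<union> insert e S) \<le> rk B"
          using that AB by (intro rank_mono) (auto simp: spanning_def)
        ultimately show ?thesis using that by (auto simp: spanning_def)
      qed
      then show ?thesis by (auto simp: P_def spanning_def)
    qed
  qed (use card_spanning_ge[OF B] in \<open>auto simp: Suc_diff_le simp del: mult_pCons_left\<close>)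
  also have "\<dots> = (\<Sum>S\<in>spanning A B. \<Sum>e\<in>B - A - S. [:-1, 1:] * ?w S)"
    by (rule sum.Sigma[symmetric]) (use finite_spanning finB B in auto)
  also have "\<dots> = (\<Sum>S\<in>spanning A B. [:-1, 1:] * (of_nat (card (B - A)) * ?w S - of_nat (card S) * ?w S))"
  proof (intro sum.cong refl)
    fix S assume S: "S \<in> spanning A B"
    then have "card (B - A - S) = card (B - A) - card S" "card S \<le> card (B - A)"
      using finB finite_spanning_member[OF B S] by (auto simp: spanning_def card_Diff_subset intro!: card_mono)
    then show "(\<Sum>e\<in>B - A - S. [:-1, 1:] * ?w S) =
        [:-1, 1:] * (of_nat (card (B - A)) * ?w S - of_nat (card S) * ?w S)"
      by (simp add: of_nat_diff algebra_simps del: mult_pCons_left)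
  qed
  also have "\<dots> = [:-1, 1:] * (of_nat (card (B - A)) * spanning_poly A B - weighted_spanning_poly A B)"
    by (simp only: spanning_poly_def weighted_spanning_poly_def sum_subtractf sum_distrib_left[symmetric])
  \<comment> \<open>The exponent is the same on both sides: dropping \<open>e\<close> and passing
    from \<open>B\<close> to \<open>H\<close> lower the size and the rank by one each.\<close>
  also have "(\<Sum>(S, e)\<in>{p\<in>P. fst p \<notin> spanning A B}. [:-1, 1:: int:] ^ (Suc (card S) - (rk B - rk A)))
    = (\<Sum>(H, S, e)\<in>(SIGMA H:hyps. spanning A H \<times> (B - H)). [:-1, 1:] ^ (card S - (rk H - rk A)))"
  proof (rule sum.reindex_bij_witness[where i = "\<lambda>(H, S, e). (S, e)" and j = "\<lambda>(S, e). (closure (A \<union> S), S, e)"])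
    fix p assume "p \<in> {p\<in>P. fst p \<notin> spanning A B}"
    then obtain S e where p: "p = (S, e)" "S \<subseteq> B - A" "e \<in> B - A - S" "rk (A \<union> insert e S) = rk B"
      "rk (A \<union> S) \<noteq> rk B" by (auto simp: P_def spanning_def)
    have AS: "A \<union> S \<subseteq> B" using AB p by auto
    have cl: "closure (A \<union> S) \<subseteq> B" using closure_least[OF B AS] .
    have "rk (A \<union> S) < rk B" using rank_mono[OF AS] p(5) by auto
    then have rS: "Suc (rk (A \<union> S)) = rk B" using rank_insert_le[of e "A \<union> S"] p(4) by simp
    have ASE: "A \<union> S \<subseteq> E" using AS BE by auto
    have rkcl: "rk (closure (A \<union> S)) = rk (A \<union> S)" using rank_closure[OF ASE] .
    have "closure (A \<union> S) \<in> hyps"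
      using flat_closure[OF ASE] cl rS rkcl subset_closure[OF ASE] by (auto simp: hyps_def)
    moreover have "e \<notin> closure (A \<union> S)" using p(4,5) by (auto simp: closure_def)
    moreover have "S \<in> spanning A (closure (A \<union> S))"
      using subset_closure[OF ASE] rkcl p by (auto simp: spanning_def)
    ultimately show "(case p of (S, e) \<Rightarrow> (closure (A \<union> S), S, e)) \<in> (SIGMA H:hyps. spanning A H \<times> (B - H))"
      using p by auto
    show "(case case p of (S, e) \<Rightarrow> (closure (A \<union> S), S, e) of
          (H, S, e) \<Rightarrow> [:-1, 1:] ^ (card S - (rk H - rk A))) =
        (case p of (S, e) \<Rightarrow> [:-1, 1:] ^ (Suc (card S) - (rk B - rk A)))"
      using p(1) rkcl rS rank_mono[of A "A \<union> S"] by (simp add: Suc_diff_le rS[symmetric])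
    show "(case case p of (S, e) \<Rightarrow> (closure (A \<union> S), S, e) of (H, S, e) \<Rightarrow> (S, e)) = p" using p by simp
  next
    fix q assume "q \<in> (SIGMA H:hyps. spanning A H \<times> (B - H))"
    then obtain H S e where q: "q = (H, S, e)" "is_flat M H" "A \<subseteq> H" "H \<subseteq> B" "Suc (rk H) = rk B"
      "S \<subseteq> H - A" "rk (A \<union> S) = rk H" "e \<in> B - H" by (auto simp: hyps_def spanning_def)
    have "closure (A \<union> S) = H" using q by (intro closure_unique) auto
    then show "(case case q of (H, S, e) \<Rightarrow> (S, e) of (S, e) \<Rightarrow> (closure (A \<union> S), S, e)) = q" using q by simp
    have "rk (insert e (A \<union> S)) \<noteq> rk (A \<union> S)"
      using q \<open>closure (A \<union> S) = H\<close> BE by (auto simp: closure_def)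
    then have "rk (A \<union> insert e S) = rk B"
      using rank_insert_le[of e "A \<union> S"] rank_insert_ge[of "A \<union> S" e] q by simp
    then show "(case q of (H, S, e) \<Rightarrow> (S, e)) \<in> {p\<in>P. fst p \<notin> spanning A B}"
      using q by (auto simp: P_def spanning_def)
  qed
  also have "\<dots> = (\<Sum>H\<in>hyps. \<Sum>(S, e)\<in>spanning A H \<times> (B - H). [:-1, 1:] ^ (card S - (rk H - rk A)))"
    by (subst sum.Sigma) (use finhyps finite_spanning finB in \<open>auto simp: hyps_def\<close>)
  also have "\<dots> = (\<Sum>H\<in>hyps. of_nat (card (B - H)) * spanning_poly A H)"
    by (simp add: sum.cartesian_product[symmetric] spanning_poly_def sum_distrib_left)
  finally have eq: "weighted_spanning_poly A B =
    [:-1, 1:] * (of_nat (card (B - A)) * spanning_poly A B - weighted_spanning_poly A B) +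
    (\<Sum>H\<in>hyps. of_nat (card (B - H)) * spanning_poly A H)" .
  have y: "[:0, 1:] = 1 + [:-1, 1:: int:]" by (simp add: one_pCons)
  show ?thesis unfolding hyps_def[symmetric] y
    using eq by (simp add: algebra_simps del: mult_pCons_left)
qed

text \<open>The operator (y - 1) d/dy multiplies (y - 1)^k by k, and the exponents k are the size of
  the spanning set minus the rank of the interval.\<close>

lemma spanning_poly_pderiv:
  assumes "is_flat M A" "is_flat M B" "A \<subseteq> B"
  shows "[:-1, 1:] * pderiv (spanning_poly A B) =
    weighted_spanning_poly A B - of_nat (rk B - rk A) * spanning_poly A B"
proof -
  have "[:-1, 1:] * pderiv ([:-1, 1::int:] ^ k) = of_nat k * [:-1, 1:] ^ k" for k
  proof (cases k)
    case (Suc m)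
    have "pderiv [:-1, 1::int:] = 1" by (simp add: pderiv_pCons)
    then have "[:-1, 1:] * pderiv ([:-1, 1::int:] ^ k) = [:-1, 1:] * smult (of_nat (Suc m)) ([:-1, 1:] ^ m)"
      unfolding Suc pderiv_power_Suc by (simp del: mult_pCons_left)
    also have "\<dots> = smult (of_nat (Suc m)) ([:-1, 1:] ^ Suc m)"
      by (simp only: mult_smult_right power_Suc)
    finally show ?thesis unfolding Suc of_nat_poly by simp
  qed simp
  then have "[:-1, 1:] * pderiv (spanning_poly A B) =
    (\<Sum>S\<in>spanning A B. of_nat (card S - (rk B - rk A)) * [:-1, 1:] ^ (card S - (rk B - rk A)))"
    by (simp add: spanning_poly_def higher_pderiv_sum[where n = 1, simplified] sum_distrib_left del: mult_pCons_left)
  also have "\<dots> = weighted_spanning_poly A B - of_nat (rk B - rk A) * spanning_poly A B"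
    unfolding spanning_poly_def weighted_spanning_poly_def sum_distrib_left sum_subtractf[symmetric]
    using card_spanning_ge[OF assms(2)] by (intro sum.cong refl) (simp add: of_nat_diff left_diff_distrib)
  finally show ?thesis .
qed

text \<open>Mirrors the solution of the discrete Poisson equation for the intersection numbers.\<close>

lemma spanning_poly_recurrence:
  assumes A: "is_flat M A" and B: "is_flat M B" and AB: "A \<subset> B" and s: "rk B - rk A = Suc s"
  defines "N \<equiv> int (card (B - A))"
  shows "N * int s * poly.coeff (spanning_poly A B) j =
    int (j + s) * (\<Sum>H\<in>{H. is_flat M H \<and> A \<subseteq> H \<and> H \<subseteq> B \<and> Suc (rk H) = rk B}.
        int (card (B - H)) * poly.coeff (spanning_poly A H) j) +
    (N - int (j + s)) * (\<Sum>F\<in>{F. is_flat M F \<and> A \<subseteq> F \<and> F \<subseteq> B \<and> rk F = Suc (rk A)}.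
        int (card (F - A)) * (if card (F - A) \<le> j then poly.coeff (spanning_poly F B) (j - card (F - A)) else 0))"
proof -
  define h where "h = spanning_poly A B"
  define Q where "Q = weighted_spanning_poly A B"
  have cf: "poly.coeff (of_nat k * p) j = int k * poly.coeff p j" for k p and j :: nat
    by (simp add: of_nat_poly)
  have finB: "finite B" using B flat_sub finite_E finite_subset by blast
  have e1: "(\<Sum>H\<in>{H. is_flat M H \<and> A \<subseteq> H \<and> H \<subseteq> B \<and> Suc (rk H) = rk B}.
        int (card (B - H)) * poly.coeff (spanning_poly A H) j) =
      poly.coeff ([:0, 1:] * Q - of_nat (card (B - A)) * ([:-1, 1:] * h)) j"
    unfolding h_def Q_def sum_hyperplanes[OF A B AB, symmetric] by (simp only: coeff_sum cf)
  have e2: "(\<Sum>F\<in>{F. is_flat M F \<and> A \<subseteq> F \<and> F \<subseteq> B \<and> rk F = Suc (rk A)}.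
        int (card (F - A)) * (if card (F - A) \<le> j then poly.coeff (spanning_poly F B) (j - card (F - A)) else 0))
      = poly.coeff ([:0, 1:] * Q) j"
  proof -
    \<comment> \<open>The extra factor y completes the power to y^\<open>card (F - A)\<close>, which
      shifts coefficients by \<open>card (F - A)\<close>; the case distinction in the recurrence is
      this shift.\<close>
    have "[:0, 1:] * Q = (\<Sum>F\<in>{F. is_flat M F \<and> A \<subseteq> F \<and> F \<subseteq> B \<and> rk F = Suc (rk A)}.
      of_nat (card (F - A)) * (monom 1 (card (F - A)) * spanning_poly F B))"
      unfolding Q_def weighted_spanning_poly_atoms[OF A B psubset_imp_subset[OF AB]] sum_distrib_left
    proof (intro sum.cong refl)
      fix F assume F: "F \<in> {F. is_flat M F \<and> A \<subseteq> F \<and> F \<subseteq> B \<and> rk F = Suc (rk A)}"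
      then have "F - A \<noteq> {}" by auto
      then have "card (F - A) = Suc (card (F - A) - 1)"
        using F finB by (metis (no_types, lifting) Suc_pred' card_gt_0_iff finite_Diff finite_subset mem_Collect_eq)
      then have "monom 1 (card (F - A)) = [:0, 1:] * [:0, 1::int:] ^ (card (F - A) - 1)"
        by (metis monom_altdef power_Suc smult_1_left)
      then show "[:0, 1:] * (of_nat (card (F - A)) * ([:0, 1:] ^ (card (F - A) - 1) * spanning_poly F B)) =
         of_nat (card (F - A)) * (monom 1 (card (F - A)) * spanning_poly F B)"
        by (simp only: mult_ac)
    qed
    then show ?thesis by (simp only: coeff_sum cf) (auto simp: coeff_monom_mult intro!: sum.cong)
  qed
  have c1: "poly.coeff ([:-1, 1:] * p) j = (if j = 0 then 0 else poly.coeff p (j - 1)) - poly.coeff p j" for p :: "int poly" and j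
    by (cases j) auto
  have c0: "poly.coeff ([:0, 1:] * p) j = (if j = 0 then 0 else poly.coeff p (j - 1))" for p :: "int poly" and j
    by (cases j) auto
  have e3: "poly.coeff ([:-1, 1:] * pderiv h) k = poly.coeff Q k - int (Suc s) * poly.coeff h k" for k
    unfolding h_def Q_def spanning_poly_pderiv[OF A B psubset_imp_subset[OF AB]] s by (simp only: coeff_diff cf)
  show ?thesis unfolding e1 e2 N_def h_def[symmetric] coeff_diff cf c0 c1
  proof (cases j)
    case (Suc k)
    \<comment> \<open>The derivative identity solved for \<open>Q\<close>. In the recurrence the
      weights \<open>j + s\<close> and \<open>N - (j + s)\<close> of \<open>Q\<close> add up to
      \<open>N\<close>; inserting this value cancels the coefficient of \<open>h\<close> at
      \<open>k\<close> and leaves \<open>N * s\<close> times the one at \<open>j\<close>.\<close>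
    have Q: "poly.coeff Q k = int (Suc k + s) * poly.coeff h k - int (Suc k) * poly.coeff h (Suc k)"
      using e3[of k] by (cases k) (auto simp: c1 coeff_pderiv algebra_simps)
    show "int (card (B - A)) * int s * poly.coeff h j = int (j + s) *
       ((if j = 0 then 0 else poly.coeff Q (j - 1)) - int (card (B - A)) *
          ((if j = 0 then 0 else poly.coeff h (j - 1)) - poly.coeff h j)) +
       (int (card (B - A)) - int (j + s)) * (if j = 0 then 0 else poly.coeff Q (j - 1))"
      using Suc by (simp add: Q) (simp add: algebra_simps)
  qed (simp add: algebra_simps)
qed

text \<open>The exponents of y - 1 are bounded by the nullity of the interval. This discards from
  the recurrence the hyperplanes that are too small to occur in the Poisson source.\<close>

lemma degree_spanning_poly:
  assumes "is_flat M B" "card (B - A) < k + (rk B - rk A)"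
  shows "poly.coeff (spanning_poly A B) k = 0"
proof -
  have finB: "finite (B - A)" using assms flat_sub finite_E finite_subset by blast
  have "poly.coeff ([:-1, 1::int:] ^ (card S - (rk B - rk A))) k = 0" if "S \<in> spanning A B" for S
  proof (rule coeff_eq_0)
    have "card S \<le> card (B - A)" using that finB by (auto simp: spanning_def intro!: card_mono)
    moreover have "degree ([:-1, 1::int:] ^ (card S - (rk B - rk A))) = card S - (rk B - rk A)"
      by (simp add: degree_power_eq)
    ultimately show "degree ([:-1, 1::int:] ^ (card S - (rk B - rk A))) < k" using assms(2)
      card_spanning_ge[OF assms(1) that] by linarith
  qed
  then show ?thesis by (simp add: spanning_poly_def coeff_sum)
qed

text \<open>In rank one every nonempty subset spans, so (y - 1) h = y^N - 1 and h = 1 + y + ... +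
  y^(N-1), where N is \<open>card (B - A)\<close>.\<close>

lemma spanning_poly_corank_one:
  assumes A: "is_flat M A" and B: "is_flat M B" and AB: "A \<subset> B" and rk: "rk B = Suc (rk A)"
    and j: "j < card (B - A)"
  shows "poly.coeff (spanning_poly A B) j = 1"
proof -
  have finB: "finite (B - A)" using finite_subset[OF flat_sub[OF B] finite_E] by simp
  have sp: "spanning A B = Pow (B - A) - {{}}"
  proof -
    have "rk (A \<union> S) = rk B" if "S \<subseteq> B - A" "S \<noteq> {}" for S
    proof -
      have "A \<subset> A \<union> S" "A \<union> S \<subseteq> B" "A \<union> S \<subseteq> E" using that AB flat_sub[OF B] by blast+
      then have "rk A < rk (A \<union> S)" "rk (A \<union> S) \<le> rk B"
        using rank_flat_strict[OF A] rank_mono by blast+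
      then show ?thesis using rk by linarith
    qed
    then show ?thesis using rk by (auto simp: spanning_def)
  qed
  have "[:-1, 1:] * spanning_poly A B = (\<Sum>S\<in>Pow (B - A) - {{}}. [:-1, 1:] ^ card S)"
    unfolding spanning_poly_def sp sum_distrib_left
  proof (intro sum.cong refl)
    fix S assume "S \<in> Pow (B - A) - {{}}"
    then have "card S \<noteq> 0" using finB finite_subset by fastforce
    then show "[:-1, 1:] * [:-1, 1:] ^ (card S - (rk B - rk A)) = [:-1, 1::int:] ^ card S"
      using rk by (cases "card S") (simp_all del: mult_pCons_left)
  qed
  also have "\<dots> = (\<Sum>S\<in>Pow (B - A). [:-1, 1:] ^ card S) - 1"
    using finB by (subst sum_diff1) auto
  also have "\<dots> = [:0, 1:] ^ card (B - A) - 1"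
    using sum_power_card_Pow[OF finB, of "[:-1, 1::int:]"] by (simp add: one_pCons)
  finally have "[:-1, 1:] * spanning_poly A B = monom 1 (card (B - A)) - 1"
    by (simp add: monom_altdef)
  then have c: "poly.coeff ([:-1, 1:] * spanning_poly A B) k = poly.coeff (monom 1 (card (B - A)) - 1) k" for k
    by simp
  show ?thesis using j
  proof (induction j)
    case 0
    then show ?case using c[of 0] by simp
  next
    case (Suc j)
    then show ?case using c[of "Suc j"] by simp
  qed
qed

end

section \<open>Intersection numbers of truncated cardinalities\<close>

context flat_system
begin

text \<open>Each member of the flag contains all of \<open>B - A\<close> or none of it, so only the
  total over \<open>B - A\<close> matters. An interpolant can thus be made to follow a prescribed
  additive function inside the gap.\<close>

lemma interpolates_modify:
  assumes "interpolates b \<phi> \<sigma>" "A \<in> \<sigma>" "B \<in> \<sigma>" "A \<subseteq> B" "\<sigma> \<subseteq> L"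
    "\<And>F. F \<in> \<sigma> \<Longrightarrow> F \<subseteq> A \<or> B \<subseteq> F" "sum a (B - A) = \<phi> B - \<phi> A"
  shows "interpolates (\<lambda>e. if e \<in> B - A then a e else b e) \<phi> \<sigma>"
  unfolding interpolates_def
proof
  let ?b = "\<lambda>e. if e \<in> B - A then a e else b e"
  fix F assume F: "F \<in> \<sigma>"
  have fin: "finite F" "finite B" "finite A" using F assms finite_flat by auto
  have bF: "sum b F = \<phi> F - \<phi> {}" "sum b B = \<phi> B - \<phi> {}" "sum b A = \<phi> A - \<phi> {}"
    using F assms(1-3) by (auto simp: interpolates_def)
  show "sum ?b F = \<phi> F - \<phi> {}"
  proof (cases "F \<subseteq> A")
    case True
    then have "sum ?b F = sum b F" by (intro sum.cong) auto
    then show ?thesis using bF by simp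
  next
    case False
    then have "B \<subseteq> F" using assms(6) F by auto
    then have split: "sum c F = sum c (F - (B - A)) + sum c (B - A)" for c :: "'a \<Rightarrow> rat"
      using fin by (intro sum.subset_diff) auto
    have "sum ?b (F - (B - A)) = sum b (F - (B - A))" by (rule sum.cong) auto
    moreover have "sum ?b (B - A) = sum a (B - A)" by (rule sum.cong) auto
    moreover have "sum b (B - A) = sum b B - sum b A" using fin assms(4) by (simp add: sum_diff)
    ultimately show ?thesis using split[of ?b] split[of b] bF assms(7) by simp
  qed
qed

lemma interpolates_gap:
  assumes "interpolates b \<phi> \<sigma>" "A \<in> \<sigma>" "\<And>e. e \<in> B - A \<Longrightarrow> b e = a e" "A \<subseteq> F" "F \<subseteq> B" "finite F"
  shows "sum b F = \<phi> A - \<phi> {} + sum a (F - A)"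
proof -
  have "sum b F = sum b (F - A) + sum b A" using assms by (intro sum.subset_diff) auto
  moreover have "sum b (F - A) = sum a (F - A)" using assms by (intro sum.cong) auto
  ultimately show ?thesis using assms(1,2) by (simp add: interpolates_def)
qed

text \<open>Functions that are affine on the interval from \<open>A\<close> to \<open>B\<close> give
  weight zero to every flat inside it. So the gap is never refined, whereas the complete flag
  reached at the end would need a member of rank \<open>Suc (rk A)\<close>.\<close>

lemma inter_num_gap_zero:
  assumes "flag \<sigma>" "card \<sigma> + length q = r + 2" "A \<in> \<sigma>" "B \<in> \<sigma>" "A \<subseteq> B"
    "\<And>F. F \<in> \<sigma> \<Longrightarrow> F \<subseteq> A \<or> B \<subseteq> F" "Suc (rk A) < rk B"
    "\<And>\<phi>. \<phi> \<in> set q \<Longrightarrow> \<exists>a. \<forall>F\<in>L. A \<subseteq> F \<longrightarrow> F \<subseteq> B \<longrightarrow> \<phi> F = \<phi> A + sum a (F - A)"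
  shows "inter_num \<sigma> q = 0"
  using assms(1-6,8)
proof (induction q arbitrary: \<sigma>)
  case Nil
  have "card (rk ` \<sigma>) = card {..Suc r}" using Nil flag_rk_inj by (simp add: card_image)
  then have "rk ` \<sigma> = {..Suc r}" using flag_rk_image[OF Nil.prems(1)] by (intro card_subset_eq) auto
  moreover have "B \<in> L" using Nil.prems by (auto simp: flag_def)
  ultimately have "Suc (rk A) \<in> rk ` \<sigma>" using assms(7) rk_le[of B] by auto
  then obtain F where F: "F \<in> \<sigma>" "rk F = Suc (rk A)" by auto
  then show ?case using Nil.prems(6)[OF F(1)] flag_rk_mono[OF Nil.prems(1) F(1) Nil.prems(3)]
      flag_rk_mono[OF Nil.prems(1) Nil.prems(4) F(1)] assms(7) by auto
next
  case (Cons \<phi> q)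
  have sL: "\<sigma> \<subseteq> L" "A \<in> L" "B \<in> L" using Cons.prems by (auto simp: flag_def)
  obtain a where a: "\<forall>F\<in>L. A \<subseteq> F \<longrightarrow> F \<subseteq> B \<longrightarrow> \<phi> F = \<phi> A + sum a (F - A)"
    using Cons.prems(7)[of \<phi>] by auto
  obtain b where b: "interpolates b \<phi> \<sigma>" using interpolates_exists Cons.prems by blast
  define c where "c = (\<lambda>e. if e \<in> B - A then a e else b e)"
  have "\<phi> B = \<phi> A + sum a (B - A)" using a sL Cons.prems(5) by blast
  then have c: "interpolates c \<phi> \<sigma>" unfolding c_def
    using Cons.prems(3-6) b sL by (intro interpolates_modify) auto
  have "(\<phi> F - \<phi> {} - sum c F) * inter_num (insert F \<sigma>) q = 0" if F: "F \<in> link \<sigma>" for F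
  proof (cases "A \<subseteq> F \<and> F \<subseteq> B")
    case True
    have "sum c F = \<phi> A - \<phi> {} + sum a (F - A)"
      using True F link_sub finite_flat c Cons.prems by (intro interpolates_gap[of _ _ \<sigma> A B]) (auto simp: c_def)
    then show ?thesis using a True link_sub[OF F] by simp
  next
    case False
    have "inter_num (insert F \<sigma>) q = 0"
    proof (rule Cons.IH)
      show "flag (insert F \<sigma>)" using flag_insert F Cons.prems by blast
      show "card (insert F \<sigma>) + length q = r + 2"
        using flag_insert_card[OF Cons.prems(1) F] Cons.prems(2) by simp
      have "F \<subseteq> A \<or> B \<subseteq> F" using False F Cons.prems(3,4) by (auto simp: link_def)
      then show "G \<subseteq> A \<or> B \<subseteq> G" if "G \<in> insert F \<sigma>" for G using that Cons.prems(6) by auto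
    qed (use Cons.prems in auto)
    then show ?thesis by simp
  qed
  then have "(\<Sum>F\<in>link \<sigma>. (\<phi> F - \<phi> {} - sum c F) * inter_num (insert F \<sigma>) q) = 0"
    by (intro sum.neutral) blast
  then show ?case using inter_num_Cons[OF Cons.prems(1) _ c, of q] Cons.prems(2) by simp
qed

text \<open>The cardinality of \<open>\<sigma>\<close> forces members of every rank outside the gap,
  so a new member must have rank strictly between \<open>rk A\<close> and
  \<open>rk B\<close>.\<close>

lemma link_gap:
  assumes "flag \<sigma>" "A \<in> \<sigma>" "B \<in> \<sigma>" "\<And>F. F \<in> \<sigma> \<Longrightarrow> F \<subseteq> A \<or> B \<subseteq> F"
    "rk B = rk A + Suc s" "card \<sigma> + s = r + 2"
  shows "link \<sigma> = {F \<in> L. A \<subset> F \<and> F \<subset> B}"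
proof (intro equalityI subsetI)
  have sL: "A \<in> L" "B \<in> L" using assms by (auto simp: flag_def)
  fix F assume F: "F \<in> link \<sigma>"
  have fl: "flag (insert F \<sigma>)" using flag_insert assms F by blast
  have "rk ` \<sigma> \<subseteq> {..rk A} \<union> {rk B..Suc r}"
  proof
    fix x assume "x \<in> rk ` \<sigma>"
    then obtain G where G: "G \<in> \<sigma>" "x = rk G" by auto
    then show "x \<in> {..rk A} \<union> {rk B..Suc r}"
      using assms(4)[OF G(1)] flag_rk_mono[OF assms(1) G(1) assms(2)]
        flag_rk_mono[OF assms(1) assms(3) G(1)] flag_rk_image[OF assms(1)] by auto
  qed
  moreover have "card (rk ` \<sigma>) = card ({..rk A} \<union> {rk B..Suc r})"
  proof -
    have "card ({..rk A} \<union> {rk B..Suc r}) = Suc (rk A) + (Suc (Suc r) - rk B)"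
      using assms(5) by (subst card_Un_disjoint) auto
    then show ?thesis using assms rk_le[OF sL(2)] card_image[OF flag_rk_inj[OF assms(1)]] by simp
  qed
  ultimately have img: "rk ` \<sigma> = {..rk A} \<union> {rk B..Suc r}" by (intro card_subset_eq) auto
  have "F \<notin> \<sigma>" "F \<in> L" using F by (auto simp: link_def)
  then have "rk F \<notin> rk ` \<sigma>" using flag_rk_inj[OF fl] by (auto simp: inj_on_def)
  then have "rk A < rk F" "rk F < rk B" using rk_le[OF \<open>F \<in> L\<close>] unfolding img by auto
  then have "A \<subseteq> F" "F \<subseteq> B" "A \<noteq> F" "F \<noteq> B"
    using flag_rk_mono[OF fl, of A F] flag_rk_mono[OF fl, of F B] assms by auto
  then show "F \<in> {F \<in> L. A \<subset> F \<and> F \<subset> B}" using \<open>F \<in> L\<close> by auto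
next
  fix F assume F: "F \<in> {F \<in> L. A \<subset> F \<and> F \<subset> B}"
  then have "G \<subseteq> F \<or> F \<subseteq> G" if "G \<in> \<sigma>" for G using assms(4)[OF that] by auto
  moreover have "F \<notin> \<sigma>" using F assms(4)[of F] by auto
  ultimately show "F \<in> link \<sigma>" using F by (auto simp: link_def)
qed

section \<open>Truncated cardinalities on a single gap\<close>

definition trunc_card :: "nat \<Rightarrow> 'a set \<Rightarrow> rat" where
  "trunc_card k F = of_nat (min k (card F))"

lemma trunc_card_small:
  assumes "A \<subseteq> F" "finite F" "k \<le> card A"
  shows "trunc_card k F = trunc_card k A + (\<Sum>e\<in>F - A. 0)"
  using assms card_mono[of F A] by (simp add: trunc_card_def)

lemma trunc_card_large:
  assumes "A \<subseteq> F" "F \<subseteq> B" "finite B" "card B \<le> k"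
  shows "trunc_card k F = trunc_card k A + (\<Sum>e\<in>F - A. 1)"
proof -
  have "finite F" "card A \<le> card F" "card F \<le> card B"
    using assms by (auto intro: finite_subset card_mono)
  then show ?thesis using assms card_Diff_subset[of A F]
    by (auto simp: trunc_card_def finite_subset of_nat_diff)
qed

text \<open>For such \<open>k\<close> the truncated cardinality is constant, or a constant plus the
  cardinality, on the interval, so all weights vanish. The cases \<open>k = card A\<close> and
  \<open>k = card B\<close> are the boundary values of the Poisson equation.\<close>

lemma inter_num_trunc_card_outside:
  assumes fl: "flag \<sigma>" and AB: "A \<in> \<sigma>" "B \<in> \<sigma>" "A \<subseteq> B" and gap: "\<And>F. F \<in> \<sigma> \<Longrightarrow> F \<subseteq> A \<or> B \<subseteq> F"
    and rk: "rk B = rk A + Suc s" and card: "card \<sigma> + s = r + 2" and len: "Suc (length q) = s"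
    and k: "k \<le> card A \<or> card B \<le> k"
  shows "inter_num \<sigma> (trunc_card k # q) = 0"
proof -
  have sL: "\<sigma> \<subseteq> L" "A \<in> L" "B \<in> L" using fl AB by (auto simp: flag_def)
  have fin: "finite F" if "F \<subseteq> B" for F using finite_flat[OF sL(3)] that finite_subset by blast
  have "\<exists>a. \<forall>F. A \<subseteq> F \<longrightarrow> F \<subseteq> B \<longrightarrow> trunc_card k F = trunc_card k A + sum a (F - A)"
  proof (cases "k \<le> card A")
    case True
    then show ?thesis using fin trunc_card_small by (intro exI[of _ "\<lambda>_. 0"]) blast
  next
    case False
    then show ?thesis using k fin[of B] trunc_card_large[where B = B] by (intro exI[of _ "\<lambda>_. 1"]) blast
  qed
  then obtain a where a: "\<And>F. A \<subseteq> F \<Longrightarrow> F \<subseteq> B \<Longrightarrow> trunc_card k F = trunc_card k A + sum a (F - A)" by blast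
  obtain b where b: "interpolates b (trunc_card k) \<sigma>" using interpolates_exists fl by blast
  define c where "c = (\<lambda>e. if e \<in> B - A then a e else b e)"
  have c: "interpolates c (trunc_card k) \<sigma>" unfolding c_def
    using AB b sL a[of B] gap by (intro interpolates_modify) auto
  have "trunc_card k F - trunc_card k {} - sum c F = 0" if F: "F \<in> link \<sigma>" for F
  proof -
    have F': "A \<subseteq> F" "F \<subseteq> B" using F link_gap[OF fl AB(1,2) gap rk card] by auto
    then have "sum c F = trunc_card k A - trunc_card k {} + sum a (F - A)"
      using c AB fin by (intro interpolates_gap[of _ _ \<sigma> A B]) (auto simp: c_def)
    then show ?thesis using a[OF F'] by simp
  qed
  then show ?thesis using inter_num_Cons[OF fl _ c, of q] card len by simp
qed

text \<open>The truncation at \<open>card F\<close> is the cardinality on flats below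
  \<open>F\<close> and constant on flats above it. With \<open>F\<close> in the flag, the function
  is affine on both halves of the gap and every weight is zero.\<close>

lemma inter_num_trunc_card_self:
  assumes fl: "flag \<sigma>" and AB: "A \<in> \<sigma>" "B \<in> \<sigma>" "A \<subseteq> B" and gap: "\<And>F. F \<in> \<sigma> \<Longrightarrow> F \<subseteq> A \<or> B \<subseteq> F"
    and rk: "rk B = rk A + Suc s" and card: "card \<sigma> + s = r + 2" and len: "Suc (Suc (length q)) = s"
    and F: "F \<in> link \<sigma>"
  shows "inter_num (insert F \<sigma>) (trunc_card (card F) # q) = 0"
proof -
  let ?\<phi> = "trunc_card (card F)"
  note link = link_gap[OF fl AB(1,2) gap rk card]
  have sL: "\<sigma> \<subseteq> L" "A \<in> L" "B \<in> L" using fl AB by (auto simp: flag_def)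
  have F': "F \<in> L" "A \<subset> F" "F \<subset> B" using F link by auto
  have fin: "finite G" if "G \<subseteq> B" for G using finite_flat[OF sL(3)] that finite_subset by blast
  have fl': "flag (insert F \<sigma>)" using fl F flag_insert by blast
  have sL': "insert F \<sigma> \<subseteq> L" using sL F' by auto
  obtain b where b: "interpolates b ?\<phi> (insert F \<sigma>)" using interpolates_exists fl' by blast
  define c where "c = (\<lambda>e. if e \<in> F - A then 1 else b e)"
  have large: "?\<phi> G = ?\<phi> A + (\<Sum>e\<in>G - A. 1)" if "A \<subseteq> G" "G \<subseteq> F" for G
    using trunc_card_large[of A G F] that F' fin by auto
  have small: "?\<phi> G = ?\<phi> F + (\<Sum>e\<in>G - F. 0)" if "F \<subseteq> G" "G \<subseteq> B" for G
    using trunc_card_small[of F G] that fin by auto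
  have c: "interpolates c ?\<phi> (insert F \<sigma>)" unfolding c_def
  proof (rule interpolates_modify[OF b])
    show "(\<Sum>e\<in>F - A. 1) = ?\<phi> F - ?\<phi> A" using large[of F] F' by auto
    show "G \<subseteq> A \<or> F \<subseteq> G" if "G \<in> insert F \<sigma>" for G using gap[of G] that F' by auto
  qed (use F' AB sL' in auto)
  \<comment> \<open>The second modification takes place on \<open>B - F\<close>, disjoint from
    \<open>F - A\<close>, and so preserves the first.\<close>
  define d where "d = (\<lambda>e. if e \<in> B - F then 0 else c e)"
  have d: "interpolates d ?\<phi> (insert F \<sigma>)" unfolding d_def
  proof (rule interpolates_modify[OF c])
    show "(\<Sum>e\<in>B - F. 0) = ?\<phi> B - ?\<phi> F" using small[of B] F' by auto
    show "G \<subseteq> F \<or> B \<subseteq> G" if "G \<in> insert F \<sigma>" for G using gap[of G] that F' by auto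
  qed (use F' AB sL' in auto)
  have "?\<phi> G - ?\<phi> {} - sum d G = 0" if G: "G \<in> link (insert F \<sigma>)" for G
  proof -
    have G': "A \<subseteq> G" "G \<subseteq> B" "G \<subseteq> F \<or> F \<subseteq> G" using G F link by (auto simp: link_insert)
    show ?thesis
    proof (cases "G \<subseteq> F")
      case True
      then have "sum d G = ?\<phi> A - ?\<phi> {} + (\<Sum>e\<in>G - A. 1)"
        using d AB fin G' F' by (intro interpolates_gap[of _ _ "insert F \<sigma>" A F]) (auto simp: d_def c_def)
      then show ?thesis using large[OF G'(1) True] by simp
    next
      case False
      then have "sum d G = ?\<phi> F - ?\<phi> {} + (\<Sum>e\<in>G - F. 0)"
        using d AB fin G' F' by (intro interpolates_gap[of _ _ "insert F \<sigma>" F B]) (auto simp: d_def)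
      then show ?thesis using small[of G] G' False by simp
    qed
  qed
  moreover have "card (insert F \<sigma>) + length q = r + 1" using flag_insert_card[OF fl F] card len by simp
  ultimately show ?thesis using inter_num_Cons[OF fl' _ d, of q] by simp
qed

end

text \<open>Green's function of the negative second difference with zero boundary values. Each of
  the two partial sums telescopes to a combination of \<open>f (m - 1)\<close> and
  \<open>f m\<close>; with the weights \<open>b - m\<close> and \<open>m - a\<close> the terms in
  \<open>f (m - 1)\<close> cancel.\<close>

lemma discrete_poisson:
  fixes f g :: "nat \<Rightarrow> rat"
  assumes "a < m" "m < b" "f a = 0" "f b = 0"
    and diff: "\<And>c. a < c \<Longrightarrow> c < b \<Longrightarrow> 2 * f c - f (c - 1) - f (c + 1) = g c"
  shows "of_nat (b - a) * f m =
    of_nat (b - m) * (\<Sum>c\<in>{a<..<m}. of_nat (c - a) * g c) + of_nat (m - a) * (\<Sum>c\<in>{m..<b}. of_nat (b - c) * g c)"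
proof -
  have low: "(\<Sum>c\<in>{a<..<k}. of_nat (c - a) * g c) = of_nat (k - a) * f (k - 1) - of_nat (k - 1 - a) * f k"
    if "a < k" "k \<le> b" for k
    using that
  proof (induction k)
    case (Suc k)
    show ?case
    proof (cases "k = a")
      case True
      then show ?thesis using assms by simp
    next
      case False
      then have "{a<..<Suc k} = insert k {a<..<k}" using Suc by auto
      then have "(\<Sum>c\<in>{a<..<Suc k}. of_nat (c - a) * g c) =
        of_nat (k - a) * g k + (of_nat (k - a) * f (k - 1) - of_nat (k - 1 - a) * f k)"
        using Suc False by simp
      moreover have "g k = 2 * f k - f (k - 1) - f (k + 1)" using diff[of k] Suc False by simp
      moreover have "(of_nat (k - a) :: rat) = of_nat (k - 1 - a) + 1" using Suc False
        by (simp add: Suc_diff_Suc flip: of_nat_Suc)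
      ultimately show ?thesis using Suc False by (simp add: Suc_diff_le algebra_simps)
    qed
  qed simp
  have high: "(\<Sum>c\<in>{k..<b}. of_nat (b - c) * g c) = of_nat (b - k + 1) * f k - of_nat (b - k) * f (k - 1)"
    if "a < k" "k \<le> b" for k
    using that(2,1)
  proof (induction k rule: inc_induct)
    case base
    then show ?case using assms by simp
  next
    case (step k)
    have "(\<Sum>c\<in>{k..<b}. of_nat (b - c) * g c) =
        of_nat (b - k) * g k + (of_nat (b - Suc k + 1) * f (Suc k) - of_nat (b - Suc k) * f k)"
      using step by (simp add: sum.atLeast_Suc_lessThan)
    moreover have "g k = 2 * f k - f (k - 1) - f (k + 1)" using diff[of k] step by simp
    moreover have "(of_nat (b - k) :: rat) = of_nat (b - Suc k) + 1" using step
      by (simp add: Suc_diff_Suc flip: of_nat_Suc)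
    ultimately show ?case by (simp add: algebra_simps)
  qed
  have e: "(of_nat (b - a) :: rat) = of_nat b - of_nat a" "(of_nat (b - m) :: rat) = of_nat b - of_nat m"
    "(of_nat (m - a) :: rat) = of_nat m - of_nat a" "(of_nat (m - 1 - a) :: rat) = of_nat m - of_nat a - 1"
    "(of_nat (b - m + 1) :: rat) = of_nat b - of_nat m + 1"
    using assms by (simp_all add: of_nat_diff)
  show ?thesis unfolding low[OF assms(1) less_imp_le[OF assms(2)]] high[OF assms(1) less_imp_le[OF assms(2)]] e
    by (simp add: algebra_simps)
qed

section \<open>Evaluation by induction on the rank of the gap\<close>

context loopless_matroid
begin

text \<open>The main formula for the minor between \<open>A\<close> and \<open>B\<close>,
  strengthened to all flags with this single gap so that covers of \<open>A\<close> and hyperplanes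
  below \<open>B\<close> fall under the induction hypothesis. The bounds on \<open>i\<close> place
  \<open>i - card A\<close> between 0 and the nullity of the interval.\<close>

theorem inter_num_trunc_card:
  assumes "flag \<sigma>" "A \<in> \<sigma>" "B \<in> \<sigma>" "A \<subset> B" "\<And>F. F \<in> \<sigma> \<Longrightarrow> F \<subseteq> A \<or> B \<subseteq> F"
    "rk B = rk A + Suc s" "card \<sigma> + s = r + 2" "card A \<le> i" "i + s < card B"
  shows "inter_num \<sigma> (map trunc_card [Suc i..<Suc (i + s)]) =
    fact s * of_int (poly.coeff (spanning_poly A B) (i - card A))"
  using assms
proof (induction s arbitrary: \<sigma> A B)
  case 0
  have "is_flat M A" "is_flat M B" using "0.prems"(1-3) by (auto simp: flag_def)
  moreover have "i - card A < card (B - A)"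
    using 0 finite_flat[of B] \<open>is_flat M B\<close> by (subst card_Diff_subset) (auto intro: finite_subset)
  ultimately show ?case using 0 by (simp add: spanning_poly_corank_one)
next
  case (Suc s)
  note fl = Suc.prems(1) and AB = Suc.prems(2-4) and gap = Suc.prems(5) and rk = Suc.prems(6)
    and card = Suc.prems(7) and iA = Suc.prems(8) and iB = Suc.prems(9)
  have A: "is_flat M A" and B: "is_flat M B" using fl AB by (auto simp: flag_def)
  have fin: "finite F" if "F \<subseteq> B" for F using B finite_flat[of B] that finite_subset by blast
  have link: "link \<sigma> = {F. is_flat M F \<and> A \<subset> F \<and> F \<subset> B}"
    using link_gap[OF fl AB(1,2) gap rk card] by simp
  have sub: "A \<subseteq> B" using AB by auto
  have cardL: "card A < card F" "card F < card B" if "F \<in> link \<sigma>" for F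
    using that fin[of F] fin[of B] by (auto simp: link intro: psubset_card_mono)
  define q where "q = map trunc_card [Suc i..<Suc (i + s)]"
  have lenq: "length q = s" by (simp add: q_def)
  define f where "f = (\<lambda>c. inter_num \<sigma> (trunc_card c # q))"
  define v where "v = (\<lambda>F. inter_num (insert F \<sigma>) q)"
  define g where "g = (\<lambda>c. \<Sum>F\<in>{F \<in> link \<sigma>. card F = c}. v F)"
  \<comment> \<open>The largest index of the product; the other indices make up \<open>q\<close>.
    The number sought is \<open>f m\<close>.\<close>
  define m where "m = Suc (i + s)"
  have flen: "card \<sigma> + length q = r + 1" using card lenq by simp
  have "f (card A) = 0" "f (card B) = 0" unfolding f_def
    using inter_num_trunc_card_outside[OF fl AB(1,2) sub gap rk card] lenq by auto
  moreover have "2 * f c - f (c - 1) - f (c + 1) = g c" if c: "card A < c" "c < card B" for c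
  proof -
    let ?\<delta> = "\<lambda>F. if card F = c then 1 else 0 :: rat"
    have "?\<delta> = (\<lambda>F. 2 * trunc_card c F + (-1) * (1 * trunc_card (c - 1) F + 1 * trunc_card (c + 1) F))"
      using c by (intro ext) (auto simp: trunc_card_def min_def of_nat_diff)
    then have "2 * f c - f (c - 1) - f (c + 1) = inter_num \<sigma> (?\<delta> # q)"
      unfolding f_def by (simp only: inter_num_linear[OF fl flen]) simp
    also have "\<dots> = (\<Sum>F\<in>link \<sigma>. ?\<delta> F * v F)"
      unfolding v_def
    proof (rule inter_num_Cons_zero[OF fl flen], rule ballI)
      \<comment> \<open>Members of \<open>\<sigma>\<close> have size at most \<open>card A\<close>
        or at least \<open>card B\<close>, so the indicator of size \<open>c\<close> vanishes on the
        flag and no interpolant has to be subtracted.\<close>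
      fix F assume F: "F \<in> \<sigma>"
      have finF: "finite F" using F fl finite_flat by (auto simp: flag_def)
      then have "card F \<le> card A \<or> card B \<le> card F"
        using gap[OF F] fin[OF sub] by (auto intro: card_mono)
      then show "?\<delta> F = 0" using c by auto
    qed
    also have "\<dots> = g c" unfolding g_def
      by (rule sum.mono_neutral_cong_right) (auto split: if_splits)
    finally show ?thesis .
  qed
  ultimately have poisson: "of_nat (card B - card A) * f m =
    of_nat (card B - m) * (\<Sum>c\<in>{card A<..<m}. of_nat (c - card A) * g c)
    + of_nat (m - card A) * (\<Sum>c\<in>{m..<card B}. of_nat (card B - c) * g c)"
    using iA iB by (intro discrete_poisson) (auto simp: m_def)
  \<comment> \<open>One class in \<open>q\<close> has index \<open>card F\<close>; symmetry brings
    it to the front, where it cuts to zero.\<close>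
  have v_mid: "v F = 0" if F: "F \<in> link \<sigma>" "i < card F" "card F \<le> i + s" for F
  proof -
    have mem: "card F \<in> set [Suc i..<Suc (i + s)]" using F by auto
    then obtain us vs where split: "[Suc i..<Suc (i + s)] = us @ card F # vs" by (meson split_list)
    define p where "p = map trunc_card (us @ vs)"
    have "mset q = mset (trunc_card (card F) # p)" unfolding q_def split p_def by simp
    moreover from this have "Suc (length p) = s" using lenq by (metis length_Cons mset_eq_length)
    ultimately show ?thesis
      using inter_num_mset[OF flag_insert[OF fl F(1)], of q "trunc_card (card F) # p"]
        inter_num_trunc_card_self[OF fl AB(1,2) sub gap rk card _ F(1), of p] flag_insert_card[OF fl F(1)] flen
      by (simp add: v_def)
  qed
  \<comment> \<open>All indices in \<open>q\<close> exceed \<open>card F\<close>, so between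
    \<open>A\<close> and \<open>F\<close> every class is the plain cardinality. A gap of rank at
    least two there gives zero; if \<open>F\<close> covers \<open>A\<close>, the only remaining gap
    is the one from \<open>F\<close> to \<open>B\<close>.\<close>
  have v_low: "v F = (if rk F = Suc (rk A) then fact s * of_int (poly.coeff (spanning_poly F B) (i - card F)) else 0)"
    if F: "F \<in> link \<sigma>" "card F \<le> i" for F
  proof (cases "rk F = Suc (rk A)")
    case True
    have "v F = fact s * of_int (poly.coeff (spanning_poly F B) (i - card F))" unfolding v_def q_def
    proof (rule Suc.IH[OF flag_insert[OF fl F(1)]])
      show "card (insert F \<sigma>) + s = r + 2" using flag_insert_card[OF fl F(1)] card by simp
      show "G \<subseteq> F \<or> B \<subseteq> G" if "G \<in> insert F \<sigma>" for G using that gap[of G] F link by auto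
    qed (use True F link AB rk iB in auto)
    then show ?thesis using True by simp
  next
    case False
    have "rk A < rk F" using F link A rank_flat_strict flat_sub by auto
    have "v F = 0" unfolding v_def
    proof (rule inter_num_gap_zero[OF flag_insert[OF fl F(1)], of q A F])
      show "card (insert F \<sigma>) + length q = r + 2" using flag_insert_card[OF fl F(1)] flen by simp
      show "G \<subseteq> A \<or> F \<subseteq> G" if "G \<in> insert F \<sigma>" for G using that gap[of G] F link by auto
      show "Suc (rk A) < rk F" using False \<open>rk A < rk F\<close> by simp
      fix \<phi> assume "\<phi> \<in> set q"
      then obtain k where k: "\<phi> = trunc_card k" "i < k" by (auto simp: q_def)
      show "\<exists>a. \<forall>G\<in>{F. is_flat M F}. A \<subseteq> G \<longrightarrow> G \<subseteq> F \<longrightarrow> \<phi> G = \<phi> A + sum a (G - A)"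
      proof (intro exI[of _ "\<lambda>_. 1"] ballI impI)
        fix G assume "A \<subseteq> G" "G \<subseteq> F"
        moreover have "finite F" "card F \<le> k" using F link fin[of F] k by auto
        ultimately show "\<phi> G = \<phi> A + (\<Sum>e\<in>G - A. 1)" unfolding k(1) by (rule trunc_card_large)
      qed
    qed (use AB F link in auto)
    then show ?thesis using False by simp
  qed
  \<comment> \<open>Dually, all indices in \<open>q\<close> are below \<open>card H\<close>, so
    every class is constant between \<open>H\<close> and \<open>B\<close>.\<close>
  have v_high: "v H = (if Suc (rk H) = rk B then fact s * of_int (poly.coeff (spanning_poly A H) (i - card A)) else 0)"
    if H: "H \<in> link \<sigma>" "m \<le> card H" for H
  proof (cases "Suc (rk H) = rk B")
    case True
    have "v H = fact s * of_int (poly.coeff (spanning_poly A H) (i - card A))" unfolding v_def q_def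
    proof (rule Suc.IH[OF flag_insert[OF fl H(1)]])
      show "card (insert H \<sigma>) + s = r + 2" using flag_insert_card[OF fl H(1)] card by simp
      show "G \<subseteq> A \<or> H \<subseteq> G" if "G \<in> insert H \<sigma>" for G using that gap[of G] H link by auto
    qed (use True H link AB rk iA in \<open>auto simp: m_def\<close>)
    then show ?thesis using True by simp
  next
    case False
    have "rk H < rk B" using H link rank_flat_strict flat_sub[OF B] by auto
    have "v H = 0" unfolding v_def
    proof (rule inter_num_gap_zero[OF flag_insert[OF fl H(1)], of q H B])
      show "card (insert H \<sigma>) + length q = r + 2" using flag_insert_card[OF fl H(1)] flen by simp
      show "G \<subseteq> H \<or> B \<subseteq> G" if "G \<in> insert H \<sigma>" for G using that gap[of G] H link by auto
      show "H \<in> insert H \<sigma>" "B \<in> insert H \<sigma>" "H \<subseteq> B" using AB H link by blast+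
      show "Suc (rk H) < rk B" using False \<open>rk H < rk B\<close> by simp
      fix \<phi> assume "\<phi> \<in> set q"
      then obtain k where k: "\<phi> = trunc_card k" "k < m" by (auto simp: q_def m_def)
      show "\<exists>a. \<forall>G\<in>{F. is_flat M F}. H \<subseteq> G \<longrightarrow> G \<subseteq> B \<longrightarrow> \<phi> G = \<phi> H + sum a (G - H)"
      proof (intro exI[of _ "\<lambda>_. 0"] ballI impI)
        fix G assume "H \<subseteq> G" "G \<subseteq> B"
        moreover have "finite G" "k \<le> card H" using H k fin[OF \<open>G \<subseteq> B\<close>] by auto
        ultimately show "\<phi> G = \<phi> H + (\<Sum>e\<in>G - H. 0)" unfolding k(1) by (intro trunc_card_small)
      qed
    qed
    then show ?thesis using False by simp
  qed
  have group: "(\<Sum>c\<in>T. w c * g c) = (\<Sum>F\<in>{F \<in> link \<sigma>. card F \<in> T}. w (card F) * v F)"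
    if "finite T" for T and w :: "nat \<Rightarrow> rat"
  proof -
    have "(\<Sum>F\<in>{F \<in> link \<sigma>. card F \<in> T}. w (card F) * v F) =
      (\<Sum>c\<in>T. \<Sum>F\<in>{F \<in> {F \<in> link \<sigma>. card F \<in> T}. card F = c}. w (card F) * v F)"
      by (rule sum.group[symmetric]) (use that in auto)
    also have "\<dots> = (\<Sum>c\<in>T. w c * g c)"
      unfolding g_def sum_distrib_left by (intro sum.cong) auto
    finally show ?thesis by simp
  qed
  let ?j = "i - card A"
  let ?atoms = "{F. is_flat M F \<and> A \<subseteq> F \<and> F \<subseteq> B \<and> rk F = Suc (rk A)}"
  let ?hyps = "{H. is_flat M H \<and> A \<subseteq> H \<and> H \<subseteq> B \<and> Suc (rk H) = rk B}"
  have finflats: "finite ?atoms" "finite ?hyps"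
    using finite_flats by (auto elim: rev_finite_subset)
  have cardD: "card (F - A) = card F - card A" "card A \<le> card F" if "A \<subseteq> F" "F \<subseteq> B" for F
    using that fin[of F] fin[OF sub] by (auto simp: card_Diff_subset intro: card_mono)
  \<comment> \<open>The index sets differ, but flats of the link that do not cover \<open>A\<close>
    have \<open>v F = 0\<close>, and a cover with more than \<open>i\<close> elements is cut off on
    the right by the condition on \<open>?j\<close>.\<close>
  have "(\<Sum>c\<in>{card A<..<m}. of_nat (c - card A) * g c) =
    (\<Sum>F\<in>?atoms. fact s * of_int (int (card (F - A)) *
       (if card (F - A) \<le> ?j then poly.coeff (spanning_poly F B) (?j - card (F - A)) else 0)))"
    unfolding group[OF finite_greaterThanLessThan]
  proof (rule sum.mono_neutral_cong[OF finflats(1)])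
    show "finite {F \<in> link \<sigma>. card F \<in> {card A<..<m}}" by simp
    fix F assume F: "F \<in> ?atoms - {F \<in> link \<sigma>. card F \<in> {card A<..<m}}"
    have "F \<in> link \<sigma>" using F rk by (auto simp: link)
    then have "\<not> card F < m" using F cardL by auto
    then show "fact s * of_int (int (card (F - A)) *
       (if card (F - A) \<le> ?j then poly.coeff (spanning_poly F B) (?j - card (F - A)) else 0)) = (0::rat)"
      using F cardD[of F] iA by (auto simp: m_def)
  next
    fix F assume F: "F \<in> {F \<in> link \<sigma>. card F \<in> {card A<..<m}} - ?atoms"
    then have "v F = 0" using v_mid[of F] v_low[of F] by (cases "card F \<le> i") (auto simp: link m_def)
    then show "of_nat (card F - card A) * v F = 0" by simp
  next
    fix F assume F: "F \<in> {F \<in> link \<sigma>. card F \<in> {card A<..<m}} \<inter> ?atoms"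
    show "of_nat (card F - card A) * v F = fact s * of_int (int (card (F - A)) *
       (if card (F - A) \<le> ?j then poly.coeff (spanning_poly F B) (?j - card (F - A)) else 0))"
    proof (cases "card F \<le> i")
      case True
      then have "card (F - A) \<le> ?j" "?j - card (F - A) = i - card F" using cardD[of F] F by auto
      then show ?thesis using v_low[of F] True F cardD[of F] by simp
    next
      case False
      then have "\<not> card (F - A) \<le> ?j" using cardD[of F] F by auto
      then show ?thesis using v_mid[of F] False F by (auto simp: m_def)
    qed
  qed
  also have "\<dots> = fact s * of_int (\<Sum>F\<in>?atoms. int (card (F - A)) *
       (if card (F - A) \<le> ?j then poly.coeff (spanning_poly F B) (?j - card (F - A)) else 0))"
    by (simp add: sum_distrib_left)
  finally have low: "(\<Sum>c\<in>{card A<..<m}. of_nat (c - card A) * g c) = \<dots>" .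
  \<comment> \<open>A hyperplane with fewer than \<open>m\<close> elements is absent on the left; on
    the right its coefficient vanishes by the degree bound.\<close>
  have "(\<Sum>c\<in>{m..<card B}. of_nat (card B - c) * g c) =
    (\<Sum>H\<in>?hyps. fact s * of_int (int (card (B - H)) * poly.coeff (spanning_poly A H) ?j))"
    unfolding group[OF finite_atLeastLessThan]
  proof (rule sum.mono_neutral_cong[OF finflats(2)])
    show "finite {F \<in> link \<sigma>. card F \<in> {m..<card B}}" by simp
    fix H assume H: "H \<in> ?hyps - {F \<in> link \<sigma>. card F \<in> {m..<card B}}"
    have "H \<in> link \<sigma>" using H rk by (auto simp: link)
    then have "card H < m" using H cardL by auto
    then have "card (H - A) < ?j + (rk H - rk A)" using H cardD[of H] iA rk by (auto simp: m_def)
    then show "fact s * of_int (int (card (B - H)) * poly.coeff (spanning_poly A H) ?j) = (0::rat)"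
      using degree_spanning_poly[of H A ?j] H by simp
  next
    fix H assume H: "H \<in> {F \<in> link \<sigma>. card F \<in> {m..<card B}} - ?hyps"
    then have "v H = 0" using v_high[of H] by (auto simp: link)
    then show "of_nat (card B - card H) * v H = 0" by simp
  next
    fix H assume H: "H \<in> {F \<in> link \<sigma>. card F \<in> {m..<card B}} \<inter> ?hyps"
    have "card (B - H) = card B - card H" using H fin by (auto simp: card_Diff_subset)
    then show "of_nat (card B - card H) * v H =
      fact s * of_int (int (card (B - H)) * poly.coeff (spanning_poly A H) ?j)"
      using v_high[of H] H by simp
  qed
  also have "\<dots> = fact s * of_int (\<Sum>H\<in>?hyps. int (card (B - H)) * poly.coeff (spanning_poly A H) ?j)"
    by (simp add: sum_distrib_left)
  finally have high: "(\<Sum>c\<in>{m..<card B}. of_nat (card B - c) * g c) = \<dots>" .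
  have mA: "m - card A = ?j + Suc s" using iA by (simp add: m_def)
  have mB: "int (card B - m) = int (card (B - A)) - int (?j + Suc s)"
    using cardD[of B] sub iA iB by (simp add: m_def)
  have "of_nat (card B - card A) * f m = fact s * of_int (
     int (card B - m) * (\<Sum>F\<in>?atoms. int (card (F - A)) *
       (if card (F - A) \<le> ?j then poly.coeff (spanning_poly F B) (?j - card (F - A)) else 0))
     + int (m - card A) * (\<Sum>H\<in>?hyps. int (card (B - H)) * poly.coeff (spanning_poly A H) ?j))"
    unfolding poisson low high by (simp add: algebra_simps)
  \<comment> \<open>The interval has rank \<open>Suc (Suc s)\<close>, so the recurrence is taken at
    \<open>Suc s\<close>; its factor \<open>Suc s\<close> turns \<open>fact s\<close> into
    \<open>fact (Suc s)\<close>.\<close>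
  also have "\<dots> = fact s * of_int (int (card (B - A)) * int (Suc s) * poly.coeff (spanning_poly A B) ?j)"
    unfolding mB mA using spanning_poly_recurrence[OF A B AB(3), of "Suc s" ?j] rk by (simp add: add.commute)
  finally have "of_nat (card B - card A) * f m =
    of_nat (card B - card A) * (fact (Suc s) * of_int (poly.coeff (spanning_poly A B) ?j))"
    using cardD[of B] sub by (simp add: mult_ac)
  moreover have "(of_nat (card B - card A) :: rat) \<noteq> 0"
    using psubset_card_mono[OF fin[of B] AB(3)] by simp
  ultimately have "f m = fact (Suc s) * of_int (poly.coeff (spanning_poly A B) ?j)"
    by (metis mult_cancel_left)
  moreover have "inter_num \<sigma> (map trunc_card [Suc i..<Suc (i + Suc s)]) = f m"
    unfolding f_def
  proof (rule inter_num_mset[OF fl])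
    show "mset (map trunc_card [Suc i..<Suc (i + Suc s)]) = mset (trunc_card m # q)"
      by (simp add: q_def m_def)
    show "card \<sigma> + length (map trunc_card [Suc i..<Suc (i + Suc s)]) = r + 2" using card by simp
  qed
  ultimately show ?case by simp
qed

end

section \<open>Words and polynomials\<close>

text \<open>Monomials are handled as words because intersection numbers consume their functions one
  at a time; the exponent vector forgets the order.\<close>

definition exponent :: "'v list \<Rightarrow> ('v \<Rightarrow>\<^sub>0 nat)" where
  "exponent xs = (\<Sum>x\<leftarrow>xs. Poly_Mapping.single x 1)"

definition word_poly :: "'v list \<Rightarrow> 'v int_mpoly" where
  "word_poly xs = (\<Prod>x\<leftarrow>xs. mvar x)"

lemma word_poly_Nil [simp]: "word_poly [] = 1"
  and word_poly_Cons [simp]: "word_poly (x # xs) = mvar x * word_poly xs"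
  by (simp_all add: word_poly_def)

lemma word_poly_single: "word_poly xs = Poly_Mapping.single (exponent xs) 1"
  by (induction xs) (simp_all add: exponent_def mvar_def mult_single)

lemma lookup_exponent: "Poly_Mapping.lookup (exponent xs) v = count (mset xs) v"
  by (induction xs) (auto simp: exponent_def lookup_add lookup_single when_def)

lemma exponent_eq_iff: "exponent xs = exponent ys \<longleftrightarrow> mset xs = mset ys"
  by (metis lookup_exponent multiset_eqI poly_mapping_eqI)

lemma exponent_surj: "\<exists>xs. exponent xs = m"
proof -
  have "finite {x. 0 < Poly_Mapping.lookup m x}"
    using finite_lookup[of m] by simp
  then have "count (Abs_multiset (Poly_Mapping.lookup m)) = Poly_Mapping.lookup m"
    by (rule count_Abs_multiset)
  moreover obtain xs where "mset xs = Abs_multiset (Poly_Mapping.lookup m)" using ex_mset by blast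
  ultimately have "exponent xs = m" by (intro poly_mapping_eqI) (simp add: lookup_exponent)
  then show ?thesis ..
qed

lemma keys_exponent: "Poly_Mapping.keys (exponent xs) = set xs"
  by (auto simp: in_keys_iff lookup_exponent count_eq_zero_iff)

lemma exponent_degree:
  "(\<Sum>v\<in>Poly_Mapping.keys (exponent xs). Poly_Mapping.lookup (exponent xs) v) = length xs"
  by (simp add: keys_exponent lookup_exponent size_mset[symmetric] size_multiset_overloaded_eq del: size_mset)

lemma exponent_append: "exponent (xs @ ys) = exponent xs + exponent ys"
  by (simp add: exponent_def)

lemma homogeneous_mult: "homogeneous d p \<Longrightarrow> homogeneous e q \<Longrightarrow> homogeneous (d + e) (p * q)"
  unfolding homogeneous_def
proof
  fix m assume p: "\<forall>m\<in>Poly_Mapping.keys p. (\<Sum>v\<in>Poly_Mapping.keys m. Poly_Mapping.lookup m v) = d"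
    and q: "\<forall>m\<in>Poly_Mapping.keys q. (\<Sum>v\<in>Poly_Mapping.keys m. Poly_Mapping.lookup m v) = e"
    and m: "m \<in> Poly_Mapping.keys (p * q)"
  obtain a b where ab: "m = a + b" "a \<in> Poly_Mapping.keys p" "b \<in> Poly_Mapping.keys q"
    using m keys_mult[of p q] by auto
  obtain xs ys where xs: "a = exponent xs" and ys: "b = exponent ys" using exponent_surj by metis
  have "length xs = d" "length ys = e" using p q ab exponent_degree[of xs] exponent_degree[of ys] xs ys by auto
  then show "(\<Sum>v\<in>Poly_Mapping.keys m. Poly_Mapping.lookup m v) = d + e"
    using exponent_degree[of "xs @ ys"] by (simp add: ab xs ys exponent_append)
qed

lemma homogeneous_add: "homogeneous d p \<Longrightarrow> homogeneous d q \<Longrightarrow> homogeneous d (p + q)"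
  unfolding homogeneous_def using keys_add[of p q] by blast

lemma homogeneous_0: "homogeneous d 0"
  by (simp add: homogeneous_def)

lemma homogeneous_sum: "(\<And>x. x \<in> A \<Longrightarrow> homogeneous d (f x)) \<Longrightarrow> homogeneous d (sum f A)"
  by (induction A rule: infinite_finite_induct) (auto intro: homogeneous_add homogeneous_0)

lemma homogeneous_word: "homogeneous (length xs) (word_poly xs)"
  unfolding homogeneous_def word_poly_single by (auto simp: exponent_degree)

lemma homogeneous_of_int: "homogeneous 0 (of_int c)"
proof -
  have "(of_int c :: 'a int_mpoly) = Poly_Mapping.single 0 c"
    by (metis of_int_eq_id id_apply single_of_int)
  then show ?thesis by (simp add: homogeneous_def)
qed

lemma homogeneous_of_int_mult: "homogeneous d p \<Longrightarrow> homogeneous d (of_int c * p)"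
  using homogeneous_mult[OF homogeneous_of_int] by fastforce

section \<open>The Chow ring as a ring of congruence classes\<close>

context loopless_matroid
begin

abbreviation "PF \<equiv> proper_flats M"
abbreviation "polys \<equiv> carrier (flat_poly_ring M)"

lemma PF_iff: "F \<in> PF \<longleftrightarrow> is_flat M F \<and> F \<noteq> {} \<and> F \<noteq> E"
  by (simp add: proper_flats_def)

lemma finite_PF: "finite PF"
  using finite_flats by (auto simp: proper_flats_def elim: rev_finite_subset)

lemma polys_iff: "p \<in> polys \<longleftrightarrow> (\<forall>m\<in>Poly_Mapping.keys p. Poly_Mapping.keys m \<subseteq> PF)"
  by (simp add: flat_poly_ring_def)

lemma ring_simps [simp]:
  "p \<otimes>\<^bsub>flat_poly_ring M\<^esub> q = p * q" "p \<oplus>\<^bsub>flat_poly_ring M\<^esub> q = p + q"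
  "\<one>\<^bsub>flat_poly_ring M\<^esub> = 1" "\<zero>\<^bsub>flat_poly_ring M\<^esub> = 0"
  by (simp_all add: flat_poly_ring_def)

lemma polys_0 [simp]: "0 \<in> polys"
  and polys_1 [simp]: "1 \<in> polys"
  by (simp_all add: polys_iff)

lemma polys_add: "p \<in> polys \<Longrightarrow> q \<in> polys \<Longrightarrow> p + q \<in> polys"
  unfolding polys_iff using keys_add[of p q] by blast

lemma polys_uminus: "p \<in> polys \<Longrightarrow> - p \<in> polys"
  by (simp add: polys_iff)

lemma polys_diff: "p \<in> polys \<Longrightarrow> q \<in> polys \<Longrightarrow> p - q \<in> polys"
  unfolding polys_iff using keys_diff[of p q] by blast

lemma polys_mult: "p \<in> polys \<Longrightarrow> q \<in> polys \<Longrightarrow> p * q \<in> polys"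
  unfolding polys_iff
proof
  fix m assume p: "\<forall>m\<in>Poly_Mapping.keys p. Poly_Mapping.keys m \<subseteq> PF"
    and q: "\<forall>m\<in>Poly_Mapping.keys q. Poly_Mapping.keys m \<subseteq> PF" and m: "m \<in> Poly_Mapping.keys (p * q)"
  then obtain a b where "m = a + b" "a \<in> Poly_Mapping.keys p" "b \<in> Poly_Mapping.keys q"
    using keys_mult[of p q] by auto
  then show "Poly_Mapping.keys m \<subseteq> PF" using p q keys_add[of a b] by blast
qed

lemma polys_mvar: "F \<in> PF \<Longrightarrow> mvar F \<in> polys"
  by (simp add: polys_iff mvar_def)

lemma polys_of_int: "of_int c \<in> polys"
proof -
  have "(of_int c :: 'a set int_mpoly) = Poly_Mapping.single 0 c"
    by (metis of_int_eq_id id_apply single_of_int)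
  then show ?thesis by (simp add: polys_iff)
qed

lemma polys_sum: "(\<And>x. x \<in> A \<Longrightarrow> f x \<in> polys) \<Longrightarrow> sum f A \<in> polys"
  by (induction A rule: infinite_finite_induct) (auto intro: polys_add)

lemma polys_prod: "(\<And>x. x \<in> A \<Longrightarrow> f x \<in> polys) \<Longrightarrow> prod f A \<in> polys"
  by (induction A rule: infinite_finite_induct) (auto intro: polys_mult)

lemma polys_power: "p \<in> polys \<Longrightarrow> p ^ k \<in> polys"
  by (induction k) (auto intro: polys_mult)

lemma polys_word: "set xs \<subseteq> PF \<Longrightarrow> word_poly xs \<in> polys"
  by (induction xs) (auto intro: polys_mult polys_mvar)

lemmas polys_intros = polys_add polys_diff polys_mult polys_mvar polys_of_int polys_sum polys_prod
  polys_power polys_word polys_uminus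

lemma cring_polys: "cring (flat_poly_ring M)"
proof (rule cringI)
  show "abelian_group (flat_poly_ring M)"
  proof (rule abelian_groupI)
    fix x assume "x \<in> polys"
    then show "\<exists>y\<in>polys. y \<oplus>\<^bsub>flat_poly_ring M\<^esub> x = \<zero>\<^bsub>flat_poly_ring M\<^esub>"
      using polys_uminus by (intro bexI[of _ "- x"]) auto
  qed (auto simp: add_ac intro: polys_add)
  show "Group.comm_monoid (flat_poly_ring M)"
    by (rule comm_monoidI) (auto simp: mult_ac intro: polys_mult)
qed (auto simp: algebra_simps)

lemma ring_polys: "ring (flat_poly_ring M)"
  using cring_polys cring.axioms(1) by blast

lemma ring_uminus: "p \<in> polys \<Longrightarrow> \<ominus>\<^bsub>flat_poly_ring M\<^esub> p = - p"
  using abelian_group.minus_equality[OF ring.is_abelian_group[OF ring_polys], of "- p" p]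
  by (simp add: polys_uminus)

lemma ring_minus: "p \<in> polys \<Longrightarrow> q \<in> polys \<Longrightarrow> p \<ominus>\<^bsub>flat_poly_ring M\<^esub> q = p - q"
  by (simp add: a_minus_def ring_uminus)

definition star_sum :: "'a \<Rightarrow> 'a set int_mpoly" where
  "star_sum e = (\<Sum>F\<in>{F \<in> PF. e \<in> F}. mvar F)"

lemma polys_star_sum: "star_sum e \<in> polys"
  unfolding star_sum_def by (intro polys_intros) auto

lemma incomparable_gens: "{mvar F * mvar G | F G. F \<in> PF \<and> G \<in> PF \<and> \<not> F \<subseteq> G \<and> \<not> G \<subseteq> F} \<subseteq> polys"
  by (auto intro!: polys_intros)

lemma linear_gens: "{(\<Sum>F\<in>{F \<in> PF. i \<in> F}. mvar F) - (\<Sum>F\<in>{F \<in> PF. j \<in> F}. mvar F) | i j. i \<in> E \<and> j \<in> E} \<subseteq> polys"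
  using polys_star_sum by (auto simp: star_sum_def[symmetric] intro!: polys_diff)

lemma ideal_incomparable: "ideal (incomparable_ideal M) (flat_poly_ring M)"
  unfolding incomparable_ideal_def by (rule ring.genideal_ideal[OF ring_polys incomparable_gens])

lemma ideal_linear: "ideal (linear_ideal M) (flat_poly_ring M)"
  unfolding linear_ideal_def by (rule ring.genideal_ideal[OF ring_polys linear_gens])

lemma ideal_chow: "ideal (chow_ideal M) (flat_poly_ring M)"
  unfolding chow_ideal_def by (rule ring.add_ideals[OF ring_polys ideal_incomparable ideal_linear])

lemma chow_ideal_iff: "p \<in> chow_ideal M \<longleftrightarrow> (\<exists>a\<in>incomparable_ideal M. \<exists>b\<in>linear_ideal M. p = a + b)"
  by (auto simp: chow_ideal_def set_add_def' )

lemma chow_ideal_0 [simp]: "0 \<in> chow_ideal M"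
  using additive_subgroup.zero_closed[OF ideal.axioms(1)[OF ideal_chow]] by simp

lemma chow_ideal_add: "p \<in> chow_ideal M \<Longrightarrow> q \<in> chow_ideal M \<Longrightarrow> p + q \<in> chow_ideal M"
  using additive_subgroup.a_closed[OF ideal.axioms(1)[OF ideal_chow], of p q] by simp

lemma chow_ideal_mult: "p \<in> chow_ideal M \<Longrightarrow> q \<in> polys \<Longrightarrow> q * p \<in> chow_ideal M"
  using ideal.I_l_closed[OF ideal_chow, of p q] by simp

lemma chow_ideal_uminus: "p \<in> chow_ideal M \<Longrightarrow> - p \<in> chow_ideal M"
  using chow_ideal_mult[of p "- 1"] polys_uminus[of 1] by simp

lemma chow_ideal_diff: "p \<in> chow_ideal M \<Longrightarrow> q \<in> chow_ideal M \<Longrightarrow> p - q \<in> chow_ideal M"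
  using chow_ideal_add[of p "- q"] chow_ideal_uminus by simp

lemma chow_ideal_sum: "(\<And>x. x \<in> A \<Longrightarrow> f x \<in> chow_ideal M) \<Longrightarrow> sum f A \<in> chow_ideal M"
  by (induction A rule: infinite_finite_induct) (auto intro: chow_ideal_add)

lemma chow_ideal_incomparable:
  assumes "F \<in> PF" "G \<in> PF" "\<not> F \<subseteq> G" "\<not> G \<subseteq> F"
  shows "mvar F * mvar G \<in> chow_ideal M"
proof -
  have "mvar F * mvar G \<in> incomparable_ideal M"
    unfolding incomparable_ideal_def
    by (rule subsetD[OF ring.genideal_self[OF ring_polys incomparable_gens]]) (use assms in blast)
  moreover have "0 \<in> linear_ideal M"
    using additive_subgroup.zero_closed[OF ideal.axioms(1)[OF ideal_linear]] by simp
  ultimately show ?thesis unfolding chow_ideal_iff by force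
qed

lemma chow_ideal_linear:
  assumes "i \<in> E" "j \<in> E"
  shows "star_sum i - star_sum j \<in> chow_ideal M"
proof -
  have "star_sum i - star_sum j \<in> linear_ideal M"
    unfolding linear_ideal_def star_sum_def
    by (rule subsetD[OF ring.genideal_self[OF ring_polys linear_gens]]) (use assms in blast)
  moreover have "0 \<in> incomparable_ideal M"
    using additive_subgroup.zero_closed[OF ideal.axioms(1)[OF ideal_incomparable]] by simp
  ultimately show ?thesis unfolding chow_ideal_iff by force
qed

lemma chow_ideal_minimal:
  assumes "ideal K (flat_poly_ring M)"
    and "\<And>F G. \<lbrakk>F \<in> PF; G \<in> PF; \<not> F \<subseteq> G; \<not> G \<subseteq> F\<rbrakk> \<Longrightarrow> mvar F * mvar G \<in> K"
    and "\<And>i j. \<lbrakk>i \<in> E; j \<in> E\<rbrakk> \<Longrightarrow> star_sum i - star_sum j \<in> K"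
  shows "chow_ideal M \<subseteq> K"
proof
  fix p assume "p \<in> chow_ideal M"
  then obtain a b where p: "p = a + b" "a \<in> incomparable_ideal M" "b \<in> linear_ideal M"
    unfolding chow_ideal_iff by blast
  have "incomparable_ideal M \<subseteq> K" unfolding incomparable_ideal_def
    by (rule ring.genideal_minimal[OF ring_polys assms(1)]) (use assms(2) in blast)
  then have "a \<in> K" using p(2) by blast
  have "linear_ideal M \<subseteq> K" unfolding linear_ideal_def
    by (rule ring.genideal_minimal[OF ring_polys assms(1)]) (use assms(3)[unfolded star_sum_def] in blast)
  then have "b \<in> K" using p(3) by blast
  with \<open>a \<in> K\<close> show "p \<in> K"
    using additive_subgroup.a_closed[OF ideal.axioms(1)[OF assms(1)], of a b] p by simp
qed

lemma chow_class_eq_iff: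
  "p \<in> polys \<Longrightarrow> q \<in> polys \<Longrightarrow> chow_class M p = chow_class M q \<longleftrightarrow> p - q \<in> chow_ideal M"
  using ring.quotient_eq_iff_same_a_r_cos[OF ring_polys ideal_chow, of p q]
  by (simp add: chow_class_def ring_minus)

lemma chow_class_add: "p \<in> polys \<Longrightarrow> q \<in> polys \<Longrightarrow>
    chow_class M p \<oplus>\<^bsub>chow_ring M\<^esub> chow_class M q = chow_class M (p + q)"
  using ideal.a_rcos_sum[OF ideal_chow, of p q] by (simp add: chow_class_def chow_ring_def FactRing_def)

lemma ring_hom_chow: "ring_hom_cring (flat_poly_ring M) (chow_ring M) (chow_class M)"
proof -
  have "chow_class M = (+>\<^bsub>flat_poly_ring M\<^esub>) (chow_ideal M)"
    by (intro ext) (simp add: chow_class_def)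
  then show ?thesis unfolding chow_ring_def using ideal.rcos_ring_hom_cring[OF ideal_chow cring_polys] by simp
qed

lemma chow_class_prod:
  assumes "finite A" "\<And>k. k \<in> A \<Longrightarrow> p k \<in> polys"
  shows "(\<Otimes>\<^bsub>chow_ring M\<^esub>k\<in>A. chow_class M (p k)) = chow_class M (prod p A)"
proof -
  interpret ring_hom_cring "flat_poly_ring M" "chow_ring M" "chow_class M" by (rule ring_hom_chow)
  have "(\<Otimes>\<^bsub>flat_poly_ring M\<^esub>k\<in>A. p k) = prod p A"
    using assms by (induction A rule: finite_induct) (auto simp: R.finprod_insert Pi_def)
  moreover have "chow_class M (\<Otimes>\<^bsub>flat_poly_ring M\<^esub>k\<in>A. p k) = (\<Otimes>\<^bsub>chow_ring M\<^esub>k\<in>A. (chow_class M \<circ> p) k)"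
    using assms by (intro hom_finprod) auto
  ultimately show ?thesis by (simp add: comp_def)
qed

section \<open>The top degree part is generated by one class\<close>

text \<open>\<open>{}\<close> and \<open>E\<close> belong to every flag but carry no
  variable.\<close>

definition flag_poly :: "'a set set \<Rightarrow> 'a set int_mpoly" where
  "flag_poly \<sigma> = (\<Prod>F\<in>\<sigma> - {{}, E}. mvar F)"

lemma flag_PF: "flag \<sigma> \<Longrightarrow> F \<in> \<sigma> \<Longrightarrow> F \<noteq> {} \<Longrightarrow> F \<noteq> E \<Longrightarrow> F \<in> PF"
  by (auto simp: flag_def PF_iff)

lemma polys_flag_poly: "flag \<sigma> \<Longrightarrow> flag_poly \<sigma> \<in> polys"
  unfolding flag_poly_def by (intro polys_prod polys_mvar) (auto intro: flag_PF)

lemma link_PF: "flag \<sigma> \<Longrightarrow> F \<in> link \<sigma> \<Longrightarrow> F \<in> PF"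
  by (auto simp: flag_def link_def PF_iff)

lemma flag_poly_insert: "flag \<sigma> \<Longrightarrow> F \<in> link \<sigma> \<Longrightarrow> flag_poly (insert F \<sigma>) = mvar F * flag_poly \<sigma>"
proof -
  assume \<sigma>: "flag \<sigma>" "F \<in> link \<sigma>"
  then have "F \<noteq> {}" "F \<noteq> E" "F \<notin> \<sigma>" by (auto simp: flag_def link_def)
  then have "insert F \<sigma> - {{}, E} = insert F (\<sigma> - {{}, E})" by auto
  then show ?thesis using \<sigma> flag_finite[of \<sigma>] \<open>F \<notin> \<sigma>\<close> by (simp add: flag_poly_def)
qed

lemma flag_poly_incomparable:
  assumes "flag \<sigma>" "G \<in> PF" "H \<in> \<sigma>" "\<not> G \<subseteq> H" "\<not> H \<subseteq> G"
  shows "mvar G * flag_poly \<sigma> \<in> chow_ideal M"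
proof -
  have H: "H \<in> \<sigma> - {{}, E}" using assms flat_sub by (auto simp: PF_iff)
  have fin: "finite (\<sigma> - {{}, E})" using flag_finite assms by auto
  have "flag_poly \<sigma> = mvar H * (\<Prod>F\<in>\<sigma> - {{}, E} - {H}. mvar F)"
    unfolding flag_poly_def by (rule prod.remove[OF fin H])
  then have "mvar G * flag_poly \<sigma> = (\<Prod>F\<in>\<sigma> - {{}, E} - {H}. mvar F) * (mvar G * mvar H)"
    by (simp add: mult_ac)
  moreover have "(\<Prod>F\<in>\<sigma> - {{}, E} - {H}. mvar F) \<in> polys"
    using assms(1) by (intro polys_prod polys_mvar) (auto intro: flag_PF)
  moreover have "mvar G * mvar H \<in> chow_ideal M"
    using assms H by (intro chow_ideal_incomparable) (auto intro: flag_PF)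
  ultimately show ?thesis using chow_ideal_mult by simp
qed

text \<open>The linear relations allow \<open>star_sum e'\<close> to be replaced by
  \<open>star_sum e\<close> with \<open>e\<close> outside the largest proper member
  \<open>B\<close>. A flat containing \<open>e\<close> outside the link is incomparable with some
  member of \<open>\<tau>\<close>; the remaining ones lie strictly above \<open>B\<close>.\<close>

lemma star_sum_flag_poly:
  assumes fl: "flag \<tau>" and B: "B \<in> \<tau>" "\<And>F. F \<in> \<tau> \<Longrightarrow> F = E \<or> F \<subseteq> B" and e: "e \<in> E - B" and e': "e' \<in> E"
  shows "star_sum e' * flag_poly \<tau> - (\<Sum>G\<in>{G \<in> link \<tau>. e \<in> G}. flag_poly (insert G \<tau>)) \<in> chow_ideal M"
proof -
  have "star_sum e * flag_poly \<tau> = (\<Sum>G\<in>{G \<in> PF. e \<in> G}. mvar G * flag_poly \<tau>)"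
    by (simp add: star_sum_def sum_distrib_right)
  also have "{G \<in> PF. e \<in> G} = {G \<in> link \<tau>. e \<in> G} \<union> {G \<in> PF - link \<tau>. e \<in> G}"
    using link_PF[OF fl] by blast
  also have "(\<Sum>G\<in>\<dots>. mvar G * flag_poly \<tau>) = (\<Sum>G\<in>{G \<in> link \<tau>. e \<in> G}. mvar G * flag_poly \<tau>) +
     (\<Sum>G\<in>{G \<in> PF - link \<tau>. e \<in> G}. mvar G * flag_poly \<tau>)"
    by (rule sum.union_disjoint) (use finite_PF in auto)
  also have "(\<Sum>G\<in>{G \<in> link \<tau>. e \<in> G}. mvar G * flag_poly \<tau>) = (\<Sum>G\<in>{G \<in> link \<tau>. e \<in> G}. flag_poly (insert G \<tau>))"
    using flag_poly_insert[OF fl] by (intro sum.cong) auto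
  finally have eq: "star_sum e * flag_poly \<tau> = \<dots> + (\<Sum>G\<in>{G \<in> PF - link \<tau>. e \<in> G}. mvar G * flag_poly \<tau>)" .
  have "(\<Sum>G\<in>{G \<in> PF - link \<tau>. e \<in> G}. mvar G * flag_poly \<tau>) \<in> chow_ideal M"
  proof (rule chow_ideal_sum)
    fix G assume G: "G \<in> {G \<in> PF - link \<tau>. e \<in> G}"
    then have "G \<notin> \<tau>" using B(2)[of G] e by (auto simp: PF_iff)
    then obtain H where "H \<in> \<tau>" "\<not> G \<subseteq> H" "\<not> H \<subseteq> G" using G by (auto simp: link_def PF_iff)
    then show "mvar G * flag_poly \<tau> \<in> chow_ideal M" using flag_poly_incomparable[OF fl] G by auto
  qed
  moreover have "flag_poly \<tau> * (star_sum e' - star_sum e) \<in> chow_ideal M"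
    using chow_ideal_mult chow_ideal_linear e e' polys_flag_poly[OF fl] by blast
  moreover have "star_sum e' * flag_poly \<tau> - (\<Sum>G\<in>{G \<in> link \<tau>. e \<in> G}. flag_poly (insert G \<tau>)) =
    flag_poly \<tau> * (star_sum e' - star_sum e) + (\<Sum>G\<in>{G \<in> PF - link \<tau>. e \<in> G}. mvar G * flag_poly \<tau>)"
    using eq by (simp add: algebra_simps)
  ultimately show ?thesis using chow_ideal_add by simp
qed

lemma star_sum_flag_poly_power:
  assumes fl: "flag \<tau>" and B: "B \<in> \<tau>" "\<And>F. F \<in> \<tau> \<Longrightarrow> F = E \<or> F \<subseteq> B" and e: "e \<in> E - B" and e': "e' \<in> E"
  shows "star_sum e' ^ Suc j * flag_poly \<tau> - (\<Sum>G\<in>{G \<in> link \<tau>. e \<in> G}. star_sum e' ^ j * flag_poly (insert G \<tau>))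
    \<in> chow_ideal M"
proof -
  have "star_sum e' ^ j * (star_sum e' * flag_poly \<tau> - (\<Sum>G\<in>{G \<in> link \<tau>. e \<in> G}. flag_poly (insert G \<tau>)))
    \<in> chow_ideal M"
    using star_sum_flag_poly[OF assms] polys_power[OF polys_star_sum] chow_ideal_mult by blast
  then show ?thesis by (simp add: right_diff_distrib sum_distrib_left mult_ac)
qed

text \<open>\<open>star_sum e\<close> represents the class usually called \<open>\<alpha>\<close>; every monomial of a complete flag
  is congruent to \<open>\<alpha>\<^sup>r\<close>, which avoids a connectedness argument for complete flags.\<close>

lemma star_sum_power_vanish:
  assumes "flag \<tau>" "B \<in> \<tau>" "B \<noteq> E" "\<And>F. F \<in> \<tau> \<Longrightarrow> F = E \<or> F \<subseteq> B" "r < rk B + j" "e' \<in> E"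
  shows "star_sum e' ^ j * flag_poly \<tau> \<in> chow_ideal M"
  using assms
proof (induction j arbitrary: \<tau> B)
  case 0
  have "is_flat M B" using 0 by (auto simp: flag_def)
  moreover from this have "B \<subset> E" using flat_sub[of B] "0.prems"(3) by simp
  ultimately have "rk B < rk E" by (intro rank_flat_strict) auto
  then show ?case using "0.prems"(5) rank_ground by simp
next
  case (Suc j)
  have B: "is_flat M B" using Suc.prems by (auto simp: flag_def)
  have "B \<subset> E" using flat_sub[OF B] Suc.prems(3) by simp
  then obtain e where e: "e \<in> E - B" using psubset_imp_ex_mem by metis
  \<comment> \<open>Each factor inserts a new largest proper member of higher rank, and only
    \<open>r - rk B\<close> ranks are left for proper flats.\<close>
  have "star_sum e' ^ j * flag_poly (insert G \<tau>) \<in> chow_ideal M" if G: "G \<in> {G \<in> link \<tau>. e \<in> G}" for G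
  proof (rule Suc.IH[of _ G])
    have "B \<subset> G" using G e Suc.prems(2) by (auto simp: link_def)
    moreover have "G \<in> PF" using G link_PF Suc.prems by auto
    ultimately have "rk B < rk G" using B rank_flat_strict flat_sub by (auto simp: PF_iff)
    then show "r < rk G + j" using Suc.prems by simp
    show "F = E \<or> F \<subseteq> G" if "F \<in> insert G \<tau>" for F
      using that Suc.prems(4) \<open>B \<subset> G\<close> by blast
    show "G \<noteq> E" using \<open>G \<in> PF\<close> by (simp add: PF_iff)
    show "flag (insert G \<tau>)" using flag_insert Suc.prems G by auto
  qed (use Suc.prems in auto)
  then have "(\<Sum>G\<in>{G \<in> link \<tau>. e \<in> G}. star_sum e' ^ j * flag_poly (insert G \<tau>)) \<in> chow_ideal M"
    by (rule chow_ideal_sum)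
  from chow_ideal_add[OF star_sum_flag_poly_power[OF Suc.prems(1,2,4) e Suc.prems(6), of j] this]
  show ?case by simp
qed

text \<open>Rebuild the flag from the bottom, choosing \<open>e\<close> in the next member
  \<open>F\<close> but not in \<open>B\<close>. Among the flats above \<open>B\<close> that contain
  \<open>e\<close>, only \<open>F\<close> has rank \<open>Suc b\<close>; any other skips a rank and
  is killed by the remaining power.\<close>

lemma full_flag_star_sum:
  assumes fl: "flag \<sigma>" and card: "card \<sigma> = r + 2" and e': "e' \<in> E"
  shows "star_sum e' ^ r - flag_poly \<sigma> \<in> chow_ideal M"
proof -
  have \<sigma>: "{} \<in> \<sigma>" "E \<in> \<sigma>" "\<And>F. F \<in> \<sigma> \<Longrightarrow> is_flat M F" using fl by (auto simp: flag_def)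
  have "card (rk ` \<sigma>) = card {..Suc r}" using card flag_rk_inj[OF fl] by (simp add: card_image)
  then have img: "rk ` \<sigma> = {..Suc r}" using flag_rk_image[OF fl] by (intro card_subset_eq) auto
  define \<tau> where "\<tau> = (\<lambda>b. {F \<in> \<sigma>. rk F \<le> b} \<union> {E})"
  have fl\<tau>: "flag (\<tau> b)" for b using fl \<sigma> rank_empty by (auto simp: flag_def \<tau>_def)
  have rkE: "F = E" if "F \<in> \<sigma>" "r < rk F" for F
    using that rank_flat_strict[OF \<sigma>(3)[OF that(1)], of E] \<sigma>(3)[OF that(1)] flat_sub rank_ground by fastforce
  have "star_sum e' ^ j * flag_poly (\<tau> b) - flag_poly \<sigma> \<in> chow_ideal M" if "b + j = r" for b j
    using that
  proof (induction j arbitrary: b)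
    case 0
    then have "\<tau> b = \<sigma>" using \<sigma> rkE by (force simp: \<tau>_def)
    then show ?case by simp
  next
    case (Suc j)
    obtain B where B: "B \<in> \<sigma>" "rk B = b" using img Suc.prems by (metis atMost_iff image_iff le_add1 le_SucI)
    obtain F where F: "F \<in> \<sigma>" "rk F = Suc b" using img Suc.prems
      by (metis atMost_iff image_iff add_Suc_right le_add1 Suc_le_mono)
    have BF: "B \<subseteq> F" using flag_rk_mono[OF fl B(1) F(1)] B F by simp
    have FE: "F \<noteq> E" using F rank_ground Suc.prems by auto
    obtain e where e: "e \<in> F - B" using BF B F by (metis Diff_eq_empty_iff ex_in_conv n_not_Suc_n subset_antisym)
    have eE: "e \<in> E - B" using e flat_sub[OF \<sigma>(3)[OF F(1)]] by auto
    have B\<tau>: "B \<in> \<tau> b" using B by (simp add: \<tau>_def)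
    have max: "G = E \<or> G \<subseteq> B" if "G \<in> \<tau> b" for G
      using that flag_rk_mono[OF fl _ B(1), of G] B by (auto simp: \<tau>_def)
    have Flink: "F \<in> link (\<tau> b)"
    proof -
      have "G \<subseteq> F \<or> F \<subseteq> G" if "G \<in> \<tau> b" for G using that fl F(1) flat_sub[OF \<sigma>(3)[OF F(1)]] unfolding \<tau>_def flag_def by blast
      moreover have "F \<notin> \<tau> b" using F FE by (auto simp: \<tau>_def)
      ultimately show ?thesis using \<sigma>(3)[OF F(1)] by (auto simp: link_def)
    qed
    have ins: "insert F (\<tau> b) = \<tau> (Suc b)"
    proof -
      have "G = F" if "G \<in> \<sigma>" "rk G = Suc b" for G
        using that F flag_rk_inj[OF fl] by (auto simp: inj_on_def)
      then have "{G \<in> \<sigma>. rk G \<le> Suc b} = insert F {G \<in> \<sigma>. rk G \<le> b}"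
        unfolding le_Suc_eq using F by blast
      then show ?thesis by (simp add: \<tau>_def insert_commute)
    qed
    let ?t = "\<lambda>G. star_sum e' ^ j * flag_poly (insert G (\<tau> b))"
    have others: "?t G \<in> chow_ideal M" if G: "G \<in> {G \<in> link (\<tau> b). e \<in> G} - {F}" for G
    proof (rule star_sum_power_vanish)
      have BG: "B \<subset> G" using G eE B\<tau> by (auto simp: link_def)
      have GPF: "G \<in> PF" using G link_PF[OF fl\<tau>] by auto
      then have "rk B < rk G" using rank_flat_strict[OF \<sigma>(3)[OF B(1)] BG] flat_sub by (auto simp: PF_iff)
      moreover have "rk G \<noteq> Suc b"
      proof
        assume "rk G = Suc b"
        then have "G = F"
          using link_cover_unique[of B G F e] \<sigma>(3)[OF B(1)] \<sigma>(3)[OF F(1)] GPF BG BF e B F G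
          by (auto simp: PF_iff)
        then show False using G by auto
      qed
      ultimately show "r < rk G + j" using B Suc.prems by simp
      show "G \<noteq> E" using GPF by (simp add: PF_iff)
      show "H = E \<or> H \<subseteq> G" if "H \<in> insert G (\<tau> b)" for H using that max[of H] BG by auto
      show "flag (insert G (\<tau> b))" using G flag_insert[OF fl\<tau>] by auto
    qed (use e' in auto)
    have "(\<Sum>G\<in>{G \<in> link (\<tau> b). e \<in> G}. ?t G) = ?t F + (\<Sum>G\<in>{G \<in> link (\<tau> b). e \<in> G} - {F}. ?t G)"
      using Flink e by (intro sum.remove) auto
    moreover have "(\<Sum>G\<in>{G \<in> link (\<tau> b). e \<in> G} - {F}. ?t G) \<in> chow_ideal M"
      using others by (rule chow_ideal_sum)
    moreover have "?t F - flag_poly \<sigma> \<in> chow_ideal M" unfolding ins using Suc by simp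
    moreover note star_sum_flag_poly_power[OF fl\<tau>[of b] B\<tau> max eE e', of j]
    ultimately have "(star_sum e' ^ Suc j * flag_poly (\<tau> b) - (?t F + (\<Sum>G\<in>{G \<in> link (\<tau> b). e \<in> G} - {F}. ?t G)))
       + ((?t F - flag_poly \<sigma>) + (\<Sum>G\<in>{G \<in> link (\<tau> b). e \<in> G} - {F}. ?t G)) \<in> chow_ideal M"
      by (intro chow_ideal_add) auto
    then show ?case by (simp add: algebra_simps)
  qed
  from this[of 0 r] have "star_sum e' ^ r * flag_poly (\<tau> 0) - flag_poly \<sigma> \<in> chow_ideal M" by simp
  moreover have "\<tau> 0 = {{}, E}"
  proof -
    have "F = {}" if "F \<in> \<sigma>" "rk F = 0" for F
      using that \<sigma> flag_rk_inj[OF fl] rank_empty by (auto simp: inj_on_def)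
    then show ?thesis using \<sigma> rank_empty by (auto simp: \<tau>_def)
  qed
  ultimately show ?thesis by (simp add: flag_poly_def)
qed

section \<open>Linear forms and the reduction of words to one generator\<close>

definition linear_form :: "('a set \<Rightarrow> int) \<Rightarrow> 'a set int_mpoly" where
  "linear_form \<phi> = (\<Sum>F\<in>PF. of_int (\<phi> F) * mvar F)"

lemma polys_linear_form: "linear_form \<phi> \<in> polys"
  unfolding linear_form_def by (intro polys_intros) auto

lemma homogeneous_linear_form: "homogeneous 1 (linear_form \<phi>)"
  unfolding linear_form_def
  by (intro homogeneous_sum homogeneous_of_int_mult) (use homogeneous_word[of "[_]"] in simp)

text \<open>Exchanging the sums over flats and elements gives the combination of the
  \<open>star_sum e\<close> with coefficients \<open>a e\<close>; total zero allows one fixed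
  \<open>star_sum e0\<close> to be subtracted from each of them.\<close>

lemma linear_form_additive:
  assumes "sum a E = 0"
  shows "linear_form (sum a) \<in> chow_ideal M"
proof -
  have "E \<noteq> {}" using rank_ground rank_empty by auto
  then obtain e0 where e0: "e0 \<in> E" by auto
  have "linear_form (sum a) = (\<Sum>F\<in>PF. \<Sum>e\<in>{e \<in> E. e \<in> F}. of_int (a e) * mvar F)"
    unfolding linear_form_def
  proof (intro sum.cong refl)
    fix F assume "F \<in> PF"
    then have "{e \<in> E. e \<in> F} = F" using flat_sub by (auto simp: PF_iff)
    then show "of_int (sum a F) * mvar F = (\<Sum>e\<in>{e \<in> E. e \<in> F}. of_int (a e) * mvar F)"
      by (simp add: sum_distrib_right)
  qed
  also have "\<dots> = (\<Sum>e\<in>E. \<Sum>F\<in>{F \<in> PF. e \<in> F}. of_int (a e) * mvar F)"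
    by (rule sum.swap_restrict) (use finite_PF finite_E in auto)
  also have "\<dots> = (\<Sum>e\<in>E. of_int (a e) * star_sum e)"
    by (simp add: star_sum_def sum_distrib_left)
  also have "\<dots> = (\<Sum>e\<in>E. of_int (a e) * (star_sum e - star_sum e0)) + of_int (sum a E) * star_sum e0"
    by (simp add: right_diff_distrib sum_subtractf sum_distrib_right)
  also have "\<dots> = (\<Sum>e\<in>E. of_int (a e) * (star_sum e - star_sum e0))"
    using assms by simp
  also have "\<dots> \<in> chow_ideal M"
    using e0 by (intro chow_ideal_sum chow_ideal_mult chow_ideal_linear polys_of_int)
  finally show ?thesis .
qed

text \<open>The preimage of the cyclic subgroup generated by the class of \<open>c\<close>.\<close>

definition cyclic_multiples :: "'a set int_mpoly \<Rightarrow> 'a set int_mpoly set" where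
  "cyclic_multiples c = {p. \<exists>z. p - of_int z * c \<in> chow_ideal M}"

lemma cyclic_multiples_diff:
  assumes "p \<in> cyclic_multiples c" "q \<in> cyclic_multiples c"
  shows "p - q \<in> cyclic_multiples c"
proof -
  obtain z w where "p - of_int z * c \<in> chow_ideal M" "q - of_int w * c \<in> chow_ideal M"
    using assms by (auto simp: cyclic_multiples_def)
  from chow_ideal_diff[OF this] have "p - q - of_int (z - w) * c \<in> chow_ideal M"
    by (simp add: algebra_simps)
  then show ?thesis unfolding cyclic_multiples_def by blast
qed

lemma cyclic_multiples_ideal: "p \<in> chow_ideal M \<Longrightarrow> p \<in> cyclic_multiples c"
  unfolding cyclic_multiples_def by (auto intro!: exI[of _ 0])

lemma cyclic_multiples_add:
  assumes "p \<in> cyclic_multiples c" "q \<in> cyclic_multiples c"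
  shows "p + q \<in> cyclic_multiples c"
  using cyclic_multiples_diff[OF assms(1) cyclic_multiples_diff[OF cyclic_multiples_ideal[of 0] assms(2)]] by simp

lemma cyclic_multiples_sum: "(\<And>x. x \<in> A \<Longrightarrow> f x \<in> cyclic_multiples c) \<Longrightarrow> sum f A \<in> cyclic_multiples c"
  by (induction A rule: infinite_finite_induct) (auto intro: cyclic_multiples_add cyclic_multiples_ideal)

lemma cyclic_multiples_of_int: 
  assumes "p \<in> cyclic_multiples c"
  shows "of_int k * p \<in> cyclic_multiples c"
proof -
  obtain z where "p - of_int z * c \<in> chow_ideal M" using assms by (auto simp: cyclic_multiples_def)
  from chow_ideal_mult[OF this polys_of_int[of k]] have "of_int k * p - of_int (k * z) * c \<in> chow_ideal M"
    by (simp add: algebra_simps)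
  then show ?thesis unfolding cyclic_multiples_def by blast
qed

text \<open>A letter outside the flag either extends it or is incomparable with a member, which
  kills the product. A letter in the flag is traded, by a linear relation, for letters outside it.
  So each letter lengthens the flag until it is complete.\<close>

lemma flag_word_cyclic:
  assumes "flag \<sigma>" "card \<sigma> + length q = r + 2" "set q \<subseteq> PF" "e \<in> E"
  shows "flag_poly \<sigma> * word_poly q \<in> cyclic_multiples (star_sum e ^ r)"
  using assms
proof (induction q arbitrary: \<sigma>)
  case Nil
  then have "star_sum e ^ r - flag_poly \<sigma> \<in> chow_ideal M" using full_flag_star_sum by simp
  then have "flag_poly \<sigma> - of_int 1 * star_sum e ^ r \<in> chow_ideal M" using chow_ideal_uminus by fastforce
  then show ?case unfolding cyclic_multiples_def word_poly_Nil mult_1_right by blast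
next
  case (Cons F q)
  have wq: "word_poly q \<in> polys" using Cons.prems by (intro polys_word) auto
  have outside: "flag_poly \<sigma> * (mvar G * word_poly q) \<in> cyclic_multiples (star_sum e ^ r)"
    if G: "G \<in> PF" "G \<notin> \<sigma>" for G
  proof (cases "G \<in> link \<sigma>")
    case True
    then have "flag_poly (insert G \<sigma>) * word_poly q \<in> cyclic_multiples (star_sum e ^ r)"
      using Cons.prems flag_insert flag_insert_card by (intro Cons.IH) auto
    then show ?thesis using flag_poly_insert[OF Cons.prems(1) True] by (simp add: mult_ac)
  next
    case False
    then obtain H where "H \<in> \<sigma>" "\<not> G \<subseteq> H" "\<not> H \<subseteq> G" using G by (auto simp: link_def PF_iff)
    then have "word_poly q * (mvar G * flag_poly \<sigma>) \<in> chow_ideal M"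
      using flag_poly_incomparable[OF Cons.prems(1) G(1)] chow_ideal_mult wq by blast
    then show ?thesis by (intro cyclic_multiples_ideal) (simp add: mult_ac)
  qed
  show ?case
  proof (cases "F \<in> \<sigma>")
    case False
    then show ?thesis using outside Cons.prems by simp
  next
    case True
    have F: "F \<in> PF" using Cons.prems by simp
    \<comment> \<open>An integral additive function that is the indicator of \<open>F\<close> on the
      flag. It vanishes on \<open>E\<close>, so it yields a relation expressing
      \<open>mvar F\<close> through variables outside the flag.\<close>
    obtain a :: "'a \<Rightarrow> int" where a: "\<And>G. G \<in> \<sigma> \<Longrightarrow> sum a G = (if G = F then 1 else 0) - (if {} = F then 1 else 0)"
      using chain_interpolation[OF Cons.prems(1), of "\<lambda>G. if G = F then 1 else 0 :: int"] by blast
    have a': "sum a G = (if G = F then 1 else 0)" if "G \<in> \<sigma>" for G using a[OF that] F by (auto simp: PF_iff)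
    have "sum a E = 0" using a'[of E] F Cons.prems(1) by (auto simp: PF_iff flag_def)
    then have "linear_form (sum a) \<in> chow_ideal M" by (rule linear_form_additive)
    then have lin: "(flag_poly \<sigma> * word_poly q) * linear_form (sum a) \<in> chow_ideal M"
      using chow_ideal_mult polys_mult[OF polys_flag_poly[OF Cons.prems(1)] wq] by blast
    have "linear_form (sum a) = (\<Sum>G\<in>PF \<inter> \<sigma>. of_int (sum a G) * mvar G) + (\<Sum>G\<in>PF - \<sigma>. of_int (sum a G) * mvar G)"
      unfolding linear_form_def by (rule sum.Int_Diff[OF finite_PF])
    also have "(\<Sum>G\<in>PF \<inter> \<sigma>. of_int (sum a G) * mvar G) = (\<Sum>G\<in>PF \<inter> \<sigma>. if G = F then mvar F else 0)"
      using a' by (intro sum.cong) auto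
    also have "\<dots> = mvar F" using True F finite_PF by (simp add: sum.delta)
    finally have eq: "flag_poly \<sigma> * word_poly (F # q) = (flag_poly \<sigma> * word_poly q) * linear_form (sum a)
       - (\<Sum>G\<in>PF - \<sigma>. of_int (sum a G) * (flag_poly \<sigma> * (mvar G * word_poly q)))"
      by (simp add: algebra_simps sum_distrib_left)
    show ?thesis unfolding eq
      by (intro cyclic_multiples_diff cyclic_multiples_ideal[OF lin] cyclic_multiples_sum cyclic_multiples_of_int)
        (use outside in auto)
  qed
qed

lemma trivial_flag: "flag {{}, E}" "card {{}, E} = 2"
proof -
  have "E \<noteq> {}" using rank_ground rank_empty by auto
  then show "card {{}, E} = 2" by simp
  show "flag {{}, E}" using empty_flat ground_flat by (auto simp: flag_def)
qed

text \<open>Integer polynomials form the free abelian group on exponent vectors, so words and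
  differences reach all of them.\<close>

lemma polys_induct [consumes 1, case_names zero word diff]:
  assumes "p \<in> polys" "P 0" "\<And>xs. set xs \<subseteq> PF \<Longrightarrow> P (word_poly xs)" "\<And>a b. P a \<Longrightarrow> P b \<Longrightarrow> P (a - b)"
  shows "P p"
proof -
  have "Poly_Mapping.keys p \<subseteq> {m. Poly_Mapping.keys m \<subseteq> PF}" using assms(1) by (auto simp: polys_iff)
  then show ?thesis
  proof (induction p rule: frag_induction)
    case (one m)
    obtain xs where "m = exponent xs" using exponent_surj by metis
    then show ?case using assms(3)[of xs] one by (simp add: word_poly_single keys_exponent)
  qed (use assms in auto)
qed

lemma homogeneous_polys_induct [consumes 2, case_names zero word diff]:
  assumes "p \<in> polys" "homogeneous d p" "P 0" "\<And>xs. set xs \<subseteq> PF \<Longrightarrow> length xs = d \<Longrightarrow> P (word_poly xs)"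
    "\<And>a b. P a \<Longrightarrow> P b \<Longrightarrow> P (a - b)"
  shows "P p"
proof -
  have "Poly_Mapping.keys p \<subseteq> {m. Poly_Mapping.keys m \<subseteq> PF \<and> (\<Sum>v\<in>Poly_Mapping.keys m. Poly_Mapping.lookup m v) = d}"
    using assms(1,2) by (auto simp: polys_iff homogeneous_def)
  then show ?thesis
  proof (induction p rule: frag_induction)
    case (one m)
    obtain xs where "m = exponent xs" using exponent_surj by metis
    then show ?case using assms(4)[of xs] one exponent_degree[of xs] by (simp add: word_poly_single keys_exponent)
  qed (use assms in auto)
qed

lemma top_degree_cyclic:
  assumes "p \<in> polys" "homogeneous r p" "e \<in> E"
  shows "p \<in> cyclic_multiples (star_sum e ^ r)"
  using assms(1,2)
proof (induction p rule: homogeneous_polys_induct)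
  case (word xs)
  then show ?case using flag_word_cyclic[OF trivial_flag(1) _ word(1) assms(3)] trivial_flag(2)
    by (simp add: flag_poly_def)
qed (auto intro: cyclic_multiples_ideal cyclic_multiples_diff)

end

section \<open>The degree functional\<close>

context loopless_matroid
begin

definition flat_ind :: "'a set \<Rightarrow> 'a set \<Rightarrow> rat" where
  "flat_ind F G = (if G = F then 1 else 0)"

text \<open>The recursion of \<open>inter_num\<close> from the trivial flag ends in a complete flag
  only for \<open>r\<close> letters, hence the default value 0.\<close>

definition word_num :: "'a set list \<Rightarrow> rat" where
  "word_num xs = (if length xs = r then inter_num {{}, E} (map flat_ind xs) else 0)"

text \<open>The chosen listing of a monomial is immaterial by symmetry of \<open>inter_num\<close>.
  Values are rational at first; integrality in degree \<open>r\<close> follows once the top degree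
  is known to be cyclic.\<close>

definition degree_eval :: "'a set int_mpoly \<Rightarrow> rat" where
  "degree_eval p = (\<Sum>m\<in>Poly_Mapping.keys p.
     of_int (Poly_Mapping.lookup p m) * word_num (SOME xs. exponent xs = m))"

lemma word_num_mset: "mset xs = mset ys \<Longrightarrow> word_num xs = word_num ys"
  unfolding word_num_def
  using inter_num_mset[OF trivial_flag(1), of "map flat_ind xs" "map flat_ind ys"] trivial_flag(2)
  by (auto dest: mset_eq_length)

lemma degree_eval_superset:
  assumes "finite K" "Poly_Mapping.keys p \<subseteq> K"
  shows "degree_eval p = (\<Sum>m\<in>K. of_int (Poly_Mapping.lookup p m) * word_num (SOME xs. exponent xs = m))"
  unfolding degree_eval_def
  by (rule sum.mono_neutral_left) (use assms in \<open>auto simp: in_keys_iff\<close>)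

lemma degree_eval_diff: "degree_eval (p - q) = degree_eval p - degree_eval q"
proof -
  let ?K = "Poly_Mapping.keys p \<union> Poly_Mapping.keys q"
  show ?thesis
    using degree_eval_superset[of ?K p] degree_eval_superset[of ?K q] degree_eval_superset[of ?K "p - q"]
      keys_diff[of p q] by (simp add: lookup_minus left_diff_distrib sum_subtractf)
qed

lemma degree_eval_0: "degree_eval 0 = 0"
  by (simp add: degree_eval_def)

lemma degree_eval_add: "degree_eval (p + q) = degree_eval p + degree_eval q"
  using degree_eval_diff[of p "0 - q"] degree_eval_diff[of 0 q] by (simp add: degree_eval_0)

lemma degree_eval_sum: "degree_eval (sum f A) = (\<Sum>x\<in>A. degree_eval (f x))"
  by (induction A rule: infinite_finite_induct) (auto simp: degree_eval_0 degree_eval_add)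

lemma degree_eval_of_int: "degree_eval (of_int c * p) = of_int c * degree_eval p"
  by (induction c rule: int_induct[of _ 0])
    (simp_all add: degree_eval_0 degree_eval_add degree_eval_diff algebra_simps)

lemma degree_eval_word: "degree_eval (word_poly xs) = word_num xs"
proof -
  have "exponent (SOME ys. exponent ys = exponent xs) = exponent xs" by (rule someI) simp
  then have "word_num (SOME ys. exponent ys = exponent xs) = word_num xs"
    by (intro word_num_mset) (simp add: exponent_eq_iff)
  then show ?thesis by (simp add: degree_eval_def word_poly_single)
qed

lemma inter_num_flat_ind:
  assumes "flag \<sigma>" "card \<sigma> + length q = r + 1" "F \<notin> \<sigma>"
  shows "inter_num \<sigma> (flat_ind F # q) = (if F \<in> link \<sigma> then inter_num (insert F \<sigma>) q else 0)"
proof -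
  have "inter_num \<sigma> (flat_ind F # q) = (\<Sum>G\<in>link \<sigma>. flat_ind F G * inter_num (insert G \<sigma>) q)"
    using assms by (intro inter_num_Cons_zero) (auto simp: flat_ind_def)
  also have "\<dots> = (\<Sum>G\<in>link \<sigma>. if G = F then inter_num (insert F \<sigma>) q else 0)"
    by (intro sum.cong) (auto simp: flat_ind_def)
  finally show ?thesis by (simp add: sum.delta)
qed

text \<open>The function on flats whose divisor is \<open>linear_form \<phi>\<close>: it is 0 at
  \<open>{}\<close> and \<open>E\<close>, which have no variable.\<close>

definition flat_fun :: "('a set \<Rightarrow> int) \<Rightarrow> 'a set \<Rightarrow> rat" where
  "flat_fun \<phi> G = (if G \<in> PF then of_int (\<phi> G) else 0)"

lemma inter_num_flat_fun:
  assumes "Suc (length q) = r"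
  shows "inter_num {{}, E} (flat_fun \<phi> # q) = (\<Sum>F\<in>PF. of_int (\<phi> F) * inter_num {{}, E} (flat_ind F # q))"
proof -
  have "flat_fun \<phi> = (\<lambda>G. \<Sum>F\<in>PF. of_int (\<phi> F) * flat_ind F G)"
  proof
    fix G
    have "(\<Sum>F\<in>PF. of_int (\<phi> F) * flat_ind F G) = (\<Sum>F\<in>PF. if G = F then of_int (\<phi> F) else 0)"
      by (intro sum.cong) (auto simp: flat_ind_def)
    then show "flat_fun \<phi> G = (\<Sum>F\<in>PF. of_int (\<phi> F) * flat_ind F G)"
      using finite_PF by (simp add: flat_fun_def sum.delta')
  qed
  then show ?thesis
    using inter_num_sum[OF trivial_flag(1) _ finite_PF, of q "\<lambda>F. of_int (\<phi> F)" flat_ind] trivial_flag(2) assms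
    by simp
qed

text \<open>Linear forms are expanded into letters one by one; \<open>xs\<close> accumulates the
  letters already chosen, and symmetry restores the order of the functions.\<close>

lemma degree_eval_linear_forms:
  assumes "length xs + length \<phi>s = r"
  shows "degree_eval (word_poly xs * prod_list (map linear_form \<phi>s)) =
    inter_num {{}, E} (map flat_ind xs @ map flat_fun \<phi>s)"
  using assms
proof (induction \<phi>s arbitrary: xs)
  case Nil
  then show ?case by (simp add: degree_eval_word word_num_def)
next
  case (Cons \<phi> \<phi>s)
  let ?P = "prod_list (map linear_form \<phi>s)"
  let ?q = "map flat_ind xs @ map flat_fun \<phi>s"
  have "word_poly xs * (linear_form \<phi> * ?P) = (\<Sum>F\<in>PF. of_int (\<phi> F) * (word_poly (F # xs) * ?P))"
    by (simp add: linear_form_def sum_distrib_left sum_distrib_right mult_ac)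
  then have "degree_eval (word_poly xs * (linear_form \<phi> * ?P)) =
      (\<Sum>F\<in>PF. of_int (\<phi> F) * degree_eval (word_poly (F # xs) * ?P))"
    by (simp only: degree_eval_sum degree_eval_of_int)
  also have "\<dots> = (\<Sum>F\<in>PF. of_int (\<phi> F) * inter_num {{}, E} (flat_ind F # ?q))"
  proof (intro sum.cong refl)
    fix F
    have "degree_eval (word_poly (F # xs) * ?P) = inter_num {{}, E} (map flat_ind (F # xs) @ map flat_fun \<phi>s)"
      using Cons.prems by (intro Cons.IH) simp
    then show "of_int (\<phi> F) * degree_eval (word_poly (F # xs) * ?P) =
        of_int (\<phi> F) * inter_num {{}, E} (flat_ind F # ?q)" by simp
  qed
  also have "\<dots> = inter_num {{}, E} (flat_fun \<phi> # ?q)"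
    using Cons.prems by (intro inter_num_flat_fun[symmetric]) simp
  also have "\<dots> = inter_num {{}, E} (map flat_ind xs @ map flat_fun (\<phi> # \<phi>s))"
    by (rule inter_num_mset[OF trivial_flag(1)]) (use trivial_flag(2) Cons.prems in auto)
  finally show ?case by simp
qed

lemma degree_eval_word_linear_form:
  "degree_eval (word_poly xs * linear_form \<phi>) = (\<Sum>F\<in>PF. of_int (\<phi> F) * word_num (F # xs))"
proof -
  have "word_poly xs * linear_form \<phi> = (\<Sum>F\<in>PF. of_int (\<phi> F) * word_poly (F # xs))"
    by (simp add: linear_form_def sum_distrib_left mult_ac)
  then show ?thesis by (simp only: degree_eval_sum degree_eval_of_int degree_eval_word)
qed

lemma PF_link: "F \<in> PF \<Longrightarrow> F \<in> link {{}, E}"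
  using flat_sub by (auto simp: PF_iff link_def)

lemma degree_eval_incomparable:
  assumes "F \<in> PF" "G \<in> PF" "\<not> F \<subseteq> G" "\<not> G \<subseteq> F" "q \<in> polys"
  shows "degree_eval (mvar F * mvar G * q) = 0"
  using assms(5)
proof (induction q rule: polys_induct)
  case (word xs)
  have "word_num (F # G # xs) = 0"
  proof (cases "Suc (Suc (length xs)) = r")
    case True
    have F: "F \<in> link {{}, E}" "F \<notin> {{}, E}" using PF_link assms by (auto simp: PF_iff)
    have G: "G \<notin> insert F {{}, E}" "G \<notin> link (insert F {{}, E})"
      using assms by (auto simp: PF_iff link_def)
    have "inter_num {{}, E} (flat_ind F # flat_ind G # map flat_ind xs) =
        inter_num (insert F {{}, E}) (flat_ind G # map flat_ind xs)"
      using inter_num_flat_ind[OF trivial_flag(1) _ F(2), of "flat_ind G # map flat_ind xs"]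
        trivial_flag(2) True F(1) by simp
    also have "\<dots> = 0"
      using inter_num_flat_ind[OF flag_insert[OF trivial_flag(1) F(1)] _ G(1), of "map flat_ind xs"]
        flag_insert_card[OF trivial_flag(1) F(1)] trivial_flag(2) True G(2) by simp
    finally show ?thesis using True by (simp add: word_num_def)
  qed (simp add: word_num_def)
  then show ?case using degree_eval_word[of "F # G # xs"] by (simp add: mult_ac)
qed (simp_all add: degree_eval_0 degree_eval_diff right_diff_distrib)

text \<open>The coefficients of the relation are the values of an additive function, 1 at
  \<open>i\<close> and -1 at \<open>j\<close>, which vanishes on \<open>E\<close>. Such a function
  is indistinguishable from 0 for intersection numbers.\<close>

lemma degree_eval_linear:
  assumes "i \<in> E" "j \<in> E" "q \<in> polys"
  shows "degree_eval ((star_sum i - star_sum j) * q) = 0"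
  using assms(3)
proof (induction q rule: polys_induct)
  case (word xs)
  define \<phi> :: "'a set \<Rightarrow> int" where "\<phi> = (\<lambda>F. (if i \<in> F then 1 else 0) - (if j \<in> F then 1 else 0))"
  have star: "star_sum e = (\<Sum>F\<in>PF. if e \<in> F then mvar F else 0)" for e
    unfolding star_sum_def using finite_PF by (simp add: sum.inter_filter)
  have "star_sum i - star_sum j = linear_form \<phi>"
    unfolding star linear_form_def sum_subtractf[symmetric] by (intro sum.cong) (auto simp: \<phi>_def)
  then have "degree_eval ((star_sum i - star_sum j) * word_poly xs) = (\<Sum>F\<in>PF. of_int (\<phi> F) * word_num (F # xs))"
    using degree_eval_word_linear_form[of xs \<phi>] by (simp add: mult.commute)
  also have "\<dots> = 0"
  proof (cases "Suc (length xs) = r")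
    case True
    define a :: "'a \<Rightarrow> rat" where "a = (\<lambda>e. (if e = i then 1 else 0) - (if e = j then 1 else 0))"
    have "(\<Sum>F\<in>PF. of_int (\<phi> F) * word_num (F # xs)) = inter_num {{}, E} (flat_fun \<phi> # map flat_ind xs)"
      using inter_num_flat_fun[of "map flat_ind xs" \<phi>] True by (simp add: word_num_def)
    also have "\<dots> = inter_num {{}, E} ((\<lambda>_. 0) # map flat_ind xs)"
    proof (rule inter_num_add_affine[where a = a and c = 0, OF trivial_flag(1)])
      fix F assume F: "F \<in> flats"
      then have fin: "finite F" using finite_flat by blast
      have "sum a F = of_int (\<phi> F)" using fin by (simp add: a_def \<phi>_def sum_subtractf sum.delta)
      moreover have "flat_fun \<phi> F = of_int (\<phi> F)"
        using F assms by (auto simp: flat_fun_def PF_iff \<phi>_def)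
      ultimately show "flat_fun \<phi> F = 0 + sum a F + 0" by simp
    qed (use trivial_flag(2) True in simp)
    also have "\<dots> = 0" using inter_num_zero[OF trivial_flag(1)] trivial_flag(2) True by simp
    finally show ?thesis .
  qed (simp add: word_num_def)
  finally show ?case .
qed (simp_all add: degree_eval_0 degree_eval_diff right_diff_distrib)

lemma degree_eval_chow_ideal:
  assumes "p \<in> chow_ideal M"
  shows "degree_eval p = 0"
proof -
  \<comment> \<open>The kernel of a functional need not be an ideal; \<open>K\<close> is the largest
    ideal inside it.\<close>
  define K where "K = {p \<in> polys. \<forall>q\<in>polys. degree_eval (p * q) = 0}"
  have "ideal K (flat_poly_ring M)"
  proof (rule idealI[OF ring_polys])
    show "subgroup K (add_monoid (flat_poly_ring M))"
    proof (rule subgroup.intro)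
      fix p assume p: "p \<in> K"
      have "inv\<^bsub>add_monoid (flat_poly_ring M)\<^esub> p = - p"
        using p ring_uminus by (simp add: K_def a_inv_def)
      then show "inv\<^bsub>add_monoid (flat_poly_ring M)\<^esub> p \<in> K"
        using p degree_eval_diff[of 0] by (auto simp: K_def degree_eval_0 intro: polys_uminus)
    qed (auto simp: K_def degree_eval_0 degree_eval_add distrib_right intro: polys_add)
    show "x \<otimes>\<^bsub>flat_poly_ring M\<^esub> a \<in> K" if "a \<in> K" "x \<in> polys" for a x
    proof -
      have "degree_eval (x * a * q) = 0" if "q \<in> polys" for q
        using \<open>a \<in> K\<close> polys_mult[OF \<open>x \<in> polys\<close> that] by (auto simp: K_def mult_ac)
      then show ?thesis using that by (auto simp: K_def intro: polys_mult)
    qed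
    then show "a \<otimes>\<^bsub>flat_poly_ring M\<^esub> x \<in> K" if "a \<in> K" "x \<in> polys" for a x
      using that by (simp add: mult.commute)
  qed
  moreover have "mvar F * mvar G \<in> K" if "F \<in> PF" "G \<in> PF" "\<not> F \<subseteq> G" "\<not> G \<subseteq> F" for F G
    using that degree_eval_incomparable by (auto simp: K_def intro!: polys_intros)
  moreover have "star_sum i - star_sum j \<in> K" if "i \<in> E" "j \<in> E" for i j
    using that degree_eval_linear polys_star_sum by (auto simp: K_def intro!: polys_diff)
  ultimately have "chow_ideal M \<subseteq> K" by (rule chow_ideal_minimal)
  then have "degree_eval (p * 1) = 0" using assms polys_1 unfolding K_def by blast
  then show ?thesis by simp
qed

section \<open>Complete chains and the identification of the degree map\<close>

lemma inter_num_chain: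
  assumes "flag \<sigma>" "flag (\<sigma> \<union> set Fs)" "distinct Fs" "set Fs \<inter> \<sigma> = {}" "card \<sigma> + length Fs = r + 2"
  shows "inter_num \<sigma> (map flat_ind Fs) = 1"
  using assms
proof (induction Fs arbitrary: \<sigma>)
  case (Cons F Fs)
  have F: "F \<in> link \<sigma>" using Cons.prems by (auto simp: link_def flag_def)
  have "inter_num (insert F \<sigma>) (map flat_ind Fs) = 1"
    using Cons.prems flag_insert[OF Cons.prems(1) F] flag_insert_card[OF Cons.prems(1) F]
    by (intro Cons.IH) auto
  then show ?case using inter_num_flat_ind[OF Cons.prems(1), of "map flat_ind Fs" F] Cons.prems F by auto
qed simp

lemma maximal_chain_flag:
  assumes "maximal_chain M Fs"
  defines "\<sigma> \<equiv> insert {} (insert E (set Fs))"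
  shows "length Fs = r" "set Fs \<subseteq> PF" "distinct Fs" "flag \<sigma>" "card \<sigma> = r + 2" "flag_poly \<sigma> = word_poly Fs"
proof -
  show len: "length Fs = r" and sub: "set Fs \<subseteq> PF" using assms rank_ground by (auto simp: maximal_chain_def)
  have sorted: "sorted_wrt (\<subset>) Fs" using assms by (auto simp: maximal_chain_def)
  then show d: "distinct Fs" by (induction Fs) auto
  have "F \<subseteq> G \<or> G \<subseteq> F" if "F \<in> set Fs" "G \<in> set Fs" for F G
    using sorted that by (induction Fs) auto
  then show "flag \<sigma>"
    using sub empty_flat ground_flat flat_sub by (auto simp: flag_def \<sigma>_def PF_iff subset_iff)
  have no: "{} \<notin> set Fs" "E \<notin> set Fs" using sub by (auto simp: PF_iff)
  have "E \<noteq> {}" using rank_ground rank_empty by auto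
  then show "card \<sigma> = r + 2" using no d len by (simp add: \<sigma>_def distinct_card)
  have "\<sigma> - {{}, E} = set Fs" using no by (auto simp: \<sigma>_def)
  then show "flag_poly \<sigma> = word_poly Fs"
    using d by (simp add: flag_poly_def word_poly_def prod.distinct_set_conv_list)
qed

lemma degree_eval_maximal_chain:
  assumes "maximal_chain M Fs"
  shows "degree_eval (word_poly Fs) = 1"
proof -
  note c = maximal_chain_flag[OF assms]
  have "inter_num {{}, E} (map flat_ind Fs) = 1"
  proof (rule inter_num_chain[OF trivial_flag(1)])
    have "{{}, E} \<union> set Fs = insert {} (insert E (set Fs))" by auto
    then show "flag ({{}, E} \<union> set Fs)" using c(4) by simp
    show "set Fs \<inter> {{}, E} = {}" using c(2) by (auto simp: PF_iff)
  qed (use c trivial_flag(2) in auto)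
  then show ?thesis using c(1) by (simp add: degree_eval_word word_num_def)
qed

lemma maximal_chain_exists: "\<exists>Fs. maximal_chain M Fs"
proof -
  have "\<exists>Fs G. length Fs = k \<and> set Fs \<subseteq> PF \<and> sorted_wrt (\<subset>) Fs \<and> is_flat M G \<and> rk G = k \<and> (\<forall>F\<in>set Fs. F \<subseteq> G)"
    if "k \<le> r" for k
    using that
  proof (induction k)
    case 0
    then show ?case using empty_flat rank_empty by (intro exI[of _ "[]"] exI[of _ "{}"]) auto
  next
    case (Suc k)
    then obtain Fs G where FG: "length Fs = k" "set Fs \<subseteq> PF" "sorted_wrt (\<subset>) Fs" "is_flat M G" "rk G = k"
      "\<forall>F\<in>set Fs. F \<subseteq> G" by auto
    have "G \<noteq> E" using FG(5) Suc.prems rank_ground by auto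
    then obtain e where e: "e \<in> E - G" using flat_sub[OF FG(4)] by blast
    obtain H where H: "is_flat M H" "insert e G \<subseteq> H" "rk H = Suc k"
      using cover_exists[of G e] FG(4,5) e by auto
    have "H \<noteq> E" using H(3) Suc.prems rank_ground by auto
    then have "H \<in> PF" using H by (auto simp: PF_iff)
    moreover have "F \<subset> H" if "F \<in> set Fs" for F using FG(6) that H(2) e by blast
    ultimately show ?case using FG H
      by (intro exI[of _ "Fs @ [H]"] exI[of _ H]) (auto simp: sorted_wrt_append)
  qed
  from this[of r] show ?thesis using rank_ground by (auto simp: maximal_chain_def)
qed

text \<open>Cyclicity supplies the integer \<open>z\<close>, and the functional recovers it, as it
  kills the ideal and is 1 on the chain. In particular \<open>degree_eval\<close> is integral in
  degree \<open>r\<close>.\<close>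

lemma top_degree_generator:
  assumes "maximal_chain M Fs" "p \<in> polys" "homogeneous r p"
  obtains z where "degree_eval p = of_int z" "p - of_int z * word_poly Fs \<in> chow_ideal M"
proof -
  note c = maximal_chain_flag[OF assms(1)]
  have "E \<noteq> {}" using rank_ground rank_empty by auto
  then obtain e where e: "e \<in> E" by auto
  obtain z where z: "p - of_int z * star_sum e ^ r \<in> chow_ideal M"
    using top_degree_cyclic[OF assms(2,3) e] by (auto simp: cyclic_multiples_def)
  have "star_sum e ^ r - word_poly Fs \<in> chow_ideal M"
    using full_flag_star_sum[OF c(4,5) e] c(6) by simp
  from chow_ideal_add[OF z chow_ideal_mult[OF this polys_of_int[of z]]]
  have mem: "p - of_int z * word_poly Fs \<in> chow_ideal M" by (simp add: algebra_simps)
  have "degree_eval p = of_int z"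
    using degree_eval_chow_ideal[OF mem] degree_eval_maximal_chain[OF assms(1)]
    by (simp add: degree_eval_diff degree_eval_of_int)
  then show ?thesis using mem that by blast
qed

lemma chow_group_carrier: "carrier (chow_group M d) = chow_class M ` {p \<in> polys. homogeneous d p}"
  by (simp add: chow_group_def)

lemma chow_group_mult: "p \<in> polys \<Longrightarrow> q \<in> polys \<Longrightarrow>
    chow_class M p \<otimes>\<^bsub>chow_group M d\<^esub> chow_class M q = chow_class M (p + q)"
  using chow_class_add by (simp add: chow_group_def)

lemma integer_group_simps: "carrier integer_group = UNIV" "x \<otimes>\<^bsub>integer_group\<^esub> y = x + y"
  by (simp_all add: integer_group_def)

text \<open>Existence and uniqueness for the definite description. Every class in degree
  \<open>r\<close> is an integer multiple of the class of one maximal chain, so an additive map is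
  determined by the value 1 there.\<close>

lemma degree_map_eval:
  assumes "p \<in> polys" "homogeneous r p"
  shows "of_int (degree_map M (chow_class M p)) = degree_eval p"
proof -
  let ?G = "chow_group M r"
  \<comment> \<open>The floor only changes the type, since the values are integers.\<close>
  define d0 where "d0 = restrict (\<lambda>X. \<lfloor>degree_eval (SOME p. p \<in> polys \<and> homogeneous r p \<and> chow_class M p = X)\<rfloor>) (carrier ?G)"
  obtain Fs where Fs: "maximal_chain M Fs" using maximal_chain_exists by blast
  note c = maximal_chain_flag[OF Fs]
  define w where "w = (\<lambda>z. of_int z * word_poly Fs)"
  have w: "w z \<in> polys" "homogeneous r (w z)" "degree_eval (w z) = of_int z" for z
    using c(1,2) homogeneous_word[of Fs] degree_eval_maximal_chain[OF Fs]
    by (auto simp: w_def degree_eval_of_int intro!: polys_intros homogeneous_of_int_mult)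
  have d0: "d0 (chow_class M q) = \<lfloor>degree_eval q\<rfloor>" if q: "q \<in> polys" "homogeneous r q" for q
  proof -
    define q' where "q' = (SOME p. p \<in> polys \<and> homogeneous r p \<and> chow_class M p = chow_class M q)"
    have "q' \<in> polys \<and> homogeneous r q' \<and> chow_class M q' = chow_class M q"
      unfolding q'_def by (rule someI[of _ q]) (use q in auto)
    then have "q' - q \<in> chow_ideal M" using chow_class_eq_iff q by blast
    then have "degree_eval q' = degree_eval q" using degree_eval_chow_ideal degree_eval_diff[of q' q] by auto
    moreover have "chow_class M q \<in> carrier ?G" using q by (auto simp: chow_group_carrier)
    ultimately show ?thesis by (simp add: d0_def q'_def)
  qed
  have int: "of_int (d0 (chow_class M q)) = degree_eval q" if "q \<in> polys" "homogeneous r q" for q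
    using top_degree_generator[OF Fs that] d0[OF that] by (metis floor_of_int)
  have class_w: "chow_class M q = chow_class M (w (d0 (chow_class M q)))" if q: "q \<in> polys" "homogeneous r q" for q
  proof -
    obtain z where z: "degree_eval q = of_int z" "q - w z \<in> chow_ideal M"
      using top_degree_generator[OF Fs q] unfolding w_def by blast
    then have "d0 (chow_class M q) = z" using int[OF q] by simp
    then show ?thesis using z chow_class_eq_iff q w(1) by simp
  qed
  have "degree_map M = d0"
    unfolding degree_map_def rank_ground diff_Suc_1
  proof (rule the_equality, intro conjI allI impI)
    show "d0 \<in> iso ?G integer_group"
    proof -
      have "d0 \<in> hom ?G integer_group"
      proof (rule homI)
        fix X Y assume "X \<in> carrier ?G" "Y \<in> carrier ?G"
        then obtain p q where pq: "X = chow_class M p" "Y = chow_class M q" "p \<in> polys" "homogeneous r p"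
          "q \<in> polys" "homogeneous r q" by (auto simp: chow_group_carrier)
        have "(of_int (d0 (chow_class M (p + q))) :: rat) = of_int (d0 X + d0 Y)"
          using int[of p] int[of q] int[of "p + q"] pq
          by (simp add: polys_add homogeneous_add degree_eval_add)
        then show "d0 (X \<otimes>\<^bsub>?G\<^esub> Y) = d0 X \<otimes>\<^bsub>integer_group\<^esub> d0 Y"
          using pq chow_group_mult by (simp add: integer_group_simps)
      qed (simp add: integer_group_simps)
      moreover have "bij_betw d0 (carrier ?G) (carrier integer_group)"
        unfolding bij_betw_def
      proof
        show "inj_on d0 (carrier ?G)"
        proof (rule inj_onI)
          fix X Y assume XY: "X \<in> carrier ?G" "Y \<in> carrier ?G" "d0 X = d0 Y"
          have "Z = chow_class M (w (d0 Z))" if "Z \<in> carrier ?G" for Z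
            using that class_w by (auto simp: chow_group_carrier)
          then show "X = Y" using XY by metis
        qed
        have "z \<in> d0 ` carrier ?G" for z
        proof -
          have "d0 (chow_class M (w z)) = z" using int[of "w z"] w by simp
          moreover have "chow_class M (w z) \<in> carrier ?G" using w by (auto simp: chow_group_carrier)
          ultimately show ?thesis by (metis imageI)
        qed
        then show "d0 ` carrier ?G = carrier integer_group" by (auto simp: integer_group_simps)
      qed
      ultimately show ?thesis by (simp add: iso_def)
    qed
    show "d0 \<in> extensional (carrier ?G)" by (simp add: d0_def)
    show "d0 (chow_class M (\<Prod>F\<leftarrow>Gs. mvar F)) = 1" if "maximal_chain M Gs" for Gs
      using d0[of "word_poly Gs"] degree_eval_maximal_chain[OF that] maximal_chain_flag(1,2)[OF that]
        homogeneous_word[of Gs] polys_word[of Gs] by (simp add: word_poly_def)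
  next
    fix d assume d: "d \<in> iso ?G integer_group \<and> d \<in> extensional (carrier ?G) \<and>
      (\<forall>Fs. maximal_chain M Fs \<longrightarrow> d (chow_class M (\<Prod>F\<leftarrow>Fs. mvar F)) = 1)"
    have dadd: "d (chow_class M (w (y + z))) = d (chow_class M (w y)) + d (chow_class M (w z))" for y z
    proof -
      have "d (chow_class M (w y) \<otimes>\<^bsub>?G\<^esub> chow_class M (w z)) = d (chow_class M (w y)) + d (chow_class M (w z))"
        using d w by (auto simp: iso_def hom_def chow_group_carrier integer_group_simps)
      then show ?thesis using chow_group_mult w(1) by (simp add: w_def distrib_right)
    qed
    have d1: "d (chow_class M (w 1)) = 1" using d Fs by (simp add: w_def word_poly_def)
    have dw: "d (chow_class M (w z)) = z" for z
    proof (induction z rule: int_induct[of _ 0])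
      case base
      then show ?case using dadd[of 0 0] by simp
    next
      case (step1 i)
      then show ?case using dadd[of i 1] d1 by simp
    next
      case (step2 i)
      then show ?case using dadd[of "i - 1" 1] d1 by simp
    qed
    show "d = d0"
    proof (rule extensionalityI)
      show "d \<in> extensional (carrier ?G)" using d by simp
      show "d0 \<in> extensional (carrier ?G)" by (simp add: d0_def)
      fix X assume "X \<in> carrier ?G"
      then obtain q where q: "X = chow_class M q" "q \<in> polys" "homogeneous r q"
        by (auto simp: chow_group_carrier)
      then show "d X = d0 X" using class_w[OF q(2,3)] dw by metis
    qed
  qed
  then show ?thesis using int assms by simp
qed

section \<open>The Tutte polynomial at x = 1 and the final comparison\<close>

lemma tutte_at_one: "poly (tutte M) 1 = spanning_poly {} E"
proof -
  have "poly (tutte M) 1 = (\<Sum>A\<in>Pow E. 0 ^ (rk E - rk A) * [:-1, 1:] ^ (card A - rk A))"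
    by (simp add: tutte_def poly_sum)
  also have "\<dots> = (\<Sum>A\<in>spanning {} E. [:-1, 1:] ^ (card A - (rk E - rk {})))"
  proof (rule sum.mono_neutral_cong_right)
    show "finite (Pow E)" using finite_E by simp
    show "spanning {} E \<subseteq> Pow E" by (auto simp: spanning_def)
    show "\<forall>A\<in>Pow E - spanning {} E. 0 ^ (rk E - rk A) * [:-1, 1::int:] ^ (card A - rk A) = 0"
    proof
      fix A assume A: "A \<in> Pow E - spanning {} E"
      then have "rk A \<noteq> rk E" "rk A \<le> rk E" using rank_mono by (auto simp: spanning_def)
      then show "0 ^ (rk E - rk A) * [:-1, 1::int:] ^ (card A - rk A) = 0" by simp
    qed
  qed (auto simp: spanning_def rank_empty)
  finally show ?thesis by (simp add: spanning_poly_def)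
qed

lemma homogeneous_linear_forms: "homogeneous (length \<phi>s) (prod_list (map linear_form \<phi>s))"
proof (induction \<phi>s)
  case Nil
  then show ?case using homogeneous_word[of "[]"] by simp
next
  case (Cons \<phi> \<phi>s)
  then show ?case using homogeneous_mult[OF homogeneous_linear_form] by fastforce
qed

end

theorem corollary1p6:
  fixes M :: "nat matroid" and n r i :: nat
  assumes "is_matroid M"
    and "ground M = {0..n}"
    and "loopless M"
    and "matroid_rank M = r + 1"
    and "i \<le> n - r"
  shows "of_int (poly.coeff (poly (tutte M) 1) i) =
    (1 / fact r :: rat) *
      of_int (degree_map M (\<Otimes>\<^bsub>chow_ring M\<^esub> k\<in>{i + 1..i + r}. hypersimplex_class M k))"
proof -
  interpret loopless_matroid M r
    using assms by unfold_locales auto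
  \<comment> \<open>Since \<open>r \<le> n\<close>, the truncated subtraction in the bound on
    \<open>i\<close> is a genuine one.\<close>
  have "r < card {0..n}" using rank_le_card[OF finite_E] assms(2,4) by simp
  then have ir: "i + r \<le> n" using assms(5) by simp
  define \<phi> :: "nat \<Rightarrow> nat set \<Rightarrow> int" where
    "\<phi> = (\<lambda>k F. int (min k (card F)) - int (card (F \<inter> {..<k})))"
  define ks where "ks = [Suc i..<Suc (i + r)]"
  have ks: "set ks = {i + 1..i + r}" "distinct ks" "length ks = r" by (auto simp: ks_def)
  have "hypersimplex_class M k = chow_class M (linear_form (\<phi> k))" for k
    by (simp add: hypersimplex_class_def linear_form_def \<phi>_def)
  then have "(\<Otimes>\<^bsub>chow_ring M\<^esub>k\<in>{i + 1..i + r}. hypersimplex_class M k) =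
      chow_class M (\<Prod>k\<in>{i + 1..i + r}. linear_form (\<phi> k))"
    using chow_class_prod[of "{i + 1..i + r}" "\<lambda>k. linear_form (\<phi> k)"] polys_linear_form by simp
  also have "(\<Prod>k\<in>{i + 1..i + r}. linear_form (\<phi> k)) = prod_list (map linear_form (map \<phi> ks))"
    using prod.distinct_set_conv_list[OF ks(2), of "\<lambda>k. linear_form (\<phi> k)"] ks(1) by (simp add: comp_def)
  finally have prod: "(\<Otimes>\<^bsub>chow_ring M\<^esub>k\<in>{i + 1..i + r}. hypersimplex_class M k) =
      chow_class M (prod_list (map linear_form (map \<phi> ks)))" .
  have carr: "prod_list (map linear_form \<phi>s) \<in> polys" for \<phi>s
    by (induction \<phi>s) (auto intro: polys_mult polys_linear_form)
  have "of_int (degree_map M (chow_class M (prod_list (map linear_form (map \<phi> ks))))) =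
      degree_eval (prod_list (map linear_form (map \<phi> ks)))"
    using degree_map_eval[OF carr] homogeneous_linear_forms[of "map \<phi> ks"] ks(3) by (simp del: map_map)
  also have "\<dots> = inter_num {{}, E} (map flat_fun (map \<phi> ks))"
    using degree_eval_linear_forms[of "[]" "map \<phi> ks"] ks(3) by simp
  also have "\<dots> = inter_num {{}, E} (map trunc_card ks)"
  proof (rule inter_num_cong_affine[OF trivial_flag(1)])
    show "card {{}, E} + length (map trunc_card ks) = r + 2" using trivial_flag(2) ks(3) by simp
    have "\<exists>a c. \<forall>F\<in>flats. flat_fun (\<phi> k) F = trunc_card k F + sum a F + c" if k: "k \<in> set ks" for k
    proof (intro exI ballI)
      fix F assume F: "F \<in> flats"
      then have finF: "finite F" using finite_flat by blast
      \<comment> \<open>The part of the class that depends on the set of size \<open>k\<close> is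
        additive, so it drops out of intersection numbers and the truncated cardinality
        remains.\<close>
      have "(\<Sum>e\<in>F. if e < k then - 1 else 0 :: rat) = - of_nat (card (F \<inter> {..<k}))"
        using finF by (simp add: sum.If_cases lessThan_def)
      moreover have "flat_fun (\<phi> k) F = of_int (\<phi> k F)"
      proof -
        \<comment> \<open>As \<open>k \<le> n\<close>, both terms of \<open>\<phi> k\<close> equal
          \<open>k\<close> on the ground set and cancel, so the extension by zero in
          \<open>flat_fun\<close> agrees with \<open>\<phi> k\<close> on all flats.\<close>
        have "{0..n} \<inter> {..<k} = {..<k}" using k ks(1) ir by auto
        then have "\<phi> k {0..n} = 0" using k ks(1) ir by (simp add: \<phi>_def)
        moreover have "\<phi> k {} = 0" by (simp add: \<phi>_def)
        ultimately show ?thesis using F assms(2) by (auto simp: flat_fun_def PF_iff)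
      qed
      ultimately show "flat_fun (\<phi> k) F = trunc_card k F + (\<Sum>e\<in>F. if e < k then - 1 else 0) + 0"
        by (simp add: \<phi>_def trunc_card_def)
    qed
    then show "list_all2 (\<lambda>\<psi> \<phi>. \<exists>a c. \<forall>F\<in>flats. \<psi> F = \<phi> F + sum a F + c)
        (map flat_fun (map \<phi> ks)) (map trunc_card ks)"
      by (simp add: list_all2_map1 list_all2_map2 list_all2_same)
  qed
  also have "\<dots> = fact r * of_int (poly.coeff (spanning_poly {} E) i)"
  proof -
    have "{} \<subset> E" "card E = Suc n" using assms(2) by auto
    moreover have "F \<subseteq> {} \<or> E \<subseteq> F" if "F \<in> {{}, E}" for F using that by auto
    ultimately show ?thesis
      using inter_num_trunc_card[OF trivial_flag(1), of "{}" E r i] rank_ground rank_empty trivial_flag(2) ir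
      by (simp add: ks_def del: upt_Suc)
  qed
  finally show ?thesis unfolding prod tutte_at_one by simp
qed

end
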